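(* Let $p\ge 2$ be a prime and let $\mathcal C=\underline{(\mathbb Z/p^6)\text{-mod}}$ be the classical stable category, endowed with the shift automorphism and the Verdier triangulation described in the context. Then both diagrams $X$ and $\tilde X$ in $\mathcal C$ described in the context are Verdier octahedra.
   Context: Conventions. Matrices act on row vectors, so the entry in row $r$, column $s$ is the component from the $r$-th summand to the $s$-th summand. Posets. For $n\ge 0$ let $\bar\Delta_n$ be the linearly ordered set of symbols $i^{+z}$ ($0\le i\le n$, $z\in\mathbb Z$), with $i^{+z}\le j^{+w}$ iff $z<w$, or $z=w$ and $i\le j$; write $i$ for $i^{+0}$ and $(i^{+z})^{+w}=i^{+(z+w)}$, $\alpha^{-1}=\alpha^{+(-1)}$. A map $\bar\Delta_m\to\bar\Delta_n$ is periodic monotone if it preserves $\le$ and commutes with $(-)^{+1}$. Let $\bar\Delta_n^\#$ be the poset of pairs $\beta/\alpha$ with $\alpha,\beta\in\bar\Delta_n$, $\beta^{-1}\le\alpha\le\beta\le\alpha^{+1}$, ordered componentwise, with shift $(\beta/\alpha)^{+1}=\alpha^{+1}/\beta$. Let $\bar\Delta_n^{\triangle\triangledown}=\{\beta/\alpha\in\bar\Delta_n^\#:0\le\alpha\le\beta\le 0^{+1}\}$. Pretriangles. Let $\mathcal C$ be a weakly abelian category (additive; every morphism has a weak kernel and a weak cokernel, is a weak kernel and is a weak cokernel) with an automorphism $X\mapsto X^{+1}$ (shift). A weak square is a commutative quadrangle $A\to B$, $A\to C$, $B\to D$, $C\to D$ such that in the sequence $A\to B\oplus C\to D$ (one sign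 inserted) the first morphism is a weak kernel of the second and the second a weak cokernel of the first. An $n$-pretriangle is a functor $X:\bar\Delta_n^\#\to\mathcal C$ such that $X_{\alpha/\alpha}$ and $X_{\alpha^{+1}/\alpha}$ are zero for all $\alpha$, and such that for $\delta^{-1}\le\alpha\le\beta\le\gamma\le\delta\le\alpha^{+1}$ the quadrangle $(X_{\gamma/\alpha},X_{\delta/\alpha},X_{\gamma/\beta},X_{\delta/\beta})$ is a weak square. It is periodic if the diagram $\beta/\alpha\mapsto X_{(\beta/\alpha)^{+1}}$ equals the diagram $\beta/\alpha\mapsto(X_{\beta/\alpha})^{+1}$. For a periodic monotone $q:\bar\Delta_m\to\bar\Delta_n$ put $(Xq^\#)_{\beta/\alpha}=X_{\beta q/\alpha q}$. Verdier octahedra. A periodic $2$-pretriangle $U$ is called a distinguished triangle if $U_{1/0}\to U_{2/0}\to U_{2/1}\to U_{0^{+1}/1}=(U_{1/0})^{+1}$ is a distinguished triangle in the sense of Verdier. A Verdier octahedron is a periodic $3$-pretriangle $X$ such that $Xd^\#$ is a distinguished triangle for every injective periodic monotone map $d:\bar\Delta_2\to\bar\Delta_3$. The category. Let $m=6$. Objects of $\mathcal E=(\mathbb Z/p^m)\text{-mod}$ are the modules $\bigoplus_{i=0}^m(\mathbb Z/p^i)^{\oplus a_i}$, one for each tuple $(a_i)_{0\le i\le m}$ of nonnegative integers; morphisms are $\mathbb Z/p^m$-linear maps. $\mathcal E$ is an abelian Frobenius category; its bijective (i.e. projective and injective) objects are those isomorphic to finite direct sums of copies of $\mathbb Z/p^m$.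 $\mathcal C=\underline{\mathcal E}$ is the quotient of $\mathcal E$ by the bijective objects. Viewing an object as its ordered list of cyclic summands, the distinguished short exact sequence starting in it is the direct sum of the sequences $\mathbb Z/p^i\xrightarrow{p^{m-i}}\mathbb Z/p^m\xrightarrow{1}\mathbb Z/p^{m-i}$ over its summands, the summands of the cokernel term being listed in reversed order. The shift sends the kernel term to the cokernel term of its distinguished sequence, so that on indecomposables $(\mathbb Z/p^i\xrightarrow{a}\mathbb Z/p^j)^{+1}=(\mathbb Z/p^{m-i}\xrightarrow{p^{i-j}a}\mathbb Z/p^{m-j})$, extended to matrices with the order of summands reversed. The morphism $\mathbb Z/p^i\xrightarrow{a}\mathbb Z/p^j$ is zero in $\mathcal C$ iff $p^{\min(m-i,j)}$ divides $a$. The Verdier triangulation on $\mathcal C$: given a morphism $f:X\to Y$ in $\mathcal E$ and the distinguished short exact sequence $X\to B\to X^{+1}$, form the morphism of short exact sequences from it to $Y\to Z\to X^{+1}$ that is $f$ on kernel terms and the identity on cokernel terms (pushout along $f$); the distinguished triangles are those isomorphic in $\mathcal C$ to some $X\xrightarrow{f}Y\to Z\to X^{+1}$ arising in this way. The diagrams. A periodic $3$-pretriangle is specified by its restriction to $\bar\Delta_3^{\triangle\triangledown}$. $X$ has $X_{1/0}=X_{2/0}=X_{3/0}=X_{0^{+1}/1}=X_{0^{+1}/2}=X_{0^{+1}/3}=\mathbb Z/p^3$, $X_{2/1}=X_{3/2}=\mathbb Z/p\oplus\mathbb Z/p^5$, $X_{3/1}=\mathbb Z/p^2\oplus\mathbb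 Z/p^4$, and zero at $\alpha/\alpha$ and at $0^{+1}/0$. Its morphisms are: $1/0\to 2/0$, $2/0\to 3/0$, $0^{+1}/1\to 0^{+1}/2$, $0^{+1}/2\to 0^{+1}/3$ are all $p$; $2/0\to 2/1$ is $(1\;\;p^2)$; $3/0\to 3/1$ is $(1\;\;p)$; $2/1\to 3/1$ is $\left(\begin{smallmatrix}p&0\\0&1\end{smallmatrix}\right)$; $3/1\to 3/2$ is $\left(\begin{smallmatrix}1&0\\0&p\end{smallmatrix}\right)$; $3/1\to 0^{+1}/1$ is $\left(\begin{smallmatrix}-p\\1\end{smallmatrix}\right)$; $3/2\to 0^{+1}/2$ is $\left(\begin{smallmatrix}-p^2\\1\end{smallmatrix}\right)$. The diagram $\tilde X$ has the same objects and morphisms, except that $2/1\to 3/1$ is $\left(\begin{smallmatrix}p&0\\1&1\end{smallmatrix}\right)$ and $3/1\to 3/2$ is $\left(\begin{smallmatrix}1&0\\-1&p\end{smallmatrix}\right)$. *)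

theory Defs
  imports "HOL-Algebra.Module" "HOL-Number_Theory.Residues"
begin

section \<open>The posets\<close>

text \<open>The symbol \<open>i\<^sup>+\<^sup>z\<close> is the pair \<open>(i, z)\<close>; the element \<open>\<beta>/\<alpha>\<close> of the strip is the pair \<open>(\<beta>, \<alpha>)\<close>.\<close>

type_synonym sym = "nat \<times> int"
type_synonym pt = "sym \<times> sym"

definition Dbar :: "nat \<Rightarrow> sym set" where
  "Dbar n = {\<alpha>. fst \<alpha> \<le> n}"

definition sym_le :: "sym \<Rightarrow> sym \<Rightarrow> bool" (infix "\<preceq>" 50) where
  "\<alpha> \<preceq> \<beta> \<longleftrightarrow> snd \<alpha> < snd \<beta> \<or> (snd \<alpha> = snd \<beta> \<and> fst \<alpha> \<le> fst \<beta>)"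

definition sym_shift :: "int \<Rightarrow> sym \<Rightarrow> sym" where
  "sym_shift w \<alpha> = (fst \<alpha>, snd \<alpha> + w)"

definition periodic_monotone :: "nat \<Rightarrow> nat \<Rightarrow> (sym \<Rightarrow> sym) \<Rightarrow> bool" where
  "periodic_monotone m n q \<longleftrightarrow>
     q \<in> Dbar m \<rightarrow> Dbar n \<and>
     (\<forall>\<alpha>\<in>Dbar m. \<forall>\<beta>\<in>Dbar m. \<alpha> \<preceq> \<beta> \<longrightarrow> q \<alpha> \<preceq> q \<beta>) \<and>
     (\<forall>\<alpha>\<in>Dbar m. q (sym_shift 1 \<alpha>) = sym_shift 1 (q \<alpha>))"

definition strip :: "nat \<Rightarrow> pt set" where
  "strip n = {(\<beta>, \<alpha>). \<alpha> \<in> Dbar n \<and> \<beta> \<in> Dbar n \<and>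
     sym_shift (-1) \<beta> \<preceq> \<alpha> \<and> \<alpha> \<preceq> \<beta> \<and> \<beta> \<preceq> sym_shift 1 \<alpha>}"

definition pt_le :: "pt \<Rightarrow> pt \<Rightarrow> bool" (infix "\<sqsubseteq>" 50) where
  "u \<sqsubseteq> v \<longleftrightarrow> fst u \<preceq> fst v \<and> snd u \<preceq> snd v"

definition pt_shift :: "pt \<Rightarrow> pt" where
  "pt_shift u = (sym_shift 1 (snd u), fst u)"

definition triangle_part :: "nat \<Rightarrow> pt set" where
  "triangle_part n = {(\<beta>, \<alpha>) \<in> strip n. (0, 0) \<preceq> \<alpha> \<and> \<alpha> \<preceq> \<beta> \<and> \<beta> \<preceq> (0, 1)}"


section \<open>Additive categories with shift and distinguished triangles\<close>

text \<open>Composition is in diagrammatic order: \<open>Cmp C f g\<close> is \<open>f\<close> followed by \<open>g\<close>.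
  Each morphism belongs to \<open>Mor C A B\<close> for at most one pair of objects.\<close>

record ('o, 'm) acat =
  Obj :: "'o set"
  Mor :: "'o \<Rightarrow> 'o \<Rightarrow> 'm set"
  Cmp :: "'m \<Rightarrow> 'm \<Rightarrow> 'm"
  Idn :: "'o \<Rightarrow> 'm"
  Add :: "'m \<Rightarrow> 'm \<Rightarrow> 'm"
  Neg :: "'m \<Rightarrow> 'm"
  Zer :: "'o \<Rightarrow> 'o \<Rightarrow> 'm"

record ('o, 'm) tcat = "('o, 'm) acat" +
  ShO :: "'o \<Rightarrow> 'o"
  ShM :: "'m \<Rightarrow> 'm"
  Dist :: "'m \<Rightarrow> 'm \<Rightarrow> 'm \<Rightarrow> bool"

definition zero_object :: "('o, 'm, 'z) acat_scheme \<Rightarrow> 'o \<Rightarrow> bool" where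
  "zero_object C A \<longleftrightarrow> A \<in> Obj C \<and>
     (\<forall>B\<in>Obj C. (\<exists>!f. f \<in> Mor C A B) \<and> (\<exists>!f. f \<in> Mor C B A))"

definition isomorphism :: "('o, 'm, 'z) acat_scheme \<Rightarrow> 'o \<Rightarrow> 'o \<Rightarrow> 'm \<Rightarrow> bool" where
  "isomorphism C A B f \<longleftrightarrow> A \<in> Obj C \<and> B \<in> Obj C \<and> f \<in> Mor C A B \<and>
     (\<exists>g\<in>Mor C B A. Cmp C f g = Idn C A \<and> Cmp C g f = Idn C B)"

definition weak_kernel :: "('o, 'm, 'z) acat_scheme \<Rightarrow> 'o \<Rightarrow> 'o \<Rightarrow> 'o \<Rightarrow> 'm \<Rightarrow> 'm \<Rightarrow> bool" where
  "weak_kernel C A B D a d \<longleftrightarrow> a \<in> Mor C A B \<and> d \<in> Mor C B D \<and> Cmp C a d = Zer C A D \<and>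
     (\<forall>T\<in>Obj C. \<forall>t\<in>Mor C T B. Cmp C t d = Zer C T D \<longrightarrow> (\<exists>s\<in>Mor C T A. Cmp C s a = t))"

definition weak_cokernel :: "('o, 'm, 'z) acat_scheme \<Rightarrow> 'o \<Rightarrow> 'o \<Rightarrow> 'o \<Rightarrow> 'm \<Rightarrow> 'm \<Rightarrow> bool" where
  "weak_cokernel C A B D a d \<longleftrightarrow> a \<in> Mor C A B \<and> d \<in> Mor C B D \<and> Cmp C a d = Zer C A D \<and>
     (\<forall>T\<in>Obj C. \<forall>t\<in>Mor C B T. Cmp C a t = Zer C A T \<longrightarrow> (\<exists>s\<in>Mor C D T. Cmp C d s = t))"

definition biproduct ::
  "('o, 'm, 'z) acat_scheme \<Rightarrow> 'o \<Rightarrow> 'o \<Rightarrow> 'o \<Rightarrow> 'm \<Rightarrow> 'm \<Rightarrow> 'm \<Rightarrow> 'm \<Rightarrow> bool" where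
  "biproduct C A B P i1 i2 p1 p2 \<longleftrightarrow> P \<in> Obj C \<and>
     i1 \<in> Mor C A P \<and> i2 \<in> Mor C B P \<and> p1 \<in> Mor C P A \<and> p2 \<in> Mor C P B \<and>
     Cmp C i1 p1 = Idn C A \<and> Cmp C i2 p2 = Idn C B \<and>
     Cmp C i1 p2 = Zer C A B \<and> Cmp C i2 p1 = Zer C B A \<and>
     Add C (Cmp C p1 i1) (Cmp C p2 i2) = Idn C P"

text \<open>The quadrangle with \<open>f : A \<rightarrow> B\<close>, \<open>g : A \<rightarrow> B'\<close>, \<open>h : B \<rightarrow> D\<close>, \<open>k : B' \<rightarrow> D\<close>. The sign is put on \<open>k\<close>.
  Biproducts are unique up to isomorphism, so the choice of \<open>P\<close> does not matter.\<close>

definition weak_square ::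
  "('o, 'm, 'z) acat_scheme \<Rightarrow> 'o \<Rightarrow> 'o \<Rightarrow> 'o \<Rightarrow> 'o \<Rightarrow> 'm \<Rightarrow> 'm \<Rightarrow> 'm \<Rightarrow> 'm \<Rightarrow> bool" where
  "weak_square C A B B' D f g h k \<longleftrightarrow>
     A \<in> Obj C \<and> B \<in> Obj C \<and> B' \<in> Obj C \<and> D \<in> Obj C \<and>
     f \<in> Mor C A B \<and> g \<in> Mor C A B' \<and> h \<in> Mor C B D \<and> k \<in> Mor C B' D \<and>
     Cmp C f h = Cmp C g k \<and>
     (\<exists>P i1 i2 p1 p2. biproduct C B B' P i1 i2 p1 p2 \<and>
        (let a = Add C (Cmp C f i1) (Cmp C g i2);
             d = Add C (Cmp C p1 h) (Cmp C p2 (Neg C k))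
         in weak_kernel C A P D a d \<and> weak_cokernel C A P D a d))"


section \<open>Pretriangles and Verdier octahedra\<close>

record ('o, 'm) diagram =
  DO :: "pt \<Rightarrow> 'o"
  DM :: "pt \<Rightarrow> pt \<Rightarrow> 'm"

definition is_functor :: "('o, 'm, 'z) acat_scheme \<Rightarrow> nat \<Rightarrow> ('o, 'm) diagram \<Rightarrow> bool" where
  "is_functor C n X \<longleftrightarrow>
     (\<forall>u\<in>strip n. DO X u \<in> Obj C \<and> DM X u u = Idn C (DO X u)) \<and>
     (\<forall>u\<in>strip n. \<forall>v\<in>strip n. u \<sqsubseteq> v \<longrightarrow> DM X u v \<in> Mor C (DO X u) (DO X v)) \<and>
     (\<forall>u\<in>strip n. \<forall>v\<in>strip n. \<forall>w\<in>strip n. u \<sqsubseteq> v \<and> v \<sqsubseteq> w \<longrightarrow>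
        Cmp C (DM X u v) (DM X v w) = DM X u w)"

definition pretriangle :: "('o, 'm, 'z) acat_scheme \<Rightarrow> nat \<Rightarrow> ('o, 'm) diagram \<Rightarrow> bool" where
  "pretriangle C n X \<longleftrightarrow> is_functor C n X \<and>
     (\<forall>\<alpha>\<in>Dbar n. zero_object C (DO X (\<alpha>, \<alpha>)) \<and> zero_object C (DO X (sym_shift 1 \<alpha>, \<alpha>))) \<and>
     (\<forall>\<alpha>\<in>Dbar n. \<forall>\<beta>\<in>Dbar n. \<forall>\<gamma>\<in>Dbar n. \<forall>\<delta>\<in>Dbar n.
        sym_shift (-1) \<delta> \<preceq> \<alpha> \<and> \<alpha> \<preceq> \<beta> \<and> \<beta> \<preceq> \<gamma> \<and> \<gamma> \<preceq> \<delta> \<and> \<delta> \<preceq> sym_shift 1 \<alpha> \<longrightarrow>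
        weak_square C (DO X (\<gamma>, \<alpha>)) (DO X (\<delta>, \<alpha>)) (DO X (\<gamma>, \<beta>)) (DO X (\<delta>, \<beta>))
          (DM X (\<gamma>, \<alpha>) (\<delta>, \<alpha>)) (DM X (\<gamma>, \<alpha>) (\<gamma>, \<beta>))
          (DM X (\<delta>, \<alpha>) (\<delta>, \<beta>)) (DM X (\<gamma>, \<beta>) (\<delta>, \<beta>)))"

definition periodic :: "('o, 'm, 'z) tcat_scheme \<Rightarrow> nat \<Rightarrow> ('o, 'm) diagram \<Rightarrow> bool" where
  "periodic C n X \<longleftrightarrow>
     (\<forall>u\<in>strip n. DO X (pt_shift u) = ShO C (DO X u)) \<and>
     (\<forall>u\<in>strip n. \<forall>v\<in>strip n. u \<sqsubseteq> v \<longrightarrow> DM X (pt_shift u) (pt_shift v) = ShM C (DM X u v))"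

definition pullback_diagram :: "('o, 'm) diagram \<Rightarrow> (sym \<Rightarrow> sym) \<Rightarrow> ('o, 'm) diagram" where
  "pullback_diagram X q =
     \<lparr>DO = (\<lambda>u. DO X (map_prod q q u)),
      DM = (\<lambda>u v. DM X (map_prod q q u) (map_prod q q v))\<rparr>"

text \<open>\<open>fr j i\<close> is \<open>j/i\<close>, and \<open>fr1 i\<close> is \<open>0\<^sup>+\<^sup>1/i\<close>.\<close>

abbreviation fr :: "nat \<Rightarrow> nat \<Rightarrow> pt" where "fr j i \<equiv> ((j, 0), (i, 0))"
abbreviation fr1 :: "nat \<Rightarrow> pt" where "fr1 i \<equiv> ((0, 1), (i, 0))"

definition distinguished_triangle :: "('o, 'm, 'z) tcat_scheme \<Rightarrow> ('o, 'm) diagram \<Rightarrow> bool" where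
  "distinguished_triangle C U \<longleftrightarrow> pretriangle C 2 U \<and> periodic C 2 U \<and>
     Dist C (DM U (fr 1 0) (fr 2 0)) (DM U (fr 2 0) (fr 2 1)) (DM U (fr 2 1) (fr1 1))"

definition verdier_octahedron :: "('o, 'm, 'z) tcat_scheme \<Rightarrow> ('o, 'm) diagram \<Rightarrow> bool" where
  "verdier_octahedron C X \<longleftrightarrow> pretriangle C 3 X \<and> periodic C 3 X \<and>
     (\<forall>d. periodic_monotone 2 3 d \<and> inj_on d (Dbar 2) \<longrightarrow>
        distinguished_triangle C (pullback_diagram X d))"


section \<open>The module category\<close>

text \<open>The object \<open>\<Oplus>\<^sub>i (\<int>/p\<^sup>i)\<^sup>a\<^sup>i\<close> is the list \<open>[a\<^sub>0, \<dots>, a\<^sub>m]\<close>.\<close>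

type_synonym obj = "nat list"
type_synonym fn = "int list \<Rightarrow> int list"

definition E_obj :: "nat \<Rightarrow> obj set" where
  "E_obj m = {a. length a = Suc m}"

definition summands :: "obj \<Rightarrow> nat list" where
  "summands a = concat (map (\<lambda>i. replicate (a ! i) i) [0..<length a])"

text \<open>The object with the summands \<open>\<int>/p\<^sup>e\<close> for \<open>e\<close> in the list \<open>es\<close>.\<close>

definition dsum :: "nat \<Rightarrow> nat list \<Rightarrow> obj" where
  "dsum m es = map (count_list es) [0..<Suc m]"

definition reduce :: "nat \<Rightarrow> obj \<Rightarrow> int list \<Rightarrow> int list" where
  "reduce p a x = map2 (\<lambda>e t. t mod int p ^ e) (summands a) x"

text \<open>An element of the object is the list of its components, that of a summand \<open>\<int>/p\<^sup>e\<close> being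
  represented in \<open>{0..<p\<^sup>e}\<close>. The ring multiplication of the record is not used.\<close>

definition E_mod :: "nat \<Rightarrow> obj \<Rightarrow> (int, int list) module" where
  "E_mod p a =
     \<lparr>carrier = {x. length x = length (summands a) \<and>
        (\<forall>k<length x. 0 \<le> x ! k \<and> x ! k < int p ^ (summands a ! k))},
      monoid.mult = undefined, one = undefined,
      zero = replicate (length (summands a)) 0,
      add = (\<lambda>x y. reduce p a (map2 (+) x y)),
      smult = (\<lambda>r x. reduce p a (map ((*) r) x))\<rparr>"

definition linear_maps ::
  "('r, 's) ring_scheme \<Rightarrow> ('r, 'a, 't) module_scheme \<Rightarrow> ('r, 'b, 'u) module_scheme \<Rightarrow> ('a \<Rightarrow> 'b) set" where
  "linear_maps R M N = {f \<in> carrier M \<rightarrow>\<^sub>E carrier N. f \<in> hom (add_monoid M) (add_monoid N) \<and>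
     (\<forall>r\<in>carrier R. \<forall>x\<in>carrier M. f (r \<odot>\<^bsub>M\<^esub> x) = r \<odot>\<^bsub>N\<^esub> f x)}"

definition E_hom :: "nat \<Rightarrow> nat \<Rightarrow> obj \<Rightarrow> obj \<Rightarrow> fn set" where
  "E_hom p m a b = linear_maps (residue_ring (int p ^ m)) (E_mod p a) (E_mod p b)"

definition E_comp :: "nat \<Rightarrow> obj \<Rightarrow> fn \<Rightarrow> fn \<Rightarrow> fn" where
  "E_comp p a f g = compose (carrier (E_mod p a)) g f"

text \<open>The linear map \<open>x \<mapsto> x M\<close> on row vectors; \<open>M\<close> is the list of its rows.\<close>

definition lin :: "nat \<Rightarrow> obj \<Rightarrow> obj \<Rightarrow> int list list \<Rightarrow> fn" where
  "lin p a b M = restrict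
     (\<lambda>x. reduce p b (map (\<lambda>s. \<Sum>r<length (summands a). x ! r * M ! r ! s) [0..<length (summands b)]))
     (carrier (E_mod p a))"

definition projective_obj :: "nat \<Rightarrow> nat \<Rightarrow> obj \<Rightarrow> bool" where
  "projective_obj p m N \<longleftrightarrow> N \<in> E_obj m \<and>
     (\<forall>a\<in>E_obj m. \<forall>b\<in>E_obj m. \<forall>g\<in>E_hom p m a b. \<forall>f\<in>E_hom p m N b.
        g ` carrier (E_mod p a) = carrier (E_mod p b) \<longrightarrow> (\<exists>h\<in>E_hom p m N a. E_comp p N h g = f))"

definition injective_obj :: "nat \<Rightarrow> nat \<Rightarrow> obj \<Rightarrow> bool" where
  "injective_obj p m N \<longleftrightarrow> N \<in> E_obj m \<and>
     (\<forall>a\<in>E_obj m. \<forall>b\<in>E_obj m. \<forall>g\<in>E_hom p m a b. \<forall>f\<in>E_hom p m a N.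
        inj_on g (carrier (E_mod p a)) \<longrightarrow> (\<exists>h\<in>E_hom p m b N. E_comp p a g h = f))"

definition bijective_obj :: "nat \<Rightarrow> nat \<Rightarrow> obj \<Rightarrow> bool" where
  "bijective_obj p m N \<longleftrightarrow> projective_obj p m N \<and> injective_obj p m N"

definition short_exact :: "nat \<Rightarrow> nat \<Rightarrow> obj \<Rightarrow> obj \<Rightarrow> obj \<Rightarrow> fn \<Rightarrow> fn \<Rightarrow> bool" where
  "short_exact p m a b c g h \<longleftrightarrow> g \<in> E_hom p m a b \<and> h \<in> E_hom p m b c \<and>
     inj_on g (carrier (E_mod p a)) \<and>
     h ` carrier (E_mod p b) = carrier (E_mod p c) \<and>
     g ` carrier (E_mod p a) = {x \<in> carrier (E_mod p b). h x = \<zero>\<^bsub>E_mod p c\<^esub>}"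

text \<open>The distinguished short exact sequence \<open>a \<rightarrow> mid m a \<rightarrow> rev a\<close>. Reversing the multiplicities
  turns the summands \<open>\<int>/p\<^sup>i\<close> into \<open>\<int>/p\<^sup>m\<^sup>-\<^sup>i\<close> and reverses their order.\<close>

definition mid :: "nat \<Rightarrow> obj \<Rightarrow> obj" where
  "mid m a = dsum m (replicate (length (summands a)) m)"

definition infl :: "nat \<Rightarrow> nat \<Rightarrow> obj \<Rightarrow> fn" where
  "infl p m a = restrict (map2 (\<lambda>i t. int p ^ (m - i) * t) (summands a)) (carrier (E_mod p a))"

definition defl :: "nat \<Rightarrow> nat \<Rightarrow> obj \<Rightarrow> fn" where
  "defl p m a = restrict (\<lambda>x. rev (map2 (\<lambda>i t. t mod int p ^ (m - i)) (summands a) x))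
     (carrier (E_mod p (mid m a)))"


section \<open>The stable category\<close>

text \<open>Two linear maps are related iff their difference factors through a bijective object.\<close>

definition stab :: "nat \<Rightarrow> nat \<Rightarrow> obj \<Rightarrow> obj \<Rightarrow> (fn \<times> fn) set" where
  "stab p m a b = {(f, g). f \<in> E_hom p m a b \<and> g \<in> E_hom p m a b \<and>
     (\<exists>N u v. bijective_obj p m N \<and> u \<in> E_hom p m a N \<and> v \<in> E_hom p m N b \<and>
        (\<forall>x\<in>carrier (E_mod p a). f x = g x \<oplus>\<^bsub>E_mod p b\<^esub> v (u x)))}"

text \<open>A morphism is a triple of source, target and residue class of linear maps.\<close>

type_synonym arr = "obj \<times> obj \<times> fn set"

definition cls :: "nat \<Rightarrow> nat \<Rightarrow> obj \<Rightarrow> obj \<Rightarrow> fn \<Rightarrow> arr" where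
  "cls p m a b f = (a, b, stab p m a b `` {f})"

definition stable_acat :: "nat \<Rightarrow> nat \<Rightarrow> (obj, arr) acat" where
  "stable_acat p m =
     \<lparr>Obj = E_obj m,
      Mor = (\<lambda>a b. {a} \<times> {b} \<times> (E_hom p m a b // stab p m a b)),
      Cmp = (\<lambda>(a, b, F) (b', c, G). (a, c, \<Union>f\<in>F. \<Union>g\<in>G. stab p m a c `` {E_comp p a f g})),
      Idn = (\<lambda>a. cls p m a a (\<lambda>x\<in>carrier (E_mod p a). x)),
      Add = (\<lambda>(a, b, F) (a', b', G). (a, b, \<Union>f\<in>F. \<Union>g\<in>G.
               stab p m a b `` {\<lambda>x\<in>carrier (E_mod p a). f x \<oplus>\<^bsub>E_mod p b\<^esub> g x})),
      Neg = (\<lambda>(a, b, F). (a, b, \<Union>f\<in>F.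
               stab p m a b `` {\<lambda>x\<in>carrier (E_mod p a). \<ominus>\<^bsub>E_mod p b\<^esub> f x})),
      Zer = (\<lambda>a b. cls p m a b (\<lambda>x\<in>carrier (E_mod p a). \<zero>\<^bsub>E_mod p b\<^esub>))\<rparr>"

text \<open>The linear maps \<open>g\<close> on cokernel terms induced by a representative \<open>f\<close>, for all choices of \<open>f\<close>
  and of the map \<open>h\<close> on middle terms; they form one residue class.\<close>

definition stable_shift :: "nat \<Rightarrow> nat \<Rightarrow> arr \<Rightarrow> arr" where
  "stable_shift p m = (\<lambda>(a, b, F). (rev a, rev b,
     {g \<in> E_hom p m (rev a) (rev b). \<exists>f\<in>F. \<exists>h\<in>E_hom p m (mid m a) (mid m b).
        E_comp p a (infl p m a) h = E_comp p a f (infl p m b) \<and>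
        E_comp p (mid m a) h (defl p m b) = E_comp p (mid m a) (defl p m a) g}))"

definition standard_triangle ::
  "nat \<Rightarrow> nat \<Rightarrow> obj \<Rightarrow> obj \<Rightarrow> obj \<Rightarrow> fn \<Rightarrow> fn \<Rightarrow> fn \<Rightarrow> bool" where
  "standard_triangle p m a b c f g h \<longleftrightarrow>
     a \<in> E_obj m \<and> b \<in> E_obj m \<and> c \<in> E_obj m \<and>
     f \<in> E_hom p m a b \<and> short_exact p m b c (rev a) g h \<and>
     (\<exists>k\<in>E_hom p m (mid m a) c.
        E_comp p a (infl p m a) k = E_comp p a f g \<and>
        E_comp p (mid m a) k h = defl p m a)"

definition stable_dist :: "nat \<Rightarrow> nat \<Rightarrow> arr \<Rightarrow> arr \<Rightarrow> arr \<Rightarrow> bool" where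
  "stable_dist p m F G H \<longleftrightarrow> (let C = stable_acat p m in
     \<exists>a b c f g h a' b' c' u v w. standard_triangle p m a b c f g h \<and>
       a' \<in> Obj C \<and> b' \<in> Obj C \<and> c' \<in> Obj C \<and>
       F \<in> Mor C a' b' \<and> G \<in> Mor C b' c' \<and> H \<in> Mor C c' (rev a') \<and>
       isomorphism C a' a u \<and> isomorphism C b' b v \<and> isomorphism C c' c w \<and>
       Cmp C F v = Cmp C u (cls p m a b f) \<and>
       Cmp C G w = Cmp C v (cls p m b c g) \<and>
       Cmp C H (stable_shift p m u) = Cmp C w (cls p m c (rev a) h))"

definition stable_cat :: "nat \<Rightarrow> nat \<Rightarrow> (obj, arr) tcat" where
  "stable_cat p m = acat.extend (stable_acat p m)
     (tcat.fields rev (stable_shift p m) (stable_dist p m))"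


section \<open>The two diagrams\<close>

definition mat_arr :: "nat \<Rightarrow> nat list \<Rightarrow> nat list \<Rightarrow> int list list \<Rightarrow> arr" where
  "mat_arr p es fs M = cls p 6 (dsum 6 es) (dsum 6 fs) (lin p (dsum 6 es) (dsum 6 fs) M)"

text \<open>The values on the triangle part \<open>0 \<le> \<alpha> \<le> \<beta> \<le> 0\<^sup>+\<^sup>1\<close>, where \<open>P\<close> and \<open>Q\<close> are the matrices
  of \<open>2/1 \<rightarrow> 3/1\<close> and \<open>3/1 \<rightarrow> 3/2\<close>.\<close>

definition octahedron_data ::
  "nat \<Rightarrow> int list list \<Rightarrow> int list list \<Rightarrow> (obj, arr) diagram \<Rightarrow> bool" where
  "octahedron_data p P Q X \<longleftrightarrow> (let q = int p in
     (\<forall>\<alpha>. (\<alpha>, \<alpha>) \<in> triangle_part 3 \<longrightarrow> DO X (\<alpha>, \<alpha>) = dsum 6 []) \<and> DO X (fr1 0) = dsum 6 [] \<and>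
     (\<forall>u\<in>{fr 1 0, fr 2 0, fr 3 0, fr1 1, fr1 2, fr1 3}. DO X u = dsum 6 [3]) \<and>
     DO X (fr 2 1) = dsum 6 [1, 5] \<and> DO X (fr 3 2) = dsum 6 [1, 5] \<and>
     DO X (fr 3 1) = dsum 6 [2, 4] \<and>
     DM X (fr 1 0) (fr 2 0) = mat_arr p [3] [3] [[q]] \<and>
     DM X (fr 2 0) (fr 3 0) = mat_arr p [3] [3] [[q]] \<and>
     DM X (fr1 1) (fr1 2) = mat_arr p [3] [3] [[q]] \<and>
     DM X (fr1 2) (fr1 3) = mat_arr p [3] [3] [[q]] \<and>
     DM X (fr 2 0) (fr 2 1) = mat_arr p [3] [1, 5] [[1, q^2]] \<and>
     DM X (fr 3 0) (fr 3 1) = mat_arr p [3] [2, 4] [[1, q]] \<and>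
     DM X (fr 2 1) (fr 3 1) = mat_arr p [1, 5] [2, 4] P \<and>
     DM X (fr 3 1) (fr 3 2) = mat_arr p [2, 4] [1, 5] Q \<and>
     DM X (fr 3 1) (fr1 1) = mat_arr p [2, 4] [3] [[- q], [1]] \<and>
     DM X (fr 3 2) (fr1 2) = mat_arr p [1, 5] [3] [[- (q^2)], [1]])"

text \<open>A periodic diagram on the whole strip is given by its restriction to the triangle part, since the
  shifts of the latter cover the strip and the maps into and out of zero objects are unique.\<close>

definition is_X :: "nat \<Rightarrow> (obj, arr) diagram \<Rightarrow> bool" where
  "is_X p X \<longleftrightarrow> is_functor (stable_cat p 6) 3 X \<and> periodic (stable_cat p 6) 3 X \<and>
     octahedron_data p [[int p, 0], [0, 1]] [[1, 0], [0, int p]] X"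

definition is_Xtilde :: "nat \<Rightarrow> (obj, arr) diagram \<Rightarrow> bool" where
  "is_Xtilde p X \<longleftrightarrow> is_functor (stable_cat p 6) 3 X \<and> periodic (stable_cat p 6) 3 X \<and>
     octahedron_data p [[int p, 0], [1, 1]] [[1, 0], [-1, int p]] X"

end

theory Submission
  imports Defs "HOL-Combinatorics.Permutations"
begin

text \<open>
  A morphism of the stable category between sums of cyclic modules is an integer matrix whose entry from
  \<open>\<int>/p\<^sup>e\<close> to \<open>\<int>/p\<^sup>f\<close> matters only modulo \<open>p\<close> to the power \<open>min (m - e) f\<close>, because a map is stably zero iff it
  extends along the distinguished monomorphism. The diagrams \<open>X\<close> and \<open>X~\<close> are the members \<open>t = 0\<close> and \<open>t = 1\<close>
  of the family with \<open>2/1 \<rightarrow> 3/1\<close> given by the rows \<open>(p, 0)\<close>, \<open>(t, 1)\<close> and \<open>3/1 \<rightarrow> 3/2\<close> by \<open>(1, 0)\<close>, \<open>(-t, p)\<close>, and every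
  argument works for all integers \<open>t\<close>.

  Since the double shift is the identity on matrices, everything depends only on positions modulo \<open>4\<close>.
  The nondegenerate weak squares reduce to four squares that are bicartesian already between the modules,
  and a bicartesian square is a short exact sequence, which is a weak kernel-cokernel pair by lifting through
  projectives and extending to injectives. The distinguished triangles reduce to nine explicit pushouts. The
  degenerate weak squares are the exactness of these triangles.
\<close>

section \<open>Weak squares in additive categories\<close>

text \<open>\<open>is_X\<close> and \<open>is_Xtilde\<close> prescribe finitely many values, while
  the claim concerns every periodic functor with these values and the existence of one. Both are
  settled by a single model on all pairs of integers, built from unit steps \<open>R\<close> and
  \<open>V\<close>. It is the witness, and every other such functor has the same unit steps inside
  the strip: beyond the triangle part they are shifts of known steps, and at smaller positions they
  are recovered because the shift is injective on stable morphisms.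

  Two obstacles shape the matrices. The shift reverses the summands and rescales the entries, so a
  second pair \<open>P'\<close>, \<open>Q'\<close> is needed, in which \<open>t\<close> turns into
  \<open>t * q ^ 3\<close>. Moreover, the pushout that computes a cone may be larger than the object
  in the octahedron; its free summand is split off by an explicit stable isomorphism.

  Exactness in the middle of a sequence of modules is not computed from matrices. Joint injectivity,
  joint surjectivity and a comparison of orders give it, since the modules are finite. Every square
  and every triangle is thereby certified by integer matrices, and what remains is divisibility of
  expressions in \<open>q\<close> and \<open>t\<close> by powers of \<open>q\<close>.\<close>

locale additive_category =
  fixes C :: "('o, 'm, 'z) acat_scheme"
  assumes Cmp_closed: "A \<in> Obj C \<Longrightarrow> B \<in> Obj C \<Longrightarrow> D \<in> Obj C \<Longrightarrow> f \<in> Mor C A B \<Longrightarrow> g \<in> Mor C B D \<Longrightarrow> Cmp C f g \<in> Mor C A D"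
    and Cmp_assoc: "A \<in> Obj C \<Longrightarrow> B \<in> Obj C \<Longrightarrow> D \<in> Obj C \<Longrightarrow> E \<in> Obj C \<Longrightarrow>
      f \<in> Mor C A B \<Longrightarrow> g \<in> Mor C B D \<Longrightarrow> h \<in> Mor C D E \<Longrightarrow> Cmp C (Cmp C f g) h = Cmp C f (Cmp C g h)"
    and Idn_closed: "A \<in> Obj C \<Longrightarrow> Idn C A \<in> Mor C A A"
    and Idn_left: "A \<in> Obj C \<Longrightarrow> B \<in> Obj C \<Longrightarrow> f \<in> Mor C A B \<Longrightarrow> Cmp C (Idn C A) f = f"
    and Idn_right: "A \<in> Obj C \<Longrightarrow> B \<in> Obj C \<Longrightarrow> f \<in> Mor C A B \<Longrightarrow> Cmp C f (Idn C B) = f"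
    and Add_closed: "A \<in> Obj C \<Longrightarrow> B \<in> Obj C \<Longrightarrow> f \<in> Mor C A B \<Longrightarrow> g \<in> Mor C A B \<Longrightarrow> Add C f g \<in> Mor C A B"
    and Neg_closed: "A \<in> Obj C \<Longrightarrow> B \<in> Obj C \<Longrightarrow> f \<in> Mor C A B \<Longrightarrow> Neg C f \<in> Mor C A B"
    and Zer_closed: "A \<in> Obj C \<Longrightarrow> B \<in> Obj C \<Longrightarrow> Zer C A B \<in> Mor C A B"
    and Add_assoc: "A \<in> Obj C \<Longrightarrow> B \<in> Obj C \<Longrightarrow> f \<in> Mor C A B \<Longrightarrow> g \<in> Mor C A B \<Longrightarrow> h \<in> Mor C A B \<Longrightarrow>
      Add C (Add C f g) h = Add C f (Add C g h)"
    and Add_comm: "A \<in> Obj C \<Longrightarrow> B \<in> Obj C \<Longrightarrow> f \<in> Mor C A B \<Longrightarrow> g \<in> Mor C A B \<Longrightarrow> Add C f g = Add C g f"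
    and Add_Zer: "A \<in> Obj C \<Longrightarrow> B \<in> Obj C \<Longrightarrow> f \<in> Mor C A B \<Longrightarrow> Add C f (Zer C A B) = f"
    and Add_Neg: "A \<in> Obj C \<Longrightarrow> B \<in> Obj C \<Longrightarrow> f \<in> Mor C A B \<Longrightarrow> Add C f (Neg C f) = Zer C A B"
    and Cmp_Add_left: "A \<in> Obj C \<Longrightarrow> B \<in> Obj C \<Longrightarrow> D \<in> Obj C \<Longrightarrow> f \<in> Mor C A B \<Longrightarrow> g \<in> Mor C A B \<Longrightarrow> h \<in> Mor C B D \<Longrightarrow>
      Cmp C (Add C f g) h = Add C (Cmp C f h) (Cmp C g h)"
    and Cmp_Add_right: "A \<in> Obj C \<Longrightarrow> B \<in> Obj C \<Longrightarrow> D \<in> Obj C \<Longrightarrow> f \<in> Mor C A B \<Longrightarrow> g \<in> Mor C B D \<Longrightarrow> h \<in> Mor C B D \<Longrightarrow>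
      Cmp C f (Add C g h) = Add C (Cmp C f g) (Cmp C f h)"
    and ex_biproduct: "A \<in> Obj C \<Longrightarrow> B \<in> Obj C \<Longrightarrow> \<exists>P i1 i2 p1 p2. biproduct C A B P i1 i2 p1 p2"
begin

lemma Zer_Add: "A \<in> Obj C \<Longrightarrow> B \<in> Obj C \<Longrightarrow> f \<in> Mor C A B \<Longrightarrow> Add C (Zer C A B) f = f"
  by (metis Add_comm Add_Zer Zer_closed)

lemma Add_Neg_cancel:
  assumes "A \<in> Obj C" "B \<in> Obj C" "f \<in> Mor C A B" "g \<in> Mor C A B"
  shows "Add C (Add C f g) (Neg C g) = f"
  using assms by (metis Add_assoc Add_Neg Add_Zer Neg_closed)

lemma Neg_unique:
  assumes "A \<in> Obj C" "B \<in> Obj C" "f \<in> Mor C A B" "g \<in> Mor C A B" "Add C f g = Zer C A B"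
  shows "g = Neg C f"
  using assms by (metis Add_Neg_cancel Add_comm Neg_closed Zer_Add)

lemma Add_idem_Zer:
  assumes "A \<in> Obj C" "B \<in> Obj C" "f \<in> Mor C A B" "Add C f f = f"
  shows "f = Zer C A B"
  using assms by (metis Add_Neg_cancel Add_Neg)

lemma Zer_Cmp:
  assumes "A \<in> Obj C" "B \<in> Obj C" "D \<in> Obj C" "g \<in> Mor C B D"
  shows "Cmp C (Zer C A B) g = Zer C A D"
proof (rule Add_idem_Zer)
  show "Cmp C (Zer C A B) g \<in> Mor C A D" using assms by (intro Cmp_closed[of A B D] Zer_closed)
  show "Add C (Cmp C (Zer C A B) g) (Cmp C (Zer C A B) g) = Cmp C (Zer C A B) g"
    using assms Cmp_Add_left[of A B D "Zer C A B" "Zer C A B" g] by (simp add: Add_Zer Zer_closed)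
qed fact+

lemma Cmp_Zer:
  assumes "A \<in> Obj C" "B \<in> Obj C" "D \<in> Obj C" "f \<in> Mor C A B"
  shows "Cmp C f (Zer C B D) = Zer C A D"
proof (rule Add_idem_Zer)
  show "Cmp C f (Zer C B D) \<in> Mor C A D" using assms by (intro Cmp_closed[of A B D] Zer_closed)
  show "Add C (Cmp C f (Zer C B D)) (Cmp C f (Zer C B D)) = Cmp C f (Zer C B D)"
    using assms Cmp_Add_right[of A B D f "Zer C B D" "Zer C B D"] by (simp add: Add_Zer Zer_closed)
qed fact+

lemma Cmp_Neg:
  assumes "A \<in> Obj C" "B \<in> Obj C" "D \<in> Obj C" "f \<in> Mor C A B" "g \<in> Mor C B D"
  shows "Cmp C f (Neg C g) = Neg C (Cmp C f g)"
proof (rule Neg_unique[of A D])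
  show "Add C (Cmp C f g) (Cmp C f (Neg C g)) = Zer C A D"
    using assms Cmp_Add_right[of A B D f g "Neg C g"] by (simp add: Add_Neg Neg_closed Cmp_Zer)
qed (use assms in \<open>auto intro: Cmp_closed[of A B D] Neg_closed\<close>)

lemma Neg_Cmp:
  assumes "A \<in> Obj C" "B \<in> Obj C" "D \<in> Obj C" "f \<in> Mor C A B" "g \<in> Mor C B D"
  shows "Cmp C (Neg C f) g = Neg C (Cmp C f g)"
proof (rule Neg_unique[of A D])
  show "Add C (Cmp C f g) (Cmp C (Neg C f) g) = Zer C A D"
    using assms Cmp_Add_left[of A B D f "Neg C f" g] by (simp add: Add_Neg Neg_closed Zer_Cmp)
qed (use assms in \<open>auto intro: Cmp_closed[of A B D] Neg_closed\<close>)

lemma Neg_Neg: "A \<in> Obj C \<Longrightarrow> B \<in> Obj C \<Longrightarrow> f \<in> Mor C A B \<Longrightarrow> Neg C (Neg C f) = f"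
  by (metis Neg_unique Add_Neg Add_comm Neg_closed)

lemma Neg_Zer: "A \<in> Obj C \<Longrightarrow> B \<in> Obj C \<Longrightarrow> Neg C (Zer C A B) = Zer C A B"
  by (metis Zer_Add Add_Neg Neg_closed Zer_closed)

lemma Neg_eq_Zer: "A \<in> Obj C \<Longrightarrow> B \<in> Obj C \<Longrightarrow> f \<in> Mor C A B \<Longrightarrow> Neg C f = Zer C A B \<Longrightarrow> f = Zer C A B"
  by (metis Neg_Neg Neg_Zer)

lemma zero_object_from: "zero_object C A \<Longrightarrow> B \<in> Obj C \<Longrightarrow> f \<in> Mor C A B \<Longrightarrow> f = Zer C A B"
  unfolding zero_object_def using Zer_closed by blast

lemma zero_object_to: "zero_object C B \<Longrightarrow> A \<in> Obj C \<Longrightarrow> f \<in> Mor C A B \<Longrightarrow> f = Zer C A B"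
  unfolding zero_object_def using Zer_closed by blast

section \<open>Exact pairs and their invariance\<close>

definition exact_pair :: "'o \<Rightarrow> 'o \<Rightarrow> 'o \<Rightarrow> 'm \<Rightarrow> 'm \<Rightarrow> bool" where
  "exact_pair A B D a d \<longleftrightarrow> weak_kernel C A B D a d \<and> weak_cokernel C A B D a d"

lemma exact_pairI:
  assumes "a \<in> Mor C A B" "d \<in> Mor C B D" "Cmp C a d = Zer C A D"
    and "\<And>T t. T \<in> Obj C \<Longrightarrow> t \<in> Mor C T B \<Longrightarrow> Cmp C t d = Zer C T D \<Longrightarrow> \<exists>s\<in>Mor C T A. Cmp C s a = t"
    and "\<And>T t. T \<in> Obj C \<Longrightarrow> t \<in> Mor C B T \<Longrightarrow> Cmp C a t = Zer C A T \<Longrightarrow> \<exists>s\<in>Mor C D T. Cmp C d s = t"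
  shows "exact_pair A B D a d"
  using assms by (auto simp: exact_pair_def weak_kernel_def weak_cokernel_def)

lemma exact_pairD:
  assumes "exact_pair A B D a d"
  shows "a \<in> Mor C A B" "d \<in> Mor C B D" "Cmp C a d = Zer C A D"
    and "\<And>T t. T \<in> Obj C \<Longrightarrow> t \<in> Mor C T B \<Longrightarrow> Cmp C t d = Zer C T D \<Longrightarrow> \<exists>s\<in>Mor C T A. Cmp C s a = t"
    and "\<And>T t. T \<in> Obj C \<Longrightarrow> t \<in> Mor C B T \<Longrightarrow> Cmp C a t = Zer C A T \<Longrightarrow> \<exists>s\<in>Mor C D T. Cmp C d s = t"
  using assms by (auto simp: exact_pair_def weak_kernel_def weak_cokernel_def)

text \<open>All test morphisms at a zero object are zero, so the zero morphism factors them. This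
  settles those degenerate squares in which the middle object vanishes as well.\<close>

lemma exact_pair_zero_middle:
  assumes "zero_object C B" "A \<in> Obj C" "D \<in> Obj C" "a \<in> Mor C A B" "d \<in> Mor C B D"
  shows "exact_pair A B D a d"
proof (rule exact_pairI)
  have B: "B \<in> Obj C" using assms by (simp add: zero_object_def)
  show "Cmp C a d = Zer C A D" using assms B zero_object_to[of B A a] by (simp add: Zer_Cmp)
  show "\<exists>s\<in>Mor C T A. Cmp C s a = t" if "T \<in> Obj C" "t \<in> Mor C T B" for T t
    using that assms B zero_object_to[of B A a] zero_object_to[of B T t]
    by (intro bexI[of _ "Zer C T A"]) (auto simp: Zer_Cmp Zer_closed)
  show "\<exists>s\<in>Mor C D T. Cmp C d s = t" if "T \<in> Obj C" "t \<in> Mor C B T" for T t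
    using that assms B zero_object_from[of B D d] zero_object_from[of B T t]
    by (intro bexI[of _ "Zer C D T"]) (auto simp: Zer_Cmp Zer_closed)
qed fact+

text \<open>The sign in \<open>weak_square\<close> sits on one particular edge; exactness does not
  depend on that choice, because the factorizing morphisms can absorb the sign.\<close>

lemma exact_pair_Neg:
  assumes A: "A \<in> Obj C" "B \<in> Obj C" "D \<in> Obj C" and e: "exact_pair A B D a d"
  shows "exact_pair A B D a (Neg C d)"
proof (rule exact_pairI)
  note e' = exact_pairD[OF e]
  show "a \<in> Mor C A B" by (rule e')
  show "Neg C d \<in> Mor C B D" using A e' by (intro Neg_closed)
  show "Cmp C a (Neg C d) = Zer C A D" using A e' by (simp add: Cmp_Neg[of A B D] Neg_Zer)
  show "\<exists>s\<in>Mor C T A. Cmp C s a = t" if "T \<in> Obj C" "t \<in> Mor C T B" "Cmp C t (Neg C d) = Zer C T D" for T t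
  proof (rule e'(4)[OF that(1,2)])
    show "Cmp C t d = Zer C T D"
      using that A e' Cmp_Neg[of T B D t d] Neg_eq_Zer[of T D "Cmp C t d"] Cmp_closed[of T B D t d] by simp
  qed
  show "\<exists>s\<in>Mor C D T. Cmp C (Neg C d) s = t" if T: "T \<in> Obj C" "t \<in> Mor C B T" "Cmp C a t = Zer C A T" for T t
  proof -
    obtain s where s: "s \<in> Mor C D T" "Cmp C d s = t" using e'(5) T by blast
    then have "Cmp C (Neg C d) (Neg C s) = t"
      using T A e' Cmp_closed[of B D T d s]
      by (simp add: Neg_Cmp[of B D T] Cmp_Neg[of B D T] Neg_closed Neg_Neg[of B T])
    then show ?thesis using s T A by (intro bexI[of _ "Neg C s"] Neg_closed)
  qed
qed

lemma isomorphism_Idn: "A \<in> Obj C \<Longrightarrow> isomorphism C A A (Idn C A)"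
  unfolding isomorphism_def by (auto simp: Idn_closed Idn_left[of A A] intro!: bexI[of _ "Idn C A"])

text \<open>Needed because distinguished triangles are only isomorphic to standard ones. A test
  morphism is carried over to the primed sequence, factored there and carried back by the inverse
  isomorphisms.\<close>

lemma exact_pair_transport:
  assumes u: "isomorphism C A A' u" and v: "isomorphism C B B' v" and w: "isomorphism C D D' w"
    and f: "f \<in> Mor C A B" "Cmp C f v = Cmp C u f'" and g: "g \<in> Mor C B D" "Cmp C g w = Cmp C v g'"
    and e: "exact_pair A' B' D' f' g'"
  shows "exact_pair A B D f g"
proof -
  note e' = exact_pairD[OF e]
  obtain u' where u': "u' \<in> Mor C A' A" "Cmp C u u' = Idn C A" "Cmp C u' u = Idn C A'"
    and O1: "A \<in> Obj C" "A' \<in> Obj C" "u \<in> Mor C A A'" using u by (auto simp: isomorphism_def)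
  obtain v' where v': "v' \<in> Mor C B' B" "Cmp C v v' = Idn C B" "Cmp C v' v = Idn C B'"
    and O2: "B \<in> Obj C" "B' \<in> Obj C" "v \<in> Mor C B B'" using v by (auto simp: isomorphism_def)
  obtain w' where w': "w' \<in> Mor C D' D" "Cmp C w w' = Idn C D" "Cmp C w' w = Idn C D'"
    and O3: "D \<in> Obj C" "D' \<in> Obj C" "w \<in> Mor C D D'" using w by (auto simp: isomorphism_def)
  note O = O1 O2 O3
  have cancel_w: "x = Zer C T D" if T: "T \<in> Obj C" "x \<in> Mor C T D" "Cmp C x w = Zer C T D'" for T x
  proof -
    have "x = Cmp C (Cmp C x w) w'"
      using T(1,2) O w' by (simp add: Cmp_assoc[of T D D' D] Idn_right[of T D])
    then show ?thesis unfolding T(3) using T O w' by (simp add: Zer_Cmp)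
  qed
  have cancel_v: "x = y" if "T \<in> Obj C" "x \<in> Mor C T B" "y \<in> Mor C T B" "Cmp C x v = Cmp C y v" for T x y
  proof -
    have "Cmp C (Cmp C x v) v' = Cmp C (Cmp C y v) v'" using that by simp
    then show ?thesis using that(1-3) O v' by (simp add: Cmp_assoc[of T B B' B] Idn_right[of T B])
  qed
  have f'u: "Cmp C u' (Cmp C f v) = f'"
    using O u' e' f Cmp_assoc[of A' A A' B' u' u f'] by (simp add: Idn_left[of A' B'])
  have g'v: "Cmp C v' (Cmp C g w) = g'"
    using O v' e' g Cmp_assoc[of B' B B' D' v' v g'] by (simp add: Idn_left[of B' D'])
  have zero: "Cmp C f g = Zer C A D"
  proof (rule cancel_w)
    have "Cmp C (Cmp C f g) w = Cmp C f (Cmp C v g')"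
      using O f g by (simp add: Cmp_assoc[of A B D D'])
    also have "\<dots> = Cmp C (Cmp C f v) g'" using O f(1) e' by (simp add: Cmp_assoc[of A B B' D'])
    also have "\<dots> = Cmp C u (Cmp C f' g')" using O f e' by (simp add: Cmp_assoc[of A A' B' D'])
    finally show "Cmp C (Cmp C f g) w = Zer C A D'" using O e' by (simp add: Cmp_Zer)
  qed (use O f g in \<open>auto intro: Cmp_closed[of A B D]\<close>)
  show ?thesis
  proof (rule exact_pairI)
    show "f \<in> Mor C A B" "g \<in> Mor C B D" "Cmp C f g = Zer C A D" by fact+
  next
    fix T t assume T: "T \<in> Obj C" "t \<in> Mor C T B" "Cmp C t g = Zer C T D"
    have "Cmp C (Cmp C t v) g' = Cmp C (Cmp C t g) w"
      using O T(1,2) e' g(1) by (simp add: Cmp_assoc[of T B B' D'] Cmp_assoc[of T B D D'] flip: g(2))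
    then have "Cmp C (Cmp C t v) g' = Zer C T D'" using O T by (simp add: Zer_Cmp)
    then obtain s where s: "s \<in> Mor C T A'" "Cmp C s f' = Cmp C t v"
      using e'(4)[OF T(1), of "Cmp C t v"] O T Cmp_closed[of T B B' t v] by blast
    have "Cmp C (Cmp C (Cmp C s u') f) v = Cmp C (Cmp C s u') (Cmp C f v)"
      using O T(1) s(1) u' f(1) Cmp_closed[of T A' A s u'] by (intro Cmp_assoc[of T A B B']) auto
    also have "\<dots> = Cmp C s f'"
      using O T(1) s(1) u' f(1) Cmp_closed[of A B B' f v] Cmp_assoc[of T A' A B' s u' "Cmp C f v"] by (simp add: f'u)
    finally have "Cmp C (Cmp C (Cmp C s u') f) v = Cmp C t v" using s(2) by simp
    moreover have su: "Cmp C s u' \<in> Mor C T A" using O T s u' by (intro Cmp_closed[of T A' A])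
    then have "Cmp C (Cmp C s u') f \<in> Mor C T B" using O T f by (intro Cmp_closed[of T A B])
    ultimately have "Cmp C (Cmp C s u') f = t" using cancel_v[OF T(1) _ T(2)] by blast
    then show "\<exists>s\<in>Mor C T A. Cmp C s f = t" using su by blast
  next
    fix T t assume T: "T \<in> Obj C" "t \<in> Mor C B T" "Cmp C f t = Zer C A T"
    have "Cmp C f' (Cmp C v' t) = Cmp C u' (Cmp C f t)"
    proof -
      have "Cmp C f' (Cmp C v' t) = Cmp C (Cmp C f' v') t" using O T v' e' by (simp add: Cmp_assoc[of A' B' B T])
      also have "Cmp C f' v' = Cmp C (Cmp C u' (Cmp C f v)) v'" by (simp only: f'u)
      also have "\<dots> = Cmp C u' (Cmp C (Cmp C f v) v')"
        using O v' u' f(1) Cmp_closed[of A B B' f v] by (intro Cmp_assoc[of A' A B' B]) auto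
      also have "Cmp C (Cmp C f v) v' = f"
        using O v' f(1) by (simp add: Cmp_assoc[of A B B' B] Idn_right[of A B])
      finally show ?thesis using O T u' f by (simp add: Cmp_assoc[of A' A B T])
    qed
    then have "Cmp C f' (Cmp C v' t) = Zer C A' T" using O T u' by (simp add: Cmp_Zer)
    then obtain s where s: "s \<in> Mor C D' T" "Cmp C g' s = Cmp C v' t"
      using e'(5)[OF T(1), of "Cmp C v' t"] O T v' Cmp_closed[of B' B T v' t] by blast
    have "Cmp C g (Cmp C w s) = Cmp C v (Cmp C g' s)"
      using O T(1) s(1) g e' Cmp_assoc[of B D D' T g w s] Cmp_assoc[of B B' D' T v g' s] by simp
    also have "\<dots> = Cmp C (Cmp C v v') t"
      unfolding s(2) using O T v'(1) Cmp_assoc[of B B' B T v v' t] by simp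
    also have "\<dots> = t" using O T v' by (simp add: Idn_left[of B T])
    finally show "\<exists>s\<in>Mor C D T. Cmp C g s = t" using O T s(1) by (intro bexI[of _ "Cmp C w s"] Cmp_closed[of D D' T])
  qed
qed

section \<open>Weak squares with zero corners or identity edges\<close>

lemma weak_square_zero_right:
  assumes "A \<in> Obj C" "B \<in> Obj C" "D \<in> Obj C" "zero_object C B'"
    and "g \<in> Mor C A B'" "k \<in> Mor C B' D" and e: "exact_pair A B D f h"
  shows "weak_square C A B B' D f g h k"
proof -
  note e' = exact_pairD[OF e]
  have B': "B' \<in> Obj C" using assms by (simp add: zero_object_def)
  have g: "g = Zer C A B'" and k: "k = Zer C B' D"
    using assms zero_object_from zero_object_to by blast+
  have "Idn C B' = Zer C B' B'" using B' assms Idn_closed zero_object_from by blast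
  then have "biproduct C B B' B (Idn C B) (Zer C B' B) (Idn C B) (Zer C B B')"
    using assms B' by (auto simp: biproduct_def Idn_closed Zer_closed Idn_left[of B B] Idn_left[of B B'] Idn_right[of B' B] Zer_Cmp Add_Zer)
  moreover have "Add C (Cmp C f (Idn C B)) (Cmp C g (Zer C B' B)) = f"
    using assms B' e' by (simp add: g Idn_right[of A B] Zer_Cmp Zer_closed Add_Zer)
  moreover have "Add C (Cmp C (Idn C B) h) (Cmp C (Zer C B B') (Neg C k)) = h"
    using assms B' e' by (simp add: k Idn_left[of B D] Zer_Cmp Zer_closed Add_Zer Neg_Zer)
  ultimately have ex: "\<exists>P i1 i2 p1 p2. biproduct C B B' P i1 i2 p1 p2 \<and>
     (let a = Add C (Cmp C f i1) (Cmp C g i2); d = Add C (Cmp C p1 h) (Cmp C p2 (Neg C k))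
      in weak_kernel C A P D a d \<and> weak_cokernel C A P D a d)"
    using e unfolding exact_pair_def Let_def by metis
  have "Cmp C f h = Cmp C g k" using e'(3) assms B' by (simp add: g Zer_Cmp)
  then show ?thesis using ex e' assms B' by (simp add: weak_square_def)
qed

text \<open>As in \<open>weak_square_zero_right\<close>, the nonzero middle corner is itself a
  biproduct of both corners, with zero injection and projection for the other one. Here the signed
  edge survives, so \<open>exact_pair_Neg\<close> enters.\<close>

lemma weak_square_zero_left:
  assumes "A \<in> Obj C" "B' \<in> Obj C" "D \<in> Obj C" "zero_object C B"
    and "f \<in> Mor C A B" "h \<in> Mor C B D" and e: "exact_pair A B' D g k"
  shows "weak_square C A B B' D f g h k"
proof -
  note e' = exact_pairD[OF e]
  have B: "B \<in> Obj C" using assms by (simp add: zero_object_def)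
  have f: "f = Zer C A B" and h: "h = Zer C B D"
    using assms zero_object_from zero_object_to by blast+
  have "Idn C B = Zer C B B" using B assms Idn_closed zero_object_from by blast
  then have "biproduct C B B' B' (Zer C B B') (Idn C B') (Zer C B' B) (Idn C B')"
    using assms B by (auto simp: biproduct_def Idn_closed Zer_closed Idn_left[of B' B'] Idn_right[of B B'] Idn_left[of B' B] Zer_Cmp Zer_Add)
  moreover have "Add C (Cmp C f (Zer C B B')) (Cmp C g (Idn C B')) = g"
    using assms B e' by (simp add: f Idn_right[of A B'] Zer_Cmp Zer_closed Zer_Add)
  moreover have "Add C (Cmp C (Zer C B' B) h) (Cmp C (Idn C B') (Neg C k)) = Neg C k"
    using assms B e' by (simp add: h Idn_left[of B' D] Zer_Cmp Zer_closed Zer_Add Neg_closed)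
  ultimately have ex: "\<exists>P i1 i2 p1 p2. biproduct C B B' P i1 i2 p1 p2 \<and>
     (let a = Add C (Cmp C f i1) (Cmp C g i2); d = Add C (Cmp C p1 h) (Cmp C p2 (Neg C k))
      in weak_kernel C A P D a d \<and> weak_cokernel C A P D a d)"
    using exact_pair_Neg[OF assms(1-3) e] unfolding exact_pair_def Let_def by metis
  have "Cmp C f h = Cmp C g k" using e'(3) assms B by (simp add: f Zer_Cmp)
  then show ?thesis using ex e' assms B by (simp add: weak_square_def)
qed

text \<open>A test morphism for the edge is moved to the biproduct through its second summand,
  factored there and restricted to that summand again. The application is a pushout square whose
  corner \<open>B\<close> is a free module, through which the diagonal is stably zero.\<close>

lemma weak_square_exact_right:
  assumes sq: "weak_square C A B B' D f g h k" and "Cmp C f h = Zer C A D"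
  shows "exact_pair A B' D g k"
proof -
  have O: "A \<in> Obj C" "B \<in> Obj C" "B' \<in> Obj C" "D \<in> Obj C"
    and m: "f \<in> Mor C A B" "g \<in> Mor C A B'" "h \<in> Mor C B D" "k \<in> Mor C B' D"
    and comm: "Cmp C f h = Cmp C g k" using sq by (auto simp: weak_square_def)
  obtain P i1 i2 p1 p2 where bi: "biproduct C B B' P i1 i2 p1 p2"
    and ex: "exact_pair A P D (Add C (Cmp C f i1) (Cmp C g i2)) (Add C (Cmp C p1 h) (Cmp C p2 (Neg C k)))"
    using sq unfolding weak_square_def Let_def exact_pair_def by auto
  define a where "a = Add C (Cmp C f i1) (Cmp C g i2)"
  define d where "d = Add C (Cmp C p1 h) (Cmp C p2 (Neg C k))"
  note e' = exact_pairD[OF ex, folded a_def d_def]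
  have P: "P \<in> Obj C" and i: "i1 \<in> Mor C B P" "i2 \<in> Mor C B' P" and p: "p1 \<in> Mor C P B" "p2 \<in> Mor C P B'"
    and bis: "Cmp C i1 p1 = Idn C B" "Cmp C i2 p2 = Idn C B'" "Cmp C i1 p2 = Zer C B B'" "Cmp C i2 p1 = Zer C B' B"
    using bi by (auto simp: biproduct_def)
  have i2d: "Cmp C i2 d = Neg C k"
  proof -
    have "Cmp C i2 d = Add C (Cmp C i2 (Cmp C p1 h)) (Cmp C i2 (Cmp C p2 (Neg C k)))"
      unfolding d_def using O m P i p by (intro Cmp_Add_right[of B' P D] Cmp_closed[of P B D] Cmp_closed[of P B' D] Neg_closed)
    also have "\<dots> = Neg C k"
      using O m P i p bis by (simp add: Neg_closed Zer_Cmp Zer_Add Idn_left[of B' D] flip: Cmp_assoc[of B' P B D] Cmp_assoc[of B' P B' D])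
    finally show ?thesis .
  qed
  have ap2: "Cmp C a p2 = g"
  proof -
    have "Cmp C a p2 = Add C (Cmp C (Cmp C f i1) p2) (Cmp C (Cmp C g i2) p2)"
      unfolding a_def using O m P i p by (intro Cmp_Add_left[of A P B'] Cmp_closed[of A B P] Cmp_closed[of A B' P])
    also have "\<dots> = g"
      using O m P i p bis by (simp add: Cmp_assoc[of A B P B'] Cmp_assoc[of A B' P B'] Cmp_Zer Zer_Add Idn_right[of A B'])
    finally show ?thesis .
  qed
  show ?thesis
  proof (rule exact_pairI)
    show "g \<in> Mor C A B'" "k \<in> Mor C B' D" by fact+
    show "Cmp C g k = Zer C A D" using comm assms by simp
  next
    fix T t assume T: "T \<in> Obj C" "t \<in> Mor C T B'" "Cmp C t k = Zer C T D"
    have "Cmp C (Cmp C t i2) d = Zer C T D"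
      using T O m P i e' by (simp add: Cmp_assoc[of T B' P D] i2d Cmp_Neg[of T B' D] Neg_Zer)
    then obtain s where s: "s \<in> Mor C T A" "Cmp C s a = Cmp C t i2"
      using e'(4)[OF T(1), of "Cmp C t i2"] T O P i Cmp_closed[of T B' P t i2] by blast
    have "Cmp C s g = Cmp C (Cmp C s a) p2" using s(1) T O P p e' by (simp add: Cmp_assoc[of T A P B'] ap2)
    also have "\<dots> = t" using T O P i p s bis by (simp add: Cmp_assoc[of T B' P B'] Idn_right[of T B'])
    finally show "\<exists>s\<in>Mor C T A. Cmp C s g = t" using s by blast
  next
    fix T t assume T: "T \<in> Obj C" "t \<in> Mor C B' T" "Cmp C g t = Zer C A T"
    have "Cmp C a (Cmp C p2 t) = Zer C A T"
      using T O P p e' by (simp add: ap2 flip: Cmp_assoc[of A P B' T])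
    then obtain s where s: "s \<in> Mor C D T" "Cmp C d s = Cmp C p2 t"
      using e'(5)[OF T(1), of "Cmp C p2 t"] T O P p Cmp_closed[of P B' T p2 t] by blast
    have "Cmp C (Neg C k) s = Cmp C i2 (Cmp C d s)"
      using s(1) T O P i e' by (simp add: i2d flip: Cmp_assoc[of B' P D T])
    also have "\<dots> = t" using s T O P i p bis by (simp add: Idn_left[of B' T] flip: Cmp_assoc[of B' P B' T])
    finally have "Cmp C k (Neg C s) = t" using s T O m by (simp add: Cmp_Neg[of B' D T] Neg_Cmp[of B' D T])
    then show "\<exists>s\<in>Mor C D T. Cmp C k s = t" using s T O by (intro bexI[of _ "Neg C s"] Neg_closed)
  qed
qed

text \<open>The sequence splits: \<open>a\<close> is the graph of \<open>f\<close> and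
  \<open>d\<close> measures the deviation from the graph. The factorizations are the
  \<open>A\<close>-component of a test morphism into \<open>P\<close> and the restriction to
  \<open>B\<close> of one out of \<open>P\<close>.\<close>

lemma weak_square_Idn_vertical:
  assumes O: "A \<in> Obj C" "B \<in> Obj C" and f: "f \<in> Mor C A B"
  shows "weak_square C A B A B f (Idn C A) (Idn C B) f"
proof -
  obtain P i1 i2 p1 p2 where bi: "biproduct C B A P i1 i2 p1 p2" using ex_biproduct O by blast
  then have P: "P \<in> Obj C" and i: "i1 \<in> Mor C B P" "i2 \<in> Mor C A P" and p: "p1 \<in> Mor C P B" "p2 \<in> Mor C P A"
    and bis: "Cmp C i1 p1 = Idn C B" "Cmp C i2 p2 = Idn C A" "Cmp C i1 p2 = Zer C B A" "Cmp C i2 p1 = Zer C A B"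
    and sum: "Add C (Cmp C p1 i1) (Cmp C p2 i2) = Idn C P"
    by (auto simp: biproduct_def)
  have fi: "Cmp C f i1 \<in> Mor C A P" "Cmp C p2 f \<in> Mor C P B" "Cmp C p1 i1 \<in> Mor C P P" "Cmp C p2 i2 \<in> Mor C P P"
    using O P f i p by (auto intro: Cmp_closed[of A B P] Cmp_closed[of P A B] Cmp_closed[of P B P] Cmp_closed[of P A P])
  have split_to: "t = Add C (Cmp C (Cmp C t p1) i1) (Cmp C (Cmp C t p2) i2)" if "T \<in> Obj C" "t \<in> Mor C T P" for T t
    using that O P i p fi Cmp_Add_right[of T P P t "Cmp C p1 i1" "Cmp C p2 i2"]
    by (simp add: sum Idn_right[of T P] Cmp_assoc[of T P B P] Cmp_assoc[of T P A P])
  have split_from: "t = Add C (Cmp C p1 (Cmp C i1 t)) (Cmp C p2 (Cmp C i2 t))" if "T \<in> Obj C" "t \<in> Mor C P T" for T t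
    using that O P i p fi Cmp_Add_left[of P P T "Cmp C p1 i1" "Cmp C p2 i2" t]
    by (simp add: sum Idn_left[of P T] Cmp_assoc[of P B P T] Cmp_assoc[of P A P T])
  define a where "a = Add C (Cmp C f i1) i2"
  define d where "d = Add C p1 (Neg C (Cmp C p2 f))"
  have ad: "a \<in> Mor C A P" "d \<in> Mor C P B"
    unfolding a_def d_def using O P i p fi by (auto intro: Add_closed Neg_closed)
  have td: "Cmp C t d = Add C (Cmp C t p1) (Neg C (Cmp C (Cmp C t p2) f))" if "T \<in> Obj C" "t \<in> Mor C T P" for T t
    unfolding d_def using that O P p fi f
    by (simp add: Cmp_Add_right[of T P B] Neg_closed Cmp_Neg[of T P B] Cmp_assoc[of T P A B])
  have at: "Cmp C a t = Add C (Cmp C f (Cmp C i1 t)) (Cmp C i2 t)" if "T \<in> Obj C" "t \<in> Mor C P T" for T t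
    unfolding a_def using that O P i fi f
    by (simp add: Cmp_Add_left[of A P T] Cmp_assoc[of A B P T])
  have "exact_pair A P B a d"
  proof (rule exact_pairI)
    have "Cmp C a p1 = f" "Cmp C a p2 = Idn C A"
      using O P p f bis at[of B p1] at[of A p2] by (simp_all add: Idn_right[of A B] Add_Zer Cmp_Zer Zer_Add Idn_closed)
    then show "Cmp C a d = Zer C A B" using td[of A a] O ad f by (simp add: Idn_left[of A B] Add_Neg)
  next
    fix T t assume T: "T \<in> Obj C" "t \<in> Mor C T P" "Cmp C t d = Zer C T B"
    define s where "s = Cmp C t p2"
    have s: "s \<in> Mor C T A" "Cmp C t p1 \<in> Mor C T B"
      unfolding s_def using T O P p f by (auto intro: Cmp_closed[of T P A] Cmp_closed[of T P B])
    then have sf: "Cmp C s f \<in> Mor C T B" using T O f by (intro Cmp_closed[of T A B])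
    have "Cmp C t p1 = Cmp C s f"
      using td[OF T(1,2)] T O s sf by (metis Add_comm Neg_Neg Neg_closed Neg_unique s_def)
    then have "t = Add C (Cmp C (Cmp C s f) i1) (Cmp C s i2)" using split_to[OF T(1,2)] by (simp add: s_def)
    also have "\<dots> = Cmp C s a" unfolding a_def using T O P i f fi s sf
      by (simp add: Cmp_Add_right[of T A P] Cmp_assoc[of T A B P])
    finally show "\<exists>s\<in>Mor C T A. Cmp C s a = t" using s by blast
  next
    fix T t assume T: "T \<in> Obj C" "t \<in> Mor C P T" "Cmp C a t = Zer C A T"
    define s where "s = Cmp C i1 t"
    have s: "s \<in> Mor C B T" "Cmp C i2 t \<in> Mor C A T"
      unfolding s_def using T O P i f by (auto intro: Cmp_closed[of B P T] Cmp_closed[of A P T])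
    then have sf: "Cmp C f s \<in> Mor C A T" using T O f by (intro Cmp_closed[of A B T])
    have "Cmp C i2 t = Neg C (Cmp C f s)"
      using at[OF T(1,2)] T O s sf by (metis Neg_unique s_def)
    then have "t = Add C (Cmp C p1 s) (Neg C (Cmp C p2 (Cmp C f s)))"
      using split_from[OF T(1,2)] T O P p s sf by (simp add: s_def[symmetric] Cmp_Neg[of P A T])
    also have "\<dots> = Cmp C d s" unfolding d_def using T O P p f fi s sf
      by (simp add: Cmp_Add_left[of P B T] Neg_closed Neg_Cmp[of P B T] Cmp_assoc[of P A B T])
    finally show "\<exists>s\<in>Mor C B T. Cmp C d s = t" using s by blast
  qed fact+
  moreover have "Add C (Cmp C f i1) (Cmp C (Idn C A) i2) = a"
    using O P i by (simp add: a_def Idn_left[of A P])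
  moreover have "Add C (Cmp C p1 (Idn C B)) (Cmp C p2 (Neg C f)) = d"
    using O P p f by (simp add: d_def Idn_right[of P B] Cmp_Neg[of P A B])
  ultimately have "\<exists>P i1 i2 p1 p2. biproduct C B A P i1 i2 p1 p2 \<and>
     (let a = Add C (Cmp C f i1) (Cmp C (Idn C A) i2); d = Add C (Cmp C p1 (Idn C B)) (Cmp C p2 (Neg C f))
      in weak_kernel C A P B a d \<and> weak_cokernel C A P B a d)"
    using bi unfolding exact_pair_def Let_def by metis
  then show ?thesis using O f by (simp add: weak_square_def Idn_closed Idn_left[of A B] Idn_right[of A B])
qed

text \<open>Exchanging the two summands of the biproduct turns the second morphism into its
  negative, and \<open>exact_pair_Neg\<close> applies.\<close>

lemma weak_square_swap:
  assumes sq: "weak_square C A B B' D f g h k"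
  shows "weak_square C A B' B D g f k h"
proof -
  have O: "A \<in> Obj C" "B \<in> Obj C" "B' \<in> Obj C" "D \<in> Obj C"
    and m: "f \<in> Mor C A B" "g \<in> Mor C A B'" "h \<in> Mor C B D" "k \<in> Mor C B' D"
    and comm: "Cmp C f h = Cmp C g k" using sq by (auto simp: weak_square_def)
  obtain P i1 i2 p1 p2 where bi: "biproduct C B B' P i1 i2 p1 p2"
    and ex: "exact_pair A P D (Add C (Cmp C f i1) (Cmp C g i2)) (Add C (Cmp C p1 h) (Cmp C p2 (Neg C k)))"
    using sq unfolding weak_square_def Let_def exact_pair_def by auto
  have P: "P \<in> Obj C" and i: "i1 \<in> Mor C B P" "i2 \<in> Mor C B' P" and p: "p1 \<in> Mor C P B" "p2 \<in> Mor C P B'"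
    using bi by (auto simp: biproduct_def)
  have M: "Cmp C f i1 \<in> Mor C A P" "Cmp C g i2 \<in> Mor C A P" "Cmp C p1 h \<in> Mor C P D" "Cmp C p2 k \<in> Mor C P D"
    "Cmp C p1 i1 \<in> Mor C P P" "Cmp C p2 i2 \<in> Mor C P P"
    using Cmp_closed[OF O(1,2) P m(1) i(1)] Cmp_closed[OF O(1,3) P m(2) i(2)] Cmp_closed[OF P O(2,4) p(1) m(3)]
      Cmp_closed[OF P O(3,4) p(2) m(4)] Cmp_closed[OF P O(2) P p(1) i(1)] Cmp_closed[OF P O(3) P p(2) i(2)] by auto
  have a: "Add C (Cmp C g i2) (Cmp C f i1) = Add C (Cmp C f i1) (Cmp C g i2)"
    using O P M by (intro Add_comm)
  have d: "Add C (Cmp C p2 k) (Cmp C p1 (Neg C h)) = Neg C (Add C (Cmp C p1 h) (Cmp C p2 (Neg C k)))"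
  proof (rule Neg_unique[OF P O(4)])
    have N: "Cmp C p1 (Neg C h) = Neg C (Cmp C p1 h)" "Cmp C p2 (Neg C k) = Neg C (Cmp C p2 k)"
      using Cmp_Neg[OF P O(2,4) p(1) m(3)] Cmp_Neg[OF P O(3,4) p(2) m(4)] by auto
    have NM: "Neg C (Cmp C p1 h) \<in> Mor C P D" "Neg C (Cmp C p2 k) \<in> Mor C P D" using Neg_closed[OF P O(4)] M by auto
    then show "Add C (Cmp C p1 h) (Cmp C p2 (Neg C k)) \<in> Mor C P D" "Add C (Cmp C p2 k) (Cmp C p1 (Neg C h)) \<in> Mor C P D"
      unfolding N using Add_closed[OF P O(4)] M by auto
    have "Add C (Add C (Cmp C p1 h) (Neg C (Cmp C p2 k))) (Add C (Cmp C p2 k) (Neg C (Cmp C p1 h))) =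
      Add C (Add C (Add C (Cmp C p1 h) (Neg C (Cmp C p2 k))) (Cmp C p2 k)) (Neg C (Cmp C p1 h))"
      using Add_assoc[OF P O(4) Add_closed[OF P O(4) M(3) NM(2)] M(4) NM(1)] by simp
    also have "Add C (Add C (Cmp C p1 h) (Neg C (Cmp C p2 k))) (Cmp C p2 k) = Cmp C p1 h"
      using Add_Neg_cancel[OF P O(4) M(3) NM(2)] Neg_Neg[OF P O(4) M(4)] by simp
    finally show "Add C (Add C (Cmp C p1 h) (Cmp C p2 (Neg C k))) (Add C (Cmp C p2 k) (Cmp C p1 (Neg C h))) = Zer C P D"
      unfolding N using Add_Neg[OF P O(4) M(3)] by simp
  qed
  have "biproduct C B' B P i2 i1 p2 p1"
    using bi Add_comm[OF P P M(5,6)] by (auto simp: biproduct_def)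
  moreover have "exact_pair A P D (Add C (Cmp C g i2) (Cmp C f i1)) (Add C (Cmp C p2 k) (Cmp C p1 (Neg C h)))"
    unfolding a d by (rule exact_pair_Neg[OF O(1) P O(4) ex])
  ultimately show ?thesis
    using O m comm unfolding weak_square_def Let_def exact_pair_def by (metis (no_types, lifting))
qed

end

section \<open>Modules over \<open>\<int>/p\<^sup>m\<close>\<close>

text \<open>Injectivity of \<open>\<int>/q\<close>: if \<open>N\<close> is the order of \<open>x\<close> modulo \<open>H\<close>, then \<open>q\<close> divides \<open>(q / N) \<phi> (x\<^sup>N)\<close>, so \<open>\<phi> (x\<^sup>N)\<close> is divisible
  by \<open>N\<close> and \<open>\<phi>\<close> extends to the subgroup generated by \<open>H\<close> and \<open>x\<close>.\<close>

lemma (in comm_group) extend_additive_mod: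
  fixes q :: nat and \<phi> :: "'a \<Rightarrow> int"
  assumes fin: "finite (carrier G)" and q: "q > 0"
    and expo: "\<And>x. x \<in> carrier G \<Longrightarrow> x [^] q = \<one>"
    and "subgroup H G"
    and "\<And>x y. x \<in> H \<Longrightarrow> y \<in> H \<Longrightarrow> [\<phi> (x \<otimes> y) = \<phi> x + \<phi> y] (mod int q)"
  shows "\<exists>\<psi>. (\<forall>x\<in>carrier G. \<forall>y\<in>carrier G. [\<psi> (x \<otimes> y) = \<psi> x + \<psi> y] (mod int q)) \<and>
    (\<forall>x\<in>H. [\<psi> x = \<phi> x] (mod int q))"
  using assms(4,5)
\<comment> \<open>Induction on the size of the complement: one element \<open>x\<close> is adjoined
  to \<open>H\<close> at a time.\<close>
proof (induction "card (carrier G - H)" arbitrary: H \<phi> rule: less_induct)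
  case less
  interpret H: subgroup H G by fact
  note add = less.prems(2)
  show ?case
  proof (cases "H = carrier G")
    case True
    then show ?thesis using add by (intro exI[of _ \<phi>]) auto
  next
    case False
    then obtain x where x: "x \<in> carrier G" "x \<notin> H" using H.subset by blast
    have phi1: "[\<phi> \<one> = 0] (mod int q)"
      using add[of \<one> \<one>] by (simp add: cong_iff_dvd_diff dvd_minus_iff)
    have phipow: "[\<phi> (y [^] n) = int n * \<phi> y] (mod int q)" if "y \<in> H" for y and n :: nat
    proof (induction n)
      case 0
      then show ?case using phi1 by simp
    next
      case (Suc n)
      have yn: "y [^] n \<in> H" using that by (induction n) auto
      have "[\<phi> (y [^] Suc n) = \<phi> (y [^] n) + \<phi> y] (mod int q)" using add[OF yn that] by simp
      also have "[\<phi> (y [^] n) + \<phi> y = int n * \<phi> y + \<phi> y] (mod int q)"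
        using Suc by (rule cong_add) simp
      finally show ?case by (simp add: algebra_simps)
    qed
    define N where "N = (LEAST n :: nat. n > 0 \<and> x [^] n \<in> H)"
    have "q > 0 \<and> x [^] q \<in> H" using q expo[OF x(1)] by simp
    then have N: "N > 0" "x [^] N \<in> H" and Nmin: "\<And>n. n > 0 \<and> x [^] n \<in> H \<Longrightarrow> N \<le> n"
      using LeastI[of "\<lambda>n :: nat. n > 0 \<and> x [^] n \<in> H" q] Least_le[of "\<lambda>n :: nat. n > 0 \<and> x [^] n \<in> H"]
      unfolding N_def by auto
    have Ndvd: "N dvd j" if j: "x [^] j \<in> H" for j :: nat
    proof -
      \<comment> \<open>Division with remainder: the remainder is again an exponent that takes
        \<open>x\<close> into \<open>H\<close>, but it is smaller than the least positive
        one.\<close>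
      have "x [^] j = (x [^] N) [^] (j div N) \<otimes> x [^] (j mod N)"
        using x by (simp add: nat_pow_mult nat_pow_pow)
      moreover have pows: "(x [^] N) [^] i \<in> H" for i :: nat
        using N(2) by (induction i) (simp_all del: nat_pow_pow)
      ultimately have "x [^] (j mod N) = inv ((x [^] N) [^] (j div N)) \<otimes> x [^] j"
        using x by (simp add: inv_solve_left)
      then have "x [^] (j mod N) \<in> H" 
        using pows j by simp
      then have "j mod N = 0" using Nmin[of "j mod N"] N(1) mod_less_divisor[of N j] by linarith
      then show ?thesis by (rule mod_0_imp_dvd)
    qed
    have "N dvd q" using Ndvd[of q] expo[OF x(1)] by simp
    then obtain L where L: "q = N * L" by blast
    have "[int L * \<phi> (x [^] N) = 0] (mod int q)"
    proof -
      have "[\<phi> ((x [^] N) [^] L) = int L * \<phi> (x [^] N)] (mod int q)" using phipow N(2) by blast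
      moreover have "(x [^] N) [^] L = \<one>" using x expo L by (simp add: nat_pow_pow)
      ultimately show ?thesis using phi1 by (metis cong_sym cong_trans)
    qed
    then have "int N dvd \<phi> (x [^] N)"
      using q L by (auto simp: cong_0_iff mult.commute)
    \<comment> \<open>The extension is going to send \<open>x\<close> to \<open>d\<close>, that is,
      \<open>h \<otimes> x [^] j\<close> to \<open>\<phi> h + int j * d\<close>.\<close>
    then obtain d where d: "\<phi> (x [^] N) = int N * d" by blast
    define P where "P y hj \<longleftrightarrow> fst hj \<in> H \<and> y = fst hj \<otimes> x [^] snd hj" for y and hj :: "'a \<times> nat"
    \<comment> \<open>Some decomposition of \<open>y\<close> is chosen here; \<open>wd\<close> shows
      that another choice changes the value only by a multiple of \<open>q\<close>.\<close>
    define \<psi> where "\<psi> y = (let hj = (SOME hj. P y hj) in \<phi> (fst hj) + int (snd hj) * d)" for y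
    define H' where "H' = {y. \<exists>h j. h \<in> H \<and> y = h \<otimes> x [^] (j :: nat)}"
    have wd': "[\<phi> h + int j * d = \<phi> h' + int j' * d] (mod int q)"
      if h: "h \<in> H" "h' \<in> H" "h \<otimes> x [^] j = h' \<otimes> x [^] j'" and le: "j' \<le> j" for h h' and j j' :: nat
    proof -
      obtain i where i: "j = i + j'" using le by (metis add.commute le_iff_add)
      have "h \<otimes> x [^] i \<otimes> x [^] j' = h' \<otimes> x [^] j'" using h x i by (simp add: m_assoc nat_pow_mult)
      then have hi: "h \<otimes> x [^] i = h'" using h x by simp
      then have "x [^] i = inv h \<otimes> h'" using h x by (simp add: inv_solve_left)
      then have xi: "x [^] i \<in> H" using h by simp
      then obtain e where e: "i = N * e" using Ndvd by blast
      have "[\<phi> h' = \<phi> h + \<phi> (x [^] i)] (mod int q)" using add[OF h(1) xi] hi by simp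
      also have "[\<phi> h + \<phi> (x [^] i) = \<phi> h + int e * \<phi> (x [^] N)] (mod int q)"
        using phipow[OF N(2), of e] x by (simp add: e nat_pow_pow cong_add)
      finally have "[\<phi> h' = \<phi> h + int i * d] (mod int q)" by (simp add: d e algebra_simps)
      then have "[\<phi> h' + int j' * d = \<phi> h + int i * d + int j' * d] (mod int q)" by (rule cong_add) simp
      then show ?thesis by (simp add: i algebra_simps cong_sym)
    qed
    have wd: "[\<phi> h + int j * d = \<phi> h' + int j' * d] (mod int q)"
      if h: "h \<in> H" "h' \<in> H" "h \<otimes> x [^] j = h' \<otimes> x [^] j'" for h h' and j j' :: nat
      using wd'[OF h] wd'[OF h(2,1) h(3)[symmetric]] by (meson cong_sym nat_le_linear)
    have psi: "[\<psi> (h \<otimes> x [^] j) = \<phi> h + int j * d] (mod int q)" if h: "h \<in> H" for h and j :: nat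
    proof -
      have "P (h \<otimes> x [^] j) (h, j)" using h by (simp add: P_def)
      then have "P (h \<otimes> x [^] j) (SOME hj. P (h \<otimes> x [^] j) hj)" by (rule someI)
      moreover obtain h' j' where hj: "(SOME hj. P (h \<otimes> x [^] j) hj) = (h', j')" by fastforce
      ultimately have *: "h' \<in> H" "h' \<otimes> x [^] j' = h \<otimes> x [^] j" by (simp_all add: P_def)
      then show ?thesis using wd[OF *(1) h *(2)] by (simp add: \<psi>_def hj)
    qed
    have mult: "(h \<otimes> x [^] j) \<otimes> (h' \<otimes> x [^] j') = (h \<otimes> h') \<otimes> x [^] (j + j')"
      if "h \<in> H" "h' \<in> H" for h h' and j j' :: nat
      using that x by (simp add: nat_pow_mult[symmetric] m_ac)
    have sub: "subgroup H' G"
    proof (rule subgroupI)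
      show "H' \<subseteq> carrier G" using x by (auto simp: H'_def)
      show "H' \<noteq> {}" unfolding H'_def using H.one_closed by blast
      show "y \<otimes> z \<in> H'" if yz: "y \<in> H'" "z \<in> H'" for y z
      proof -
        obtain h j where y: "h \<in> H" "y = h \<otimes> x [^] (j :: nat)" using yz(1) unfolding H'_def mem_Collect_eq by (elim exE conjE)
        obtain h' j' where z: "h' \<in> H" "z = h' \<otimes> x [^] (j' :: nat)" using yz(2) unfolding H'_def mem_Collect_eq by (elim exE conjE)
        note * = y(1) z(1) y(2) z(2)
        show ?thesis unfolding *(3,4) mult[OF *(1,2)] H'_def mem_Collect_eq
          using *(1,2) by (intro exI conjI) (rule H.m_closed, assumption+, rule refl)
      qed
      show "inv y \<in> H'" if y': "y \<in> H'" for y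
      proof -
        obtain h j where y: "h \<in> H" "y = h \<otimes> x [^] (j :: nat)" using y' unfolding H'_def mem_Collect_eq by (elim exE conjE)
        \<comment> \<open>\<open>H'\<close> is built with natural exponents only, so the inverse of
          \<open>x [^] j\<close> is expressed as \<open>x [^] ((q - 1) * j)\<close>, using
          \<open>x [^] q = \<one>\<close>.\<close>
        have "(inv h \<otimes> x [^] ((q - 1) * j)) \<otimes> y = x [^] ((q - 1) * j + j)"
          using mult[of "inv h" h "(q - 1) * j" j] y x by simp
        also have "(q - 1) * j + j = q * j" using q by (cases q) auto
        also have "x [^] (q * j) = \<one>" using x expo by (simp flip: nat_pow_pow)
        finally have "inv y = inv h \<otimes> x [^] ((q - 1) * j)"
          using y x inv_equality[of "inv h \<otimes> x [^] ((q - 1) * j)" y] by simp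
        then show ?thesis unfolding H'_def mem_Collect_eq using y(1) H.m_inv_closed by blast
      qed
    qed
    have HH': "H \<subseteq> H'" 
      unfolding H'_def using H.subset by (force intro: exI[of _ "0 :: nat"])
    have "x \<in> H'"
      unfolding H'_def using x by (intro CollectI exI[of _ \<one>] exI[of _ "1 :: nat"]) auto
    then have "card (carrier G - H') < card (carrier G - H)"
      using HH' x fin by (intro psubset_card_mono) auto
    then obtain \<psi>' where psi':
      "\<And>x y. x \<in> carrier G \<Longrightarrow> y \<in> carrier G \<Longrightarrow> [\<psi>' (x \<otimes> y) = \<psi>' x + \<psi>' y] (mod int q)"
      "\<And>x. x \<in> H' \<Longrightarrow> [\<psi>' x = \<psi> x] (mod int q)"
    proof (rule less.hyps[OF _ sub, of \<psi>, THEN exE])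
      fix y z assume "y \<in> H'" "z \<in> H'"
      then obtain h j h' j' where y: "h \<in> H" "y = h \<otimes> x [^] (j :: nat)"
        and z: "h' \<in> H" "z = h' \<otimes> x [^] (j' :: nat)"
        unfolding H'_def mem_Collect_eq by (elim exE conjE)
      note * = y(1) z(1) y(2) z(2)
      have "[\<psi> (y \<otimes> z) = \<phi> (h \<otimes> h') + int (j + j') * d] (mod int q)"
        unfolding *(3,4) mult[OF *(1,2)] using * by (intro psi) simp
      also have "[\<phi> (h \<otimes> h') + int (j + j') * d = \<phi> h + \<phi> h' + int (j + j') * d] (mod int q)"
        using add[OF *(1,2)] by (rule cong_add) simp
      also have "\<phi> h + \<phi> h' + int (j + j') * d = (\<phi> h + int j * d) + (\<phi> h' + int j' * d)"
        by (simp add: algebra_simps)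
      also have "[\<dots> = \<psi> y + \<psi> z] (mod int q)"
        unfolding *(3,4) using psi[OF *(1)] psi[OF *(2)] by (intro cong_add) (simp_all add: cong_sym)
      finally show "[\<psi> (y \<otimes> z) = \<psi> y + \<psi> z] (mod int q)" .
    qed blast
    have "[\<psi>' h = \<phi> h] (mod int q)" if "h \<in> H" for h
    proof -
      have "[\<psi> h = \<phi> h] (mod int q)" using psi[OF that, of 0] that by simp
      then show ?thesis using psi'(2)[of h] HH' that cong_trans by blast
    qed
    then show ?thesis using psi'(1) by blast
  qed
qed

section \<open>Elements and homomorphisms of the modules\<close>

locale primary_modules =
  fixes p m :: nat
  assumes p_pos: "0 < p"
begin

abbreviation M where "M \<equiv> E_mod p"
abbreviation K where "K a \<equiv> carrier (M a)"
abbreviation Hom where "Hom \<equiv> E_hom p m"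
abbreviation rk where "rk a \<equiv> length (summands a)"
abbreviation ord where "ord a k \<equiv> int p ^ (summands a ! k)"

lemma K_iff: "x \<in> K a \<longleftrightarrow> length x = rk a \<and> (\<forall>k<rk a. 0 \<le> x ! k \<and> x ! k < ord a k)"
  by (auto simp: E_mod_def)

lemma zero_M: "\<zero>\<^bsub>M a\<^esub> = replicate (rk a) 0"
  by (simp add: E_mod_def)

lemma add_M: "x \<oplus>\<^bsub>M a\<^esub> y = reduce p a (map2 (+) x y)"
  by (simp add: E_mod_def)

lemma smult_M: "r \<odot>\<^bsub>M a\<^esub> x = reduce p a (map ((*) r) x)"
  by (simp add: E_mod_def)

lemma K_bounds: "x \<in> K a \<Longrightarrow> k < rk a \<Longrightarrow> 0 \<le> x ! k" "x \<in> K a \<Longrightarrow> k < rk a \<Longrightarrow> x ! k < ord a k"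
  by (simp_all add: K_iff)

lemma K_I: "length x = rk a \<Longrightarrow> (\<And>k. k < rk a \<Longrightarrow> 0 \<le> x ! k \<and> x ! k < ord a k) \<Longrightarrow> x \<in> K a"
  by (simp add: K_iff)

lemma nth_K_mod [simp]: "x \<in> K a \<Longrightarrow> k < rk a \<Longrightarrow> x ! k mod ord a k = x ! k"
  by (simp add: K_iff)

lemma length_K [simp]: "x \<in> K a \<Longrightarrow> length x = rk a"
  by (simp add: K_iff)

lemma finite_K: "finite (K a)"
proof (rule finite_subset)
  show "K a \<subseteq> {x. set x \<subseteq> {0..<int p ^ Max (set (summands a))} \<and> length x = rk a}"
  proof (intro subsetI CollectI conjI)
    fix x t assume x: "x \<in> K a" and "t \<in> set x"
    then obtain k where k: "k < rk a" "t = x ! k" by (auto simp: in_set_conv_nth)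
    have "ord a k \<le> int p ^ Max (set (summands a))"
      using p_pos by (intro power_increasing Max_ge nth_mem[OF k(1)] finite_set) simp
    moreover have "0 \<le> t" "t < ord a k" using k K_bounds[OF x] by auto
    ultimately show "t \<in> {0..<int p ^ Max (set (summands a))}" by simp
  qed simp
qed (simp add: finite_lists_length_eq)

lemma length_reduce [simp]: "length x = rk a \<Longrightarrow> length (reduce p a x) = rk a"
  by (simp add: reduce_def)

lemma nth_reduce [simp]: "length x = rk a \<Longrightarrow> k < rk a \<Longrightarrow> reduce p a x ! k = x ! k mod ord a k"
  by (simp add: reduce_def)

lemma reduce_in_K [simp]: "length x = rk a \<Longrightarrow> reduce p a x \<in> K a"
  using p_pos by (intro K_I) auto

lemma reduce_K [simp]: "x \<in> K a \<Longrightarrow> reduce p a x = x"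
  by (intro nth_equalityI) auto

lemma K_eqI: "x \<in> K a \<Longrightarrow> y \<in> K a \<Longrightarrow> (\<And>k. k < rk a \<Longrightarrow> x ! k = y ! k) \<Longrightarrow> x = y"
  by (intro nth_equalityI) auto

lemma zero_nth [simp]: "k < rk a \<Longrightarrow> \<zero>\<^bsub>M a\<^esub> ! k = 0"
  by (simp add: zero_M)

lemma add_nth [simp]:
  "x \<in> K a \<Longrightarrow> y \<in> K a \<Longrightarrow> k < rk a \<Longrightarrow> (x \<oplus>\<^bsub>M a\<^esub> y) ! k = (x ! k + y ! k) mod ord a k"
  by (simp add: add_M)

lemma add_closed: "x \<in> K a \<Longrightarrow> y \<in> K a \<Longrightarrow> x \<oplus>\<^bsub>M a\<^esub> y \<in> K a"
  by (simp add: add_M)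

lemma zero_closed: "\<zero>\<^bsub>M a\<^esub> \<in> K a"
  using p_pos by (intro K_I) (auto simp: zero_M)

lemma abelian_group_M: "abelian_group (M a)"
proof (rule abelian_groupI)
  fix x assume x: "x \<in> K a"
  show "\<exists>y\<in>K a. y \<oplus>\<^bsub>M a\<^esub> x = \<zero>\<^bsub>M a\<^esub>"
  proof
    show r: "reduce p a (map uminus x) \<in> K a" using x by simp
    show "reduce p a (map uminus x) \<oplus>\<^bsub>M a\<^esub> x = \<zero>\<^bsub>M a\<^esub>"
      using x r by (intro K_eqI[of _ a] add_closed zero_closed) (auto simp: mod_simps)
  qed
next
  fix x y z assume "x \<in> K a" "y \<in> K a" "z \<in> K a"
  then show "x \<oplus>\<^bsub>M a\<^esub> y \<oplus>\<^bsub>M a\<^esub> z = x \<oplus>\<^bsub>M a\<^esub> (y \<oplus>\<^bsub>M a\<^esub> z)"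
    by (intro K_eqI[of _ a] add_closed) (auto simp: add_closed mod_simps add.assoc)
next
  fix x y assume "x \<in> K a" "y \<in> K a"
  then show "x \<oplus>\<^bsub>M a\<^esub> y = y \<oplus>\<^bsub>M a\<^esub> x"
    by (intro K_eqI[of _ a] add_closed) (auto simp: add.commute)
next
  fix x assume "x \<in> K a"
  then show "\<zero>\<^bsub>M a\<^esub> \<oplus>\<^bsub>M a\<^esub> x = x"
    by (intro K_eqI[of _ a] add_closed zero_closed) (auto simp: zero_closed)
qed (auto intro: add_closed zero_closed)

sublocale M: abelian_group "E_mod p a" for a
  by (rule abelian_group_M)

lemma neg_nth [simp]:
  assumes "x \<in> K a" "k < rk a"
  shows "(\<ominus>\<^bsub>M a\<^esub> x) ! k = (- (x ! k)) mod ord a k"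
proof -
  have r: "reduce p a (map uminus x) \<in> K a" using assms by simp
  have "reduce p a (map uminus x) \<oplus>\<^bsub>M a\<^esub> x = \<zero>\<^bsub>M a\<^esub>"
    using assms r by (intro K_eqI[of _ a] add_closed zero_closed) (auto simp: mod_simps)
  then have "\<ominus>\<^bsub>M a\<^esub> x = reduce p a (map uminus x)" using r assms M.minus_equality by blast
  then show ?thesis using assms by simp
qed

lemma minus_nth [simp]:
  assumes "x \<in> K a" "y \<in> K a" "k < rk a"
  shows "(x \<ominus>\<^bsub>M a\<^esub> y) ! k = (x ! k - y ! k) mod ord a k"
  using assms by (simp add: a_minus_def mod_simps)

lemma pow_eq_smult: "x \<in> K a \<Longrightarrow> x [^]\<^bsub>add_monoid (M a)\<^esub> (n :: nat) = int n \<odot>\<^bsub>M a\<^esub> x"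
proof (induction n)
  case 0
  then show ?case by (intro K_eqI[of _ a]) (auto simp: smult_M zero_closed)
next
  case (Suc n)
  then have "x [^]\<^bsub>add_monoid (M a)\<^esub> Suc n = (int n \<odot>\<^bsub>M a\<^esub> x) \<oplus>\<^bsub>M a\<^esub> x"
    by (simp add: nat_pow_Suc)
  also have "\<dots> = int (Suc n) \<odot>\<^bsub>M a\<^esub> x"
    using Suc.prems by (intro K_eqI[of _ a] add_closed) (auto simp: smult_M mod_simps algebra_simps)
  finally show ?case .
qed

text \<open>The scalars in \<open>residue_ring\<close> are nonnegative integers and act by iterated
  addition (\<open>pow_eq_smult\<close>). Additivity therefore implies linearity, and homomorphisms
  can be handled as maps of abelian groups.\<close>

lemma Hom_iff:
  "f \<in> Hom a b \<longleftrightarrow> f \<in> K a \<rightarrow>\<^sub>E K b \<and> (\<forall>x\<in>K a. \<forall>y\<in>K a. f (x \<oplus>\<^bsub>M a\<^esub> y) = f x \<oplus>\<^bsub>M b\<^esub> f y)"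
proof (intro iffI conjI)
  assume f: "f \<in> K a \<rightarrow>\<^sub>E K b \<and> (\<forall>x\<in>K a. \<forall>y\<in>K a. f (x \<oplus>\<^bsub>M a\<^esub> y) = f x \<oplus>\<^bsub>M b\<^esub> f y)"
  then have hom: "f \<in> hom (add_monoid (M a)) (add_monoid (M b))" by (auto simp: hom_def)
  interpret f: group_hom "add_monoid (M a)" "add_monoid (M b)" f
    using hom M.a_group by (simp add: group_hom_def group_hom_axioms_def)
  have "f (r \<odot>\<^bsub>M a\<^esub> x) = r \<odot>\<^bsub>M b\<^esub> f x" if r: "r \<in> carrier (residue_ring (int p ^ m))" and x: "x \<in> K a" for r x
  proof -
    have "0 \<le> r" using r by (simp add: residue_ring_def)
    then obtain n where n: "r = int n" using nonneg_int_cases by blast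
    have "f x \<in> K b" using x f by auto
    then show ?thesis using f.hom_nat_pow[of x n] x by (simp add: n pow_eq_smult)
  qed
  then show "f \<in> Hom a b" using f hom by (simp add: E_hom_def linear_maps_def)
qed (auto simp: E_hom_def linear_maps_def hom_def)

lemma HomI:
  "(\<And>x. x \<in> K a \<Longrightarrow> f x \<in> K b) \<Longrightarrow>
   (\<And>x y. x \<in> K a \<Longrightarrow> y \<in> K a \<Longrightarrow> f (x \<oplus>\<^bsub>M a\<^esub> y) = f x \<oplus>\<^bsub>M b\<^esub> f y) \<Longrightarrow> restrict f (K a) \<in> Hom a b"
  by (auto simp: Hom_iff add_closed)

lemma HomI':
  "f \<in> extensional (K a) \<Longrightarrow> (\<And>x. x \<in> K a \<Longrightarrow> f x \<in> K b) \<Longrightarrow>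
   (\<And>x y. x \<in> K a \<Longrightarrow> y \<in> K a \<Longrightarrow> f (x \<oplus>\<^bsub>M a\<^esub> y) = f x \<oplus>\<^bsub>M b\<^esub> f y) \<Longrightarrow> f \<in> Hom a b"
  by (auto simp: Hom_iff PiE_def)

lemma Hom_closed [simp]: "f \<in> Hom a b \<Longrightarrow> x \<in> K a \<Longrightarrow> f x \<in> K b"
  by (auto simp: Hom_iff)

lemma Hom_add: "f \<in> Hom a b \<Longrightarrow> x \<in> K a \<Longrightarrow> y \<in> K a \<Longrightarrow> f (x \<oplus>\<^bsub>M a\<^esub> y) = f x \<oplus>\<^bsub>M b\<^esub> f y"
  by (auto simp: Hom_iff)

lemma Hom_ext: "f \<in> Hom a b \<Longrightarrow> g \<in> Hom a b' \<Longrightarrow> (\<And>x. x \<in> K a \<Longrightarrow> f x = g x) \<Longrightarrow> f = g"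
  by (auto simp: Hom_iff PiE_def intro: extensionalityI)

lemma Hom_group_hom:
  assumes "f \<in> Hom a b"
  shows "abelian_group_hom (M a) (M b) f"
  using assms M.abelian_group_axioms
  by (intro abelian_group_homI) (auto simp: group_hom_def group_hom_axioms_def hom_def Hom_add M.a_group abelian_group_M)

lemma Hom_zero [simp]: "f \<in> Hom a b \<Longrightarrow> f \<zero>\<^bsub>M a\<^esub> = \<zero>\<^bsub>M b\<^esub>"
  using abelian_group_hom.hom_zero[OF Hom_group_hom] by blast

lemma Hom_neg: "f \<in> Hom a b \<Longrightarrow> x \<in> K a \<Longrightarrow> f (\<ominus>\<^bsub>M a\<^esub> x) = \<ominus>\<^bsub>M b\<^esub> f x"
  using abelian_group_hom.hom_a_inv[OF Hom_group_hom] by blast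

lemma Hom_minus: "f \<in> Hom a b \<Longrightarrow> x \<in> K a \<Longrightarrow> y \<in> K a \<Longrightarrow> f (x \<ominus>\<^bsub>M a\<^esub> y) = f x \<ominus>\<^bsub>M b\<^esub> f y"
  by (simp add: a_minus_def Hom_add Hom_neg)

lemma minus_eq_zero_iff: "x \<in> K a \<Longrightarrow> y \<in> K a \<Longrightarrow> x \<ominus>\<^bsub>M a\<^esub> y = \<zero>\<^bsub>M a\<^esub> \<longleftrightarrow> x = y"
  by (metis M.add.inv_solve_right' M.minus_eq M.l_zero zero_closed)

lemma add_minus_cancel: "x \<in> K a \<Longrightarrow> y \<in> K a \<Longrightarrow> y \<oplus>\<^bsub>M a\<^esub> (x \<ominus>\<^bsub>M a\<^esub> y) = x"
  by (metis M.a_comm M.minus_eq M.add.inv_closed M.a_assoc M.l_neg M.r_zero)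

lemma minus_add_cancel: "x \<in> K a \<Longrightarrow> y \<in> K a \<Longrightarrow> (y \<oplus>\<^bsub>M a\<^esub> x) \<ominus>\<^bsub>M a\<^esub> y = x"
  by (metis M.a_comm M.minus_eq M.add.inv_closed M.a_assoc M.r_neg M.r_zero)

lemma Hom_inj_onI:
  assumes "f \<in> Hom a b" "\<And>x. x \<in> K a \<Longrightarrow> f x = \<zero>\<^bsub>M b\<^esub> \<Longrightarrow> x = \<zero>\<^bsub>M a\<^esub>"
  shows "inj_on f (K a)"
proof (rule inj_onI)
  fix x y assume xy: "x \<in> K a" "y \<in> K a" "f x = f y"
  then have "f (x \<ominus>\<^bsub>M a\<^esub> y) = \<zero>\<^bsub>M b\<^esub>" using assms(1) by (simp add: Hom_minus minus_eq_zero_iff)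
  then show "x = y" using assms(2)[of "x \<ominus>\<^bsub>M a\<^esub> y"] xy by (simp add: minus_eq_zero_iff)
qed

lemma E_comp_apply [simp]: "x \<in> K a \<Longrightarrow> E_comp p a f g x = g (f x)"
  by (simp add: E_comp_def compose_def)

lemma E_comp_Hom [simp]: "f \<in> Hom a b \<Longrightarrow> g \<in> Hom b c \<Longrightarrow> E_comp p a f g \<in> Hom a c"
  by (rule HomI') (auto simp: Hom_add E_comp_def compose_def add_closed)

definition hsum :: "obj \<Rightarrow> obj \<Rightarrow> fn \<Rightarrow> fn \<Rightarrow> fn" where
  "hsum a b f g = (\<lambda>x\<in>K a. f x \<oplus>\<^bsub>M b\<^esub> g x)"

definition hneg :: "obj \<Rightarrow> obj \<Rightarrow> fn \<Rightarrow> fn" where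
  "hneg a b f = (\<lambda>x\<in>K a. \<ominus>\<^bsub>M b\<^esub> f x)"

definition hzero :: "obj \<Rightarrow> obj \<Rightarrow> fn" where
  "hzero a b = (\<lambda>x\<in>K a. \<zero>\<^bsub>M b\<^esub>)"

definition hid :: "obj \<Rightarrow> fn" where
  "hid a = (\<lambda>x\<in>K a. x)"

lemma hsum_apply [simp]: "x \<in> K a \<Longrightarrow> hsum a b f g x = f x \<oplus>\<^bsub>M b\<^esub> g x"
  and hneg_apply [simp]: "x \<in> K a \<Longrightarrow> hneg a b f x = \<ominus>\<^bsub>M b\<^esub> f x"
  and hzero_apply [simp]: "x \<in> K a \<Longrightarrow> hzero a b x = \<zero>\<^bsub>M b\<^esub>"
  and hid_apply [simp]: "x \<in> K a \<Longrightarrow> hid a x = x"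
  by (simp_all add: hsum_def hneg_def hzero_def hid_def)

lemma hsum_Hom [simp]: "f \<in> Hom a b \<Longrightarrow> g \<in> Hom a b \<Longrightarrow> hsum a b f g \<in> Hom a b"
  unfolding hsum_def by (rule HomI) (auto simp: Hom_add M.a_ac)

lemma hneg_Hom [simp]: "f \<in> Hom a b \<Longrightarrow> hneg a b f \<in> Hom a b"
  unfolding hneg_def by (rule HomI) (auto simp: Hom_add M.minus_add)

lemma hzero_Hom [simp]: "hzero a b \<in> Hom a b"
  unfolding hzero_def by (rule HomI) auto

lemma hid_Hom [simp]: "hid a \<in> Hom a a"
  unfolding hid_def by (rule HomI) auto

lemma factor_through_mono:
  assumes g: "g \<in> Hom b c" "inj_on g (K b)" and t: "t \<in> Hom T c" "\<And>x. x \<in> K T \<Longrightarrow> t x \<in> g ` K b"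
  shows "\<exists>s\<in>Hom T b. \<forall>x\<in>K T. g (s x) = t x"
proof
  let ?s = "\<lambda>x. inv_into (K b) g (t x)"
  have s: "?s x \<in> K b" "g (?s x) = t x" if "x \<in> K T" for x
    using t(2)[OF that] by (auto intro: inv_into_into f_inv_into_f)
  show "restrict ?s (K T) \<in> Hom T b"
  proof (rule HomI)
    fix x y assume xy: "x \<in> K T" "y \<in> K T"
    have "g (?s (x \<oplus>\<^bsub>M T\<^esub> y)) = t (x \<oplus>\<^bsub>M T\<^esub> y)" using xy by (intro s) simp
    also have "\<dots> = g (?s x \<oplus>\<^bsub>M b\<^esub> ?s y)" using xy g(1) t(1) by (simp add: Hom_add s)
    finally have "g (?s (x \<oplus>\<^bsub>M T\<^esub> y)) = g (?s x \<oplus>\<^bsub>M b\<^esub> ?s y)" .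
    then show "?s (x \<oplus>\<^bsub>M T\<^esub> y) = ?s x \<oplus>\<^bsub>M b\<^esub> ?s y"
      using xy g(2) s by (auto dest!: inj_onD)
  qed (simp add: s)
  show "\<forall>x\<in>K T. g (restrict ?s (K T) x) = t x" using s by simp
qed

lemma factor_through_epi:
  assumes d: "d \<in> Hom b c" "d ` K b = K c" and t: "t \<in> Hom b T"
    and ker: "\<And>x. x \<in> K b \<Longrightarrow> d x = \<zero>\<^bsub>M c\<^esub> \<Longrightarrow> t x = \<zero>\<^bsub>M T\<^esub>"
  shows "\<exists>s\<in>Hom c T. \<forall>x\<in>K b. s (d x) = t x"
proof
  let ?s = "\<lambda>z. t (inv_into (K b) d z)"
  have i: "inv_into (K b) d z \<in> K b" "d (inv_into (K b) d z) = z" if "z \<in> K c" for z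
    using that d by (auto intro: inv_into_into f_inv_into_f)
  have s: "?s (d x) = t x" if x: "x \<in> K b" for x
  proof -
    let ?y = "inv_into (K b) d (d x)"
    have y: "?y \<in> K b" "d ?y = d x" using i d x by auto
    \<comment> \<open>Two preimages of one element under \<open>d\<close> differ by an element of
      the kernel, on which \<open>t\<close> vanishes.\<close>
    then have "t (?y \<ominus>\<^bsub>M b\<^esub> x) = \<zero>\<^bsub>M T\<^esub>" using d x by (intro ker) (auto simp: Hom_minus minus_eq_zero_iff)
    then show ?thesis using t x y by (simp add: Hom_minus minus_eq_zero_iff)
  qed
  show "restrict ?s (K c) \<in> Hom c T"
  proof (rule HomI)
    fix x y assume xy: "x \<in> K c" "y \<in> K c"
    then obtain x' y' where x'y': "x' \<in> K b" "x = d x'" "y' \<in> K b" "y = d y'" using d by blast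
    then have "x \<oplus>\<^bsub>M c\<^esub> y = d (x' \<oplus>\<^bsub>M b\<^esub> y')" using d by (simp add: Hom_add)
    then show "?s (x \<oplus>\<^bsub>M c\<^esub> y) = ?s x \<oplus>\<^bsub>M T\<^esub> ?s y" 
      using x'y' t s[of x'] s[of y'] s[of "x' \<oplus>\<^bsub>M b\<^esub> y'"] by (simp add: Hom_add)
  qed (use i t in auto)
  show "\<forall>x\<in>K b. restrict ?s (K c) (d x) = t x" using s d by auto
qed


section \<open>Linear maps given by matrices\<close>

definition admissible :: "obj \<Rightarrow> obj \<Rightarrow> int list list \<Rightarrow> bool" where
  "admissible a b L \<longleftrightarrow> (\<forall>r<rk a. \<forall>s<rk b. ord b s dvd ord a r * L ! r ! s)"

lemma lin_nth [simp]:
  "x \<in> K a \<Longrightarrow> s < rk b \<Longrightarrow> lin p a b L x ! s = (\<Sum>r<rk a. x ! r * L ! r ! s) mod ord b s"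
  by (simp add: lin_def)

lemma lin_closed [simp]: "x \<in> K a \<Longrightarrow> lin p a b L x \<in> K b"
  by (simp add: lin_def)

text \<open>Changing \<open>x ! r\<close> by a multiple of its order changes each sum by a multiple
  of \<open>ord b s\<close>; this is exactly what \<open>admissible\<close> provides. Composites can
  thus be computed on unreduced vectors.\<close>

lemma lin_reduce:
  assumes L: "admissible a b L" and x: "length x = rk a" and s: "s < rk b"
  shows "lin p a b L (reduce p a x) ! s = (\<Sum>r<rk a. x ! r * L ! r ! s) mod ord b s"
proof -
  have "[reduce p a x ! r * L ! r ! s = x ! r * L ! r ! s] (mod ord b s)" if r: "r < rk a" for r
  proof -
    have "x ! r * L ! r ! s - reduce p a x ! r * L ! r ! s = (x ! r div ord a r) * (ord a r * L ! r ! s)"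
      using x r by (simp add: minus_mod_eq_mult_div[symmetric] algebra_simps)
    moreover have "ord b s dvd ord a r * L ! r ! s" using L r s by (simp add: admissible_def)
    ultimately have "ord b s dvd x ! r * L ! r ! s - reduce p a x ! r * L ! r ! s" by simp
    then show ?thesis by (simp add: cong_iff_dvd_diff dvd_diff_commute)
  qed
  then have "[(\<Sum>r<rk a. reduce p a x ! r * L ! r ! s) = (\<Sum>r<rk a. x ! r * L ! r ! s)] (mod ord b s)"
    by (intro cong_sum) simp
  then show ?thesis using x s by (simp add: cong_def)
qed

lemma lin_Hom [simp]: "admissible a b L \<Longrightarrow> lin p a b L \<in> Hom a b"
proof (rule HomI')
  fix x y assume L: "admissible a b L" and xy: "x \<in> K a" "y \<in> K a"
  have "lin p a b L (x \<oplus>\<^bsub>M a\<^esub> y) ! s = (lin p a b L x \<oplus>\<^bsub>M b\<^esub> lin p a b L y) ! s" if s: "s < rk b" for s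
  proof -
    have "lin p a b L (x \<oplus>\<^bsub>M a\<^esub> y) ! s = (\<Sum>r<rk a. (x ! r + y ! r) * L ! r ! s) mod ord b s"
      unfolding add_M using xy s L by (subst lin_reduce) auto
    also have "\<dots> = (lin p a b L x \<oplus>\<^bsub>M b\<^esub> lin p a b L y) ! s"
      using xy s by (simp add: ring_distribs sum.distrib mod_simps)
    finally show ?thesis .
  qed
  then show "lin p a b L (x \<oplus>\<^bsub>M a\<^esub> y) = lin p a b L x \<oplus>\<^bsub>M b\<^esub> lin p a b L y"
    using xy by (intro K_eqI[of _ b]) auto
qed (auto simp: lin_def)

lemma lin_comp:
  assumes L: "admissible a b L" and N: "admissible b c N"
    and eq: "\<And>r s. r < rk a \<Longrightarrow> s < rk c \<Longrightarrow> [(\<Sum>t<rk b. L ! r ! t * N ! t ! s) = J ! r ! s] (mod ord c s)"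
  shows "E_comp p a (lin p a b L) (lin p b c N) = lin p a c J"
proof (rule extensionalityI[of _ "K a"])
  fix x assume x: "x \<in> K a"
  have "lin p b c N (lin p a b L x) ! s = lin p a c J x ! s" if s: "s < rk c" for s
  proof -
    define y where "y = map (\<lambda>t. \<Sum>r<rk a. x ! r * L ! r ! t) [0..<rk b]"
    have "lin p a b L x = reduce p b y" using x by (simp add: y_def lin_def)
    then have "lin p b c N (lin p a b L x) ! s = (\<Sum>t<rk b. (\<Sum>r<rk a. x ! r * L ! r ! t) * N ! t ! s) mod ord c s"
      using lin_reduce[OF N _ s, of y] by (simp add: y_def)
    also have "(\<Sum>t<rk b. (\<Sum>r<rk a. x ! r * L ! r ! t) * N ! t ! s) = (\<Sum>r<rk a. x ! r * (\<Sum>t<rk b. L ! r ! t * N ! t ! s))"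
      unfolding sum_distrib_left sum_distrib_right by (subst sum.swap) (simp add: mult.assoc)
    also have "[\<dots> = (\<Sum>r<rk a. x ! r * J ! r ! s)] (mod ord c s)"
      using eq s by (intro cong_sum cong_mult) auto
    ultimately show ?thesis using x s by (simp add: cong_def)
  qed
  then show "E_comp p a (lin p a b L) (lin p b c N) x = lin p a c J x"
    using x by (intro K_eqI[of _ c]) auto
qed (auto simp: E_comp_def lin_def)

text \<open>The reduction matters for trivial summands, where the generator is 0 and not 1.\<close>

definition unit_vec :: "obj \<Rightarrow> nat \<Rightarrow> int list" where
  "unit_vec a k = reduce p a ((replicate (rk a) 0)[k := 1])"

lemma unit_vec_K [simp]: "unit_vec a k \<in> K a"
  by (simp add: unit_vec_def)

lemma unit_vec_nth: "r < rk a \<Longrightarrow> unit_vec a k ! r = (if r = k then 1 mod ord a k else 0)"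
  by (simp add: unit_vec_def nth_list_update)

text \<open>Every element is reached from zero by adding unit vectors, so the induction runs over
  the sum of the nonnegative representatives.\<close>

lemma Hom_eqI_unit_vec:
  assumes f: "f \<in> Hom a b" and g: "g \<in> Hom a b"
    and eq: "\<And>k. k < rk a \<Longrightarrow> f (unit_vec a k) = g (unit_vec a k)"
  shows "f = g"
proof (rule Hom_ext[OF f g])
  fix x assume "x \<in> K a"
  then show "f x = g x"
  proof (induction "nat (\<Sum>k<rk a. x ! k)" arbitrary: x rule: less_induct)
    case less
    show ?case
    proof (cases "\<exists>k<rk a. x ! k \<noteq> 0")
      case False
      then have "x = \<zero>\<^bsub>M a\<^esub>" using less.prems by (intro K_eqI[of _ a]) auto
      then show ?thesis using f g by simp
    next
      case True
      then obtain k where k: "k < rk a" "x ! k \<noteq> 0" by blast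
      then have xk: "1 \<le> x ! k" "x ! k < ord a k" using K_bounds[OF less.prems k(1)] by auto
      define y where "y = x[k := x ! k - 1]"
      have y: "y \<in> K a"
        unfolding y_def using less.prems xk k(1) K_bounds[OF less.prems]
        by (intro K_I) (auto simp: nth_list_update intro: less_trans[of _ "x ! k"])
      have "(\<Sum>r<rk a. y ! r) = (\<Sum>r<rk a. x ! r) - 1"
        using k less.prems by (simp add: y_def sum.remove[of _ k] nth_list_update)
      moreover have "(\<Sum>r<rk a. y ! r) \<ge> 0" using K_bounds(1)[OF y] by (intro sum_nonneg) auto
      ultimately have "f y = g y" using y by (intro less.hyps) auto
      moreover have "x = y \<oplus>\<^bsub>M a\<^esub> unit_vec a k"
      proof (rule K_eqI[of _ a])
        fix r assume r: "r < rk a"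
        then show "x ! r = (y \<oplus>\<^bsub>M a\<^esub> unit_vec a k) ! r"
          using less.prems y xk by (cases "r = k") (auto simp: unit_vec_nth y_def)
      qed (use less.prems y in auto)
      ultimately show ?thesis using f g y eq k by (simp add: Hom_add)
    qed
  qed
qed

section \<open>Free modules are projective and injective\<close>

lemma summands_le: "a \<in> E_obj m \<Longrightarrow> k < rk a \<Longrightarrow> summands a ! k \<le> m"
  using nth_mem[of k "summands a"] by (auto simp: summands_def E_obj_def)

lemma ord_dvd: "a \<in> E_obj m \<Longrightarrow> k < rk a \<Longrightarrow> ord a k dvd int p ^ m"
  by (simp add: summands_le le_imp_power_dvd)

lemma pow_eq_zero:
  assumes "a \<in> E_obj m" "x \<in> K a"
  shows "x [^]\<^bsub>add_monoid (M a)\<^esub> (p ^ m) = \<zero>\<^bsub>M a\<^esub>"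
proof (rule K_eqI[of _ a])
  fix k assume k: "k < rk a"
  have "ord a k dvd int p ^ m * x ! k" using ord_dvd[OF assms(1) k] by simp
  then show "(x [^]\<^bsub>add_monoid (M a)\<^esub> (p ^ m)) ! k = \<zero>\<^bsub>M a\<^esub> ! k"
    using assms k by (simp add: pow_eq_smult smult_M)
qed (use assms in \<open>auto simp: pow_eq_smult smult_M\<close>)

text \<open>The rows of the lift are arbitrary preimages of the images of the unit vectors. Any
  choice is admissible, because the generators of \<open>N\<close> have order \<open>p ^ m\<close>,
  which kills every object.\<close>

lemma projective_free:
  assumes N: "N \<in> E_obj m" "\<And>k. k < rk N \<Longrightarrow> summands N ! k = m"
  shows "projective_obj p m N"
  unfolding projective_obj_def
proof (intro conjI ballI impI N(1))
  fix a b g f assume a: "a \<in> E_obj m" and g: "g \<in> Hom a b" "g ` K a = K b" and f: "f \<in> Hom N b"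
  have "\<exists>l. l \<in> K a \<and> g l = f (unit_vec N k)" for k
    using g(2) Hom_closed[OF f unit_vec_K] by (metis imageE)
  then obtain l where l: "l k \<in> K a" "g (l k) = f (unit_vec N k)" for k by metis
  define L where "L = map l [0..<rk N]"
  have L: "admissible N a L" using ord_dvd[OF a] N(2) by (auto simp: admissible_def)
  have lu: "lin p N a L (unit_vec N k) = l k" if k: "k < rk N" for k
  proof (rule K_eqI[of _ a])
    fix s assume s: "s < rk a"
    \<comment> \<open>The entry of the unit vector is 1 only after reduction, so it is compared with
      1 modulo the order of the target, which divides \<open>p ^ m\<close>.\<close>
    have "[1 mod ord N k = 1] (mod ord a s)"
      using ord_dvd[OF a s] N(2)[OF k] by (simp add: cong_def mod_mod_cancel)
    then have "[1 mod ord N k * l k ! s = 1 * l k ! s] (mod ord a s)" by (rule cong_mult) simp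
    moreover have "(\<Sum>r<rk N. unit_vec N k ! r * L ! r ! s) = 1 mod ord N k * l k ! s"
      using k by (subst sum.remove[of _ k]) (auto simp: unit_vec_nth L_def)
    ultimately show "lin p N a L (unit_vec N k) ! s = l k ! s"
      using s l(1)[of k] by (simp add: cong_def)
  qed (use l in auto)
  have "E_comp p N (lin p N a L) g = f"
    using L g f lu l by (intro Hom_eqI_unit_vec[OF E_comp_Hom[OF lin_Hom[OF L] g(1)] f]) auto
  then show "\<exists>h\<in>Hom N a. E_comp p N h g = f" using L by auto
qed

text \<open>A homomorphism into \<open>N\<close> is a tuple of functions that are additive modulo
  \<open>p ^ m\<close>. Each of them is carried to the image of \<open>g\<close> and extended from
  this subgroup by \<open>extend_additive_mod\<close>.\<close>

lemma injective_free:
  assumes N: "N \<in> E_obj m" "\<And>k. k < rk N \<Longrightarrow> summands N ! k = m"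
  shows "injective_obj p m N"
  unfolding injective_obj_def
proof (intro conjI ballI impI N(1))
  fix a b g f
  assume b: "b \<in> E_obj m" and g: "g \<in> Hom a b" "inj_on g (K a)" and f: "f \<in> Hom a N"
  have img: "subgroup (g ` K a) (add_monoid (M b))"
  proof (rule group.subgroupI[OF M.a_group])
    show "g ` K a \<noteq> {}" using zero_closed by blast
    show "inv\<^bsub>add_monoid (M b)\<^esub> y \<in> g ` K a" if "y \<in> g ` K a" for y
      using that g(1) by (auto simp: Hom_neg[symmetric] simp flip: a_inv_def)
    show "y \<otimes>\<^bsub>add_monoid (M b)\<^esub> z \<in> g ` K a" if "y \<in> g ` K a" "z \<in> g ` K a" for y z
      using that g(1) by (auto simp: Hom_add[symmetric])
  qed (use g in auto)
  have gi: "inv_into (K a) g (g x) = x" if "x \<in> K a" for x using g(2) that by simp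
  have "\<exists>\<psi>. (\<forall>x\<in>K b. \<forall>y\<in>K b. [\<psi> (x \<oplus>\<^bsub>M b\<^esub> y) = \<psi> x + \<psi> y] (mod int p ^ m)) \<and>
    (\<forall>x\<in>g ` K a. [\<psi> x = f (inv_into (K a) g x) ! k] (mod int p ^ m))" if k: "k < rk N" for k
  proof (rule comm_group.extend_additive_mod[OF M.a_comm_group[of b], of "p ^ m" "g ` K a"
        "\<lambda>x. f (inv_into (K a) g x) ! k", simplified partial_object.simps monoid.simps of_nat_power])
    show "finite (K b)" by (rule finite_K)
    show "0 < p ^ m" using p_pos by simp
    show "\<And>x. x \<in> K b \<Longrightarrow> x [^]\<^bsub>add_monoid (M b)\<^esub> p ^ m = \<zero>\<^bsub>M b\<^esub>" by (rule pow_eq_zero[OF b])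
    show "subgroup (g ` K a) (add_monoid (M b))" by (rule img)
    show "[f (inv_into (K a) g (y \<oplus>\<^bsub>M b\<^esub> z)) ! k = f (inv_into (K a) g y) ! k + f (inv_into (K a) g z) ! k] (mod int p ^ m)"
      if "y \<in> g ` K a" "z \<in> g ` K a" for y z
      using that g(1) f k N(2)[OF k] by (auto simp: Hom_add[symmetric] gi) (simp add: Hom_add cong_def)
  qed
  then have "\<exists>\<psi>. \<forall>k<rk N. (\<forall>x\<in>K b. \<forall>y\<in>K b. [\<psi> k (x \<oplus>\<^bsub>M b\<^esub> y) = \<psi> k x + \<psi> k y] (mod int p ^ m)) \<and>
    (\<forall>x\<in>g ` K a. [\<psi> k x = f (inv_into (K a) g x) ! k] (mod int p ^ m))" by metis
  then obtain \<psi> where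
    psi_add: "\<And>k x y. k < rk N \<Longrightarrow> x \<in> K b \<Longrightarrow> y \<in> K b \<Longrightarrow> [\<psi> k (x \<oplus>\<^bsub>M b\<^esub> y) = \<psi> k x + \<psi> k y] (mod int p ^ m)"
    and psi': "\<And>k x. k < rk N \<Longrightarrow> x \<in> g ` K a \<Longrightarrow> [\<psi> k x = f (inv_into (K a) g x) ! k] (mod int p ^ m)" by blast
  have psi: "[\<psi> k (g x) = f x ! k] (mod int p ^ m)" if "k < rk N" "x \<in> K a" for k x
    using psi'[of k "g x"] gi that by simp
  define h where "h = (\<lambda>y\<in>K b. reduce p N (map (\<lambda>k. \<psi> k y) [0..<rk N]))"
  have h: "h \<in> Hom b N"
    unfolding h_def
  proof (rule HomI)
    fix x y assume xy: "x \<in> K b" "y \<in> K b"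
    show "reduce p N (map (\<lambda>k. \<psi> k (x \<oplus>\<^bsub>M b\<^esub> y)) [0..<rk N]) =
        reduce p N (map (\<lambda>k. \<psi> k x) [0..<rk N]) \<oplus>\<^bsub>M N\<^esub> reduce p N (map (\<lambda>k. \<psi> k y) [0..<rk N])"
      using psi_add[OF _ xy] N(2) by (intro K_eqI[of _ N]) (auto simp: cong_def mod_simps)
  qed simp
  have "E_comp p a g h = f"
  proof (rule Hom_ext[of _ a N])
    fix x assume x: "x \<in> K a"
    then show "E_comp p a g h x = f x"
      using g f psi[OF _ x] N(2) nth_K_mod[OF Hom_closed[OF f x]]
      by (intro K_eqI[of _ N]) (auto simp: h_def cong_def)
  qed (use g f h in auto)
  then show "\<exists>h\<in>Hom b N. E_comp p a g h = f" using h by blast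
qed

lemma bijective_free:
  "N \<in> E_obj m \<Longrightarrow> (\<And>k. k < rk N \<Longrightarrow> summands N ! k = m) \<Longrightarrow> bijective_obj p m N"
  by (simp add: bijective_obj_def projective_free injective_free)

end

section \<open>Lists of summands\<close>

lemma sorted_concat_replicate: "sorted (concat (map (\<lambda>i. replicate (f i) i) [0..<n]))"
  by (induction n) (auto simp: sorted_append)

text \<open>A sorted list is determined by its multiset, and the multiplicities stored in
  \<open>dsum\<close> are those of \<open>es\<close>; the bound on the entries ensures that none is
  lost.\<close>

lemma summands_dsum:
  assumes "\<And>e. e \<in> set es \<Longrightarrow> e \<le> m"
  shows "summands (dsum m es) = sort es"
proof -
  have s: "summands (dsum m es) = concat (map (\<lambda>i. replicate (count_list es i) i) [0..<Suc m])"
    unfolding summands_def dsum_def by (intro arg_cong[of _ _ concat] map_cong) (auto simp del: upt_Suc)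
  have cnt: "count (mset (concat (map (\<lambda>i. replicate (f i) i) [0..<n]))) e = (if e < n then f e else 0)" for n e and f :: "nat \<Rightarrow> nat"
    by (induction n) auto
  have "mset (summands (dsum m es)) = mset es"
    unfolding s
  proof (intro multiset_eqI)
    fix e
    show "count (mset (concat (map (\<lambda>i. replicate (count_list es i) i) [0..<Suc m]))) e = count (mset es) e"
      unfolding cnt using assms[of e] by (auto simp: count_mset count_list_0_iff)
  qed
  then show ?thesis using sorted_concat_replicate unfolding s by (metis properties_for_sort)
qed

lemma dsum_E_obj [simp]: "dsum m es \<in> E_obj m"
  by (simp add: dsum_def E_obj_def)

lemma rev_E_obj [simp]: "rev a \<in> E_obj m \<longleftrightarrow> a \<in> E_obj m"
  by (simp add: E_obj_def)

lemma summands_rev: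
  assumes "a \<in> E_obj m"
  shows "summands (rev a) = rev (map (\<lambda>e. m - e) (summands a))"
proof -
  have a: "length a = Suc m" using assms by (simp add: E_obj_def)
  have "rev (map (\<lambda>e. m - e) (summands a)) = concat (map (\<lambda>i. replicate (a ! i) (m - i)) (rev [0..<Suc m]))"
    unfolding summands_def a map_concat rev_concat map_map rev_map by (simp add: comp_def rev_map del: upt_Suc)
  also have "rev [0..<Suc m] = map (\<lambda>i. m - i) [0..<Suc m]"
    by (intro nth_equalityI) (auto simp: rev_nth simp del: upt_Suc)
  also have "concat (map (\<lambda>i. replicate (a ! i) (m - i)) (map (\<lambda>i. m - i) [0..<Suc m])) = summands (rev a)"
    unfolding summands_def length_rev a map_map
    by (intro arg_cong[of _ _ concat] map_cong) (auto simp: a rev_nth simp del: upt_Suc)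
  finally show ?thesis ..
qed

context primary_modules begin

lemma rk_rev [simp]: "a \<in> E_obj m \<Longrightarrow> rk (rev a) = rk a"
  by (simp add: summands_rev)

lemma summands_rev_nth [simp]: "a \<in> E_obj m \<Longrightarrow> k < rk a \<Longrightarrow> summands (rev a) ! k = m - summands a ! (rk a - Suc k)"
  by (simp add: summands_rev rev_nth)

lemma mid_E_obj [simp]: "mid m a \<in> E_obj m"
  by (simp add: mid_def)

lemma summands_mid [simp]: "summands (mid m a) = replicate (rk a) m"
  unfolding mid_def by (subst summands_dsum) (auto simp: sorted_sort_id)

lemma bijective_mid: "bijective_obj p m (mid m a)"
  by (intro bijective_free) auto

section \<open>The distinguished short exact sequences\<close>

abbreviation ifl where "ifl \<equiv> infl p m"
abbreviation dfl where "dfl \<equiv> defl p m"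

lemma infl_nth [simp]: "x \<in> K a \<Longrightarrow> k < rk a \<Longrightarrow> ifl a x ! k = int p ^ (m - summands a ! k) * x ! k"
  by (simp add: infl_def)

lemma infl_Hom [simp]:
  assumes a: "a \<in> E_obj m"
  shows "ifl a \<in> Hom a (mid m a)"
proof (rule HomI')
  have pm: "int p ^ (m - summands a ! k) * ord a k = int p ^ m" if "k < rk a" for k
    using summands_le[OF a that] by (simp flip: power_add)
  show *: "ifl a x \<in> K (mid m a)" if x: "x \<in> K a" for x
  proof (rule K_I)
    fix k assume "k < rk (mid m a)"
    then have k: "k < rk a" by simp
    have "int p ^ (m - summands a ! k) * x ! k < int p ^ (m - summands a ! k) * ord a k"
      using K_bounds[OF x k] p_pos by simp
    then show "0 \<le> ifl a x ! k \<and> ifl a x ! k < ord (mid m a) k"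
      using x k pm[OF k] K_bounds[OF x k] p_pos by simp
  qed (use x in \<open>simp add: infl_def\<close>)
  fix x y assume xy: "x \<in> K a" "y \<in> K a"
  show "ifl a (x \<oplus>\<^bsub>M a\<^esub> y) = ifl a x \<oplus>\<^bsub>M (mid m a)\<^esub> ifl a y"
    using xy *
    by (intro K_eqI[of _ "mid m a"]) (auto simp: pm[symmetric] mult_mod_right ring_distribs)
qed (simp add: infl_def)

lemma infl_closed [simp]: "a \<in> E_obj m \<Longrightarrow> x \<in> K a \<Longrightarrow> ifl a x \<in> K (mid m a)"
  using Hom_closed[OF infl_Hom] .

lemma infl_inj: "a \<in> E_obj m \<Longrightarrow> inj_on (ifl a) (K a)"
proof (rule inj_onI)
  fix x y assume a: "a \<in> E_obj m" and xy: "x \<in> K a" "y \<in> K a" "ifl a x = ifl a y"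
  show "x = y"
  proof (rule K_eqI[OF xy(1,2)])
    fix k assume k: "k < rk a"
    have "ifl a x ! k = ifl a y ! k" using xy by simp
    then show "x ! k = y ! k" unfolding infl_nth[OF xy(1) k] infl_nth[OF xy(2) k] using p_pos by simp
  qed
qed

lemma defl_nth [simp]:
  "a \<in> E_obj m \<Longrightarrow> y \<in> K (mid m a) \<Longrightarrow> k < rk a \<Longrightarrow>
   dfl a y ! k = y ! (rk a - Suc k) mod int p ^ (m - summands a ! (rk a - Suc k))"
  by (simp add: defl_def rev_nth)

lemma defl_Hom [simp]:
  assumes a: "a \<in> E_obj m"
  shows "dfl a \<in> Hom (mid m a) (rev a)"
proof (rule HomI')
  show *: "dfl a y \<in> K (rev a)" if y: "y \<in> K (mid m a)" for y
    using a y p_pos by (intro K_I) (auto simp: defl_def rev_nth)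
  have d: "t mod int p ^ m mod int p ^ (m - e) = t mod int p ^ (m - e)" for t e
    by (simp add: mod_mod_cancel le_imp_power_dvd)
  fix x y assume xy: "x \<in> K (mid m a)" "y \<in> K (mid m a)"
  show "dfl a (x \<oplus>\<^bsub>M (mid m a)\<^esub> y) = dfl a x \<oplus>\<^bsub>M (rev a)\<^esub> dfl a y"
    using a xy * by (intro K_eqI[of _ "rev a"]) (auto simp: d mod_simps)
qed (simp add: defl_def)

lemma defl_closed [simp]: "a \<in> E_obj m \<Longrightarrow> y \<in> K (mid m a) \<Longrightarrow> dfl a y \<in> K (rev a)"
  using Hom_closed[OF defl_Hom] .

lemma defl_surj:
  assumes a: "a \<in> E_obj m"
  shows "dfl a ` K (mid m a) = K (rev a)"
proof (intro equalityI subsetI)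
  fix z assume z: "z \<in> K (rev a)"
  have zn: "0 \<le> z ! (rk a - Suc k) \<and> z ! (rk a - Suc k) < int p ^ (m - summands a ! k)" if "k < rk a" for k
    using K_bounds[OF z, of "rk a - Suc k"] that a by simp
  have "rev z \<in> K (mid m a)"
  proof (rule K_I)
    fix k assume k: "k < rk (mid m a)"
    have "int p ^ (m - summands a ! k) \<le> int p ^ m" using p_pos by (intro power_increasing) auto
    then show "0 \<le> rev z ! k \<and> rev z ! k < ord (mid m a) k" using zn[of k] k z a by (auto simp: rev_nth)
  qed (use z a in auto)
  moreover have "dfl a (rev z) = z"
  proof (rule K_eqI[of _ "rev a"])
    fix k assume "k < rk (rev a)"
    then have "k < rk a" using a by simp
    then show "dfl a (rev z) ! k = z ! k"
      using a z calculation zn[of "rk a - Suc k"] by (simp add: rev_nth Suc_diff_Suc)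
  qed (use a z calculation in auto)
  ultimately show "z \<in> dfl a ` K (mid m a)" by force
qed (use a in auto)

text \<open>A coordinate vanishes modulo \<open>p ^ (m - i)\<close> iff it is divisible by that
  power, and the quotient is then the coordinate of a preimage. This is exactness of the
  distinguished sequence in the middle.\<close>

lemma defl_zero_iff:
  assumes a: "a \<in> E_obj m" and y: "y \<in> K (mid m a)"
  shows "dfl a y = \<zero>\<^bsub>M (rev a)\<^esub> \<longleftrightarrow> y \<in> ifl a ` K a"
proof
  assume "y \<in> ifl a ` K a"
  then show "dfl a y = \<zero>\<^bsub>M (rev a)\<^esub>"
    using a y by (intro K_eqI[of _ "rev a"] Hom_closed[OF defl_Hom]) auto
next
  assume z: "dfl a y = \<zero>\<^bsub>M (rev a)\<^esub>"
  have dv: "int p ^ (m - summands a ! k) dvd y ! k" if k: "k < rk a" for k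
  proof -
    have "dfl a y ! (rk a - Suc k) = 0" unfolding z using a k by (intro zero_nth) auto
    then show ?thesis using a y k by (simp add: Suc_diff_Suc dvd_eq_mod_eq_0)
  qed
  define x where "x = map (\<lambda>k. y ! k div int p ^ (m - summands a ! k)) [0..<rk a]"
  have xy: "int p ^ (m - summands a ! k) * x ! k = y ! k" if "k < rk a" for k
    using dv that by (simp add: x_def)
  have x: "x \<in> K a"
  proof (rule K_I)
    fix k assume k: "k < rk a"
    have "int p ^ (m - summands a ! k) * ord a k = int p ^ m"
      using summands_le[OF a k] by (simp flip: power_add)
    then have "0 \<le> int p ^ (m - summands a ! k) * x ! k" "int p ^ (m - summands a ! k) * x ! k < int p ^ (m - summands a ! k) * ord a k"
      using K_bounds[OF y] k xy[OF k] by auto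
    moreover have "0 < int p ^ (m - summands a ! k)" using p_pos by simp
    ultimately show "0 \<le> x ! k \<and> x ! k < ord a k" by (auto simp: zero_le_mult_iff)
  qed (simp add: x_def)
  moreover have "y = ifl a x"
    using x y xy a by (intro K_eqI[of _ "mid m a"] Hom_closed[OF infl_Hom]) auto
  ultimately show "y \<in> ifl a ` K a" by blast
qed

section \<open>Stably zero maps\<close>

lemma mid_lift:
  assumes "a \<in> E_obj m" "b \<in> E_obj m" "g \<in> Hom a b" "g ` K a = K b" "f \<in> Hom (mid m c) b"
  shows "\<exists>h\<in>Hom (mid m c) a. \<forall>x\<in>K (mid m c). g (h x) = f x"
proof -
  obtain h where h: "h \<in> Hom (mid m c) a" "E_comp p (mid m c) h g = f"
    using bijective_mid[of c] assms unfolding bijective_obj_def projective_obj_def by blast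
  then show ?thesis by (metis E_comp_apply)
qed

lemma bijective_extend:
  assumes "bijective_obj p m N" "a \<in> E_obj m" "b \<in> E_obj m" "g \<in> Hom a b" "inj_on g (K a)" "f \<in> Hom a N"
  shows "\<exists>h\<in>Hom b N. \<forall>x\<in>K a. h (g x) = f x"
proof -
  obtain h where h: "h \<in> Hom b N" "E_comp p a g h = f"
    using assms unfolding bijective_obj_def injective_obj_def by blast
  then show ?thesis by (metis E_comp_apply)
qed

text \<open>Using one fixed monomorphism instead of an arbitrary bijective object gives all stably
  zero maps out of \<open>a\<close> a common middle term, so that their witnesses can be
  added.\<close>

definition null :: "obj \<Rightarrow> obj \<Rightarrow> fn \<Rightarrow> bool" where
  "null a b f \<longleftrightarrow> (\<exists>k\<in>Hom (mid m a) b. \<forall>x\<in>K a. f x = k (ifl a x))"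

text \<open>Injectivity of \<open>N\<close> extends \<open>u\<close> along the distinguished
  monomorphism, so any factorization through a bijective object yields one through the middle term
  of the source.\<close>

lemma null_factor:
  assumes a: "a \<in> E_obj m" and N: "bijective_obj p m N" "u \<in> Hom a N" "v \<in> Hom N b"
    and f: "\<And>x. x \<in> K a \<Longrightarrow> f x = v (u x)"
  shows "null a b f"
proof -
  obtain h where "h \<in> Hom (mid m a) N" "\<forall>x\<in>K a. h (ifl a x) = u x"
    using bijective_extend[OF N(1) a mid_E_obj infl_Hom[OF a] infl_inj[OF a] N(2)] by blast
  then show ?thesis unfolding null_def using N f a
    by (intro bexI[of _ "E_comp p (mid m a) h v"]) auto
qed

lemma stab_iff:
  assumes a: "a \<in> E_obj m"
  shows "(f, g) \<in> stab p m a b \<longleftrightarrow> f \<in> Hom a b \<and> g \<in> Hom a b \<and> null a b (hsum a b f (hneg a b g))"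
proof safe
  assume "(f, g) \<in> stab p m a b"
  then obtain N u v where fg: "f \<in> Hom a b" "g \<in> Hom a b" and N: "bijective_obj p m N" "u \<in> Hom a N" "v \<in> Hom N b"
    and eq: "\<And>x. x \<in> K a \<Longrightarrow> f x = g x \<oplus>\<^bsub>M b\<^esub> v (u x)"
    by (auto simp: stab_def)
  show "f \<in> Hom a b" "g \<in> Hom a b" by fact+
  show "null a b (hsum a b f (hneg a b g))"
    using a N fg eq by (intro null_factor[of a N u v]) (auto simp: minus_add_cancel M.minus_eq[symmetric])
next
  assume fg: "f \<in> Hom a b" "g \<in> Hom a b" and "null a b (hsum a b f (hneg a b g))"
  then obtain k where k: "k \<in> Hom (mid m a) b" "\<And>x. x \<in> K a \<Longrightarrow> f x \<ominus>\<^bsub>M b\<^esub> g x = k (ifl a x)"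
    by (auto simp: null_def M.minus_eq)
  have "f x = g x \<oplus>\<^bsub>M b\<^esub> k (ifl a x)" if "x \<in> K a" for x
    unfolding k(2)[OF that, symmetric] using that fg by (simp add: add_minus_cancel)
  then show "(f, g) \<in> stab p m a b" using fg k a bijective_mid[of a] infl_Hom[OF a] unfolding stab_def by blast
qed

lemma null_cong: "(\<And>x. x \<in> K a \<Longrightarrow> f x = g x) \<Longrightarrow> null a b f \<longleftrightarrow> null a b g"
  by (simp add: null_def)

lemma null_hzero: "a \<in> E_obj m \<Longrightarrow> null a b (hzero a b)"
  unfolding null_def by (intro bexI[of _ "hzero (mid m a) b"]) auto


section \<open>The stable category\<close>

lemma null_hneg:
  assumes "a \<in> E_obj m" "null a b f"
  shows "null a b (hneg a b f)"
proof -
  obtain k where k: "k \<in> Hom (mid m a) b" "\<And>x. x \<in> K a \<Longrightarrow> f x = k (ifl a x)" using assms by (auto simp: null_def)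
  then show ?thesis using assms(1) unfolding null_def by (intro bexI[of _ "hneg (mid m a) b k"]) auto
qed

lemma null_hsum:
  assumes "a \<in> E_obj m" "null a b f" "null a b g"
  shows "null a b (hsum a b f g)"
proof -
  obtain k where k: "k \<in> Hom (mid m a) b" "\<And>x. x \<in> K a \<Longrightarrow> f x = k (ifl a x)" using assms by (auto simp: null_def)
  obtain l where l: "l \<in> Hom (mid m a) b" "\<And>x. x \<in> K a \<Longrightarrow> g x = l (ifl a x)" using assms by (auto simp: null_def)
  show ?thesis using assms(1) k l unfolding null_def by (intro bexI[of _ "hsum (mid m a) b k l"]) auto
qed

lemma null_comp_right:
  assumes "a \<in> E_obj m" "null a b f" "g \<in> Hom b c"
  shows "null a c (E_comp p a f g)"
proof -
  obtain k where k: "k \<in> Hom (mid m a) b" "\<And>x. x \<in> K a \<Longrightarrow> f x = k (ifl a x)" using assms by (auto simp: null_def)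
  then show ?thesis using assms unfolding null_def by (intro bexI[of _ "E_comp p (mid m a) k g"]) auto
qed

lemma null_comp_left:
  assumes "a \<in> E_obj m" "b \<in> E_obj m" "null b c f" "g \<in> Hom a b"
  shows "null a c (E_comp p a g f)"
proof -
  obtain k where k: "k \<in> Hom (mid m b) c" "\<And>x. x \<in> K b \<Longrightarrow> f x = k (ifl b x)" using assms by (auto simp: null_def)
  show ?thesis
    using assms k
    by (intro null_factor[OF assms(1) bijective_mid[of b], of "E_comp p a g (ifl b)" k]) auto
qed

abbreviation hdiff where "hdiff a b f g \<equiv> hsum a b f (hneg a b g)"

lemma hdiff_apply: "x \<in> K a \<Longrightarrow> hdiff a b f g x = f x \<ominus>\<^bsub>M b\<^esub> g x"
  by (simp add: M.minus_eq)

lemma minus_telescope: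
  "x \<in> K a \<Longrightarrow> y \<in> K a \<Longrightarrow> z \<in> K a \<Longrightarrow> (x \<ominus>\<^bsub>M a\<^esub> y) \<oplus>\<^bsub>M a\<^esub> (y \<ominus>\<^bsub>M a\<^esub> z) = x \<ominus>\<^bsub>M a\<^esub> z"
  by (intro K_eqI[of _ a]) (auto simp: mod_simps)

lemma stab_equiv:
  assumes a: "a \<in> E_obj m"
  shows "equiv (Hom a b) (stab p m a b)"
proof (rule equivI)
  show "stab p m a b \<subseteq> Hom a b \<times> Hom a b" using a by (auto simp: stab_iff)
  show "refl_on (Hom a b) (stab p m a b)"
  proof (rule refl_onI)
    fix f assume f: "f \<in> Hom a b"
    have "null a b (hdiff a b f f) \<longleftrightarrow> null a b (hzero a b)" using f by (intro null_cong) (auto simp: M.r_neg)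
    then show "(f, f) \<in> stab p m a b" using a f by (simp add: stab_iff null_hzero)
  qed
  show "sym (stab p m a b)"
  proof (rule symI)
    fix f g assume fg: "(f, g) \<in> stab p m a b"
    have "null a b (hneg a b (hdiff a b f g)) \<longleftrightarrow> null a b (hdiff a b g f)"
      using fg a by (intro null_cong) (auto simp: stab_iff M.minus_add M.a_comm)
    then show "(g, f) \<in> stab p m a b" using a fg null_hneg by (simp add: stab_iff)
  qed
  show "trans (stab p m a b)"
  proof (rule transI)
    fix f g h assume fg: "(f, g) \<in> stab p m a b" and gh: "(g, h) \<in> stab p m a b"
    have "null a b (hsum a b (hdiff a b f g) (hdiff a b g h)) \<longleftrightarrow> null a b (hdiff a b f h)"
    proof (rule null_cong)
      fix x assume "x \<in> K a"
      moreover have "f \<in> Hom a b" "g \<in> Hom a b" "h \<in> Hom a b" using fg gh a by (auto simp: stab_iff)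
      ultimately show "hsum a b (hdiff a b f g) (hdiff a b g h) x = hdiff a b f h x"
        using minus_telescope[of "f x" b "g x" "h x"] by (simp add: M.minus_eq)
    qed
    then show "(f, h) \<in> stab p m a b" using a fg gh null_hsum by (simp add: stab_iff)
  qed
qed

section \<open>Operations on stable morphisms\<close>

abbreviation C where "C \<equiv> stable_cat p m"

lemma stable_cat_simps:
  "Obj C = E_obj m"
  "Mor C = (\<lambda>a b. {a} \<times> {b} \<times> (Hom a b // stab p m a b))"
  "Cmp C = (\<lambda>(a, b, F) (b', c, G). (a, c, \<Union>f\<in>F. \<Union>g\<in>G. stab p m a c `` {E_comp p a f g}))"
  "Add C = (\<lambda>(a, b, F) (a', b', G). (a, b, \<Union>f\<in>F. \<Union>g\<in>G. stab p m a b `` {hsum a b f g}))"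
  "Neg C = (\<lambda>(a, b, F). (a, b, \<Union>f\<in>F. stab p m a b `` {hneg a b f}))"
  "Idn C a = cls p m a a (hid a)" 
  "Zer C a b = cls p m a b (hzero a b)"
  "ShO C = rev" "ShM C = stable_shift p m" "Dist C = stable_dist p m"
  by (simp_all add: stable_cat_def stable_acat_def acat.extend_def tcat.fields_def hid_def hzero_def hsum_def hneg_def)

declare stable_cat_simps(1) [simp]

lemma Mor_iff: "F \<in> Mor C a b \<longleftrightarrow> (\<exists>f\<in>Hom a b. F = cls p m a b f)"
  by (auto simp: stable_cat_simps quotient_def cls_def)

lemma cls_Mor: "f \<in> Hom a b \<Longrightarrow> cls p m a b f \<in> Mor C a b"
  unfolding Mor_iff by blast

lemma Mor_cases:
  assumes "F \<in> Mor C a b"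
  obtains f where "f \<in> Hom a b" "F = cls p m a b f"
  using assms unfolding Mor_iff by blast

lemma cls_eq_iff:
  assumes "a \<in> E_obj m" "f \<in> Hom a b" "g \<in> Hom a b"
  shows "cls p m a b f = cls p m a b g \<longleftrightarrow> null a b (hdiff a b f g)"
  using eq_equiv_class_iff[OF stab_equiv[OF assms(1)] assms(2,3)] assms by (simp add: cls_def stab_iff)

lemma cls_cong: "(\<And>x. x \<in> K a \<Longrightarrow> f x = g x) \<Longrightarrow> f \<in> Hom a b \<Longrightarrow> g \<in> Hom a b \<Longrightarrow> cls p m a b f = cls p m a b g"
  by (metis Hom_ext)

lemma cls_eq_Zer_iff:
  assumes "a \<in> E_obj m" "f \<in> Hom a b"
  shows "cls p m a b f = Zer C a b \<longleftrightarrow> null a b f"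
proof -
  have "null a b (hdiff a b f (hzero a b)) \<longleftrightarrow> null a b f" using assms by (intro null_cong) simp
  then show ?thesis using assms cls_eq_iff[of a f b "hzero a b"] by (simp add: stable_cat_simps)
qed

text \<open>The operations of \<open>stable_acat\<close> are unions over all representatives, so
  independence of the representatives is used in this form.\<close>

lemma UN_const2: "A \<noteq> {} \<Longrightarrow> B \<noteq> {} \<Longrightarrow> (\<And>x y. x \<in> A \<Longrightarrow> y \<in> B \<Longrightarrow> S x y = T) \<Longrightarrow> (\<Union>x\<in>A. \<Union>y\<in>B. S x y) = T"
  by auto

lemma stab_class_nonempty: "a \<in> E_obj m \<Longrightarrow> f \<in> Hom a b \<Longrightarrow> stab p m a b `` {f} \<noteq> {}"
  using equiv_class_self[OF stab_equiv] by blast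

lemma Cmp_cls:
  assumes ab: "a \<in> E_obj m" "b \<in> E_obj m" and f: "f \<in> Hom a b" and g: "g \<in> Hom b c"
  shows "Cmp C (cls p m a b f) (cls p m b c g) = cls p m a c (E_comp p a f g)"
proof -
  have "(\<Union>f'\<in>stab p m a b `` {f}. \<Union>g'\<in>stab p m b c `` {g}. stab p m a c `` {E_comp p a f' g'}) =
    stab p m a c `` {E_comp p a f g}"
  proof (rule UN_const2)
    fix f' g' assume "f' \<in> stab p m a b `` {f}" "g' \<in> stab p m b c `` {g}"
    then have f': "f' \<in> Hom a b" "null a b (hdiff a b f f')" and g': "g' \<in> Hom b c" "null b c (hdiff b c g g')"
      using ab by (auto simp: stab_iff)
    \<comment> \<open>The difference of \<open>g (f x)\<close> and \<open>g' (f' x)\<close> is split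
      at \<open>g' (f x)\<close>, so that only one factor changes in each part.\<close>
    have "null a c (hsum a c (E_comp p a (hdiff a b f f') g') (E_comp p a f (hdiff b c g g')))"
      by (rule null_hsum[OF ab(1) null_comp_right[OF ab(1) f'(2) g'(1)] null_comp_left[OF ab g'(2) f]])
    also have "null a c (hsum a c (E_comp p a (hdiff a b f f') g') (E_comp p a f (hdiff b c g g'))) \<longleftrightarrow>
      null a c (hdiff a c (E_comp p a f g) (E_comp p a f' g'))"
    proof (rule null_cong)
      fix x assume x: "x \<in> K a"
      have "g' (f x) \<ominus>\<^bsub>M c\<^esub> g' (f' x) \<oplus>\<^bsub>M c\<^esub> (g (f x) \<ominus>\<^bsub>M c\<^esub> g' (f x)) = g (f x) \<ominus>\<^bsub>M c\<^esub> g' (f' x)"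
        using x f f' g g' M.a_comm minus_telescope[of "g (f x)" c "g' (f x)" "g' (f' x)"] by simp
      then show "hsum a c (E_comp p a (hdiff a b f f') g') (E_comp p a f (hdiff b c g g')) x =
          hdiff a c (E_comp p a f g) (E_comp p a f' g') x"
        using x f f' g g' by (simp add: Hom_minus flip: M.minus_eq)
    qed
    finally have "(E_comp p a f g, E_comp p a f' g') \<in> stab p m a c" using ab f g f' g' by (simp add: stab_iff)
    then show "stab p m a c `` {E_comp p a f' g'} = stab p m a c `` {E_comp p a f g}"
      using equiv_class_eq[OF stab_equiv[OF ab(1)]] by metis
  qed (use ab f g stab_class_nonempty in auto)
  then show ?thesis by (simp add: stable_cat_simps cls_def)
qed

lemma Add_cls:
  assumes a: "a \<in> E_obj m" and f: "f \<in> Hom a b" and g: "g \<in> Hom a b"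
  shows "Add C (cls p m a b f) (cls p m a b g) = cls p m a b (hsum a b f g)"
proof -
  have "(\<Union>f'\<in>stab p m a b `` {f}. \<Union>g'\<in>stab p m a b `` {g}. stab p m a b `` {hsum a b f' g'}) =
    stab p m a b `` {hsum a b f g}"
  proof (rule UN_const2)
    fix f' g' assume "f' \<in> stab p m a b `` {f}" "g' \<in> stab p m a b `` {g}"
    then have f': "f' \<in> Hom a b" "null a b (hdiff a b f f')" and g': "g' \<in> Hom a b" "null a b (hdiff a b g g')"
      using a by (auto simp: stab_iff)
    have "null a b (hsum a b (hdiff a b f f') (hdiff a b g g')) \<longleftrightarrow> null a b (hdiff a b (hsum a b f g) (hsum a b f' g'))"
      using f g f' g' by (intro null_cong) (auto simp: M.minus_add M.a_ac)
    then have "(hsum a b f g, hsum a b f' g') \<in> stab p m a b" using a f g f' g' null_hsum by (simp add: stab_iff)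
    then show "stab p m a b `` {hsum a b f' g'} = stab p m a b `` {hsum a b f g}"
      using equiv_class_eq[OF stab_equiv[OF a]] by metis
  qed (use a f g stab_class_nonempty in auto)
  then show ?thesis by (simp add: stable_cat_simps cls_def)
qed

lemma Neg_cls:
  assumes a: "a \<in> E_obj m" and f: "f \<in> Hom a b"
  shows "Neg C (cls p m a b f) = cls p m a b (hneg a b f)"
proof -
  \<comment> \<open>The union over a one-point set brings the unary operation into the shape of
    \<open>UN_const2\<close>.\<close>
  have "(\<Union>f'\<in>stab p m a b `` {f}. \<Union>g'\<in>{()}. stab p m a b `` {hneg a b f'}) = stab p m a b `` {hneg a b f}"
  proof (rule UN_const2)
    fix f' assume "f' \<in> stab p m a b `` {f}"
    then have f': "f' \<in> Hom a b" "null a b (hdiff a b f f')" using a by (auto simp: stab_iff)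
    have "null a b (hneg a b (hdiff a b f f')) \<longleftrightarrow> null a b (hdiff a b (hneg a b f) (hneg a b f'))"
      using f f' by (intro null_cong) (auto simp: M.minus_add)
    then have "(hneg a b f, hneg a b f') \<in> stab p m a b" using a f f' null_hneg by (simp add: stab_iff)
    then show "stab p m a b `` {hneg a b f'} = stab p m a b `` {hneg a b f}"
      using equiv_class_eq[OF stab_equiv[OF a]] by metis
  qed (use a f stab_class_nonempty in auto)
  then show ?thesis by (simp add: stable_cat_simps cls_def)
qed

section \<open>Biproducts\<close>

definition hom_biproduct :: "obj \<Rightarrow> obj \<Rightarrow> obj \<Rightarrow> fn \<Rightarrow> fn \<Rightarrow> fn \<Rightarrow> fn \<Rightarrow> bool" where
  "hom_biproduct a b P i1 i2 p1 p2 \<longleftrightarrow>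
    P \<in> E_obj m \<and> i1 \<in> Hom a P \<and> i2 \<in> Hom b P \<and> p1 \<in> Hom P a \<and> p2 \<in> Hom P b \<and>
    (\<forall>x\<in>K a. p1 (i1 x) = x \<and> p2 (i1 x) = \<zero>\<^bsub>M b\<^esub>) \<and> (\<forall>y\<in>K b. p2 (i2 y) = y \<and> p1 (i2 y) = \<zero>\<^bsub>M a\<^esub>) \<and>
    (\<forall>z\<in>K P. i1 (p1 z) \<oplus>\<^bsub>M P\<^esub> i2 (p2 z) = z)"

text \<open>Objects list their cyclic summands in increasing order, so the direct sum is the sorted
  concatenation. Coordinate \<open>k\<close> of \<open>P\<close> is coordinate
  \<open>\<pi> k\<close> of the concatenation, where \<open>\<pi>\<close> is a sorting permutation
  with inverse \<open>\<psi>\<close>; injections and projections move coordinates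
  accordingly.\<close>

lemma ex_hom_biproduct:
  assumes ab: "a \<in> E_obj m" "b \<in> E_obj m"
  shows "\<exists>P i1 i2 p1 p2. hom_biproduct a b P i1 i2 p1 p2"
proof -
  let ?S = "summands a @ summands b" and ?n = "rk a + rk b"
  define P where "P = dsum m ?S"
  have "e \<le> m" if "e \<in> set ?S" for e
    using that summands_le[OF ab(1)] summands_le[OF ab(2)] by (auto simp: in_set_conv_nth)
  then have sP: "summands P = sort ?S" unfolding P_def by (rule summands_dsum)
  then have "mset (summands P) = mset ?S" by simp
  then obtain \<pi> where \<pi>: "\<pi> permutes {..<length ?S}" "permute_list \<pi> ?S = summands P"
    by (rule mset_eq_permutation)
  then have \<pi>n: "\<pi> permutes {..<?n}" by simp
  have rkP: "rk P = ?n" using sP by simp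
  define \<psi> where "\<psi> = Hilbert_Choice.inv \<pi>"
  have perm: "\<pi> (\<psi> k) = k" "\<psi> (\<pi> k) = k" for k
    unfolding \<psi>_def using \<pi>n by (simp_all add: permutes_inverses)
  have \<pi>_lt: "\<pi> k < ?n \<longleftrightarrow> k < ?n" for k using permutes_in_image[OF \<pi>n] by simp
  have \<psi>_lt: "\<psi> k < ?n \<longleftrightarrow> k < ?n" for k
    unfolding \<psi>_def using permutes_in_image[OF permutes_inv[OF \<pi>n]] by simp
  have sPk: "summands P ! k = (if \<pi> k < rk a then summands a ! \<pi> k else summands b ! (\<pi> k - rk a))" if "k < ?n" for k
    using that \<pi>(2) permute_list_nth[OF \<pi>(1), of k] by (simp add: nth_append)
  define i1 where "i1 = (\<lambda>x\<in>K a. map (\<lambda>k. if \<pi> k < rk a then x ! \<pi> k else 0) [0..<?n])"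
  define i2 where "i2 = (\<lambda>y\<in>K b. map (\<lambda>k. if \<pi> k < rk a then 0 else y ! (\<pi> k - rk a)) [0..<?n])"
  define p1 where "p1 = (\<lambda>z\<in>K P. map (\<lambda>j. z ! \<psi> j) [0..<rk a])"
  define p2 where "p2 = (\<lambda>z\<in>K P. map (\<lambda>j. z ! \<psi> (rk a + j)) [0..<rk b])"
  have sub: "\<pi> k - rk a < rk b" if "k < ?n" "\<not> \<pi> k < rk a" for k using that \<pi>_lt[of k] by linarith
  have i1K: "map (\<lambda>k. if \<pi> k < rk a then x ! \<pi> k else 0) [0..<?n] \<in> K P" if "x \<in> K a" for x
    using that p_pos by (intro K_I) (auto simp: rkP sPk K_bounds)
  have i2K: "map (\<lambda>k. if \<pi> k < rk a then 0 else y ! (\<pi> k - rk a)) [0..<?n] \<in> K P" if "y \<in> K b" for y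
    using that p_pos sub by (intro K_I) (auto simp: rkP sPk K_bounds)
  have p1K: "map (\<lambda>j. z ! \<psi> j) [0..<rk a] \<in> K a" if "z \<in> K P" for z
  proof (rule K_I)
    fix j assume j: "j < rk a"
    then show "0 \<le> map (\<lambda>j. z ! \<psi> j) [0..<rk a] ! j \<and> map (\<lambda>j. z ! \<psi> j) [0..<rk a] ! j < ord a j"
      using K_bounds[OF that, of "\<psi> j"] \<psi>_lt[of j] sPk[of "\<psi> j"] by (simp add: rkP perm)
  qed simp
  have p2K: "map (\<lambda>j. z ! \<psi> (rk a + j)) [0..<rk b] \<in> K b" if "z \<in> K P" for z
  proof (rule K_I)
    fix j assume j: "j < rk b"
    then show "0 \<le> map (\<lambda>j. z ! \<psi> (rk a + j)) [0..<rk b] ! j \<and> map (\<lambda>j. z ! \<psi> (rk a + j)) [0..<rk b] ! j < ord b j"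
      using K_bounds[OF that, of "\<psi> (rk a + j)"] \<psi>_lt[of "rk a + j"] sPk[of "\<psi> (rk a + j)"] by (simp add: rkP perm)
  qed simp
  have h: "i1 \<in> Hom a P" "i2 \<in> Hom b P" "p1 \<in> Hom P a" "p2 \<in> Hom P b"
    unfolding i1_def i2_def p1_def p2_def
  proof (safe intro!: HomI i1K i2K p1K p2K)
    fix x y assume xy: "x \<in> K a" "y \<in> K a"
    show "map (\<lambda>k. if \<pi> k < rk a then (x \<oplus>\<^bsub>M a\<^esub> y) ! \<pi> k else 0) [0..<?n] =
      map (\<lambda>k. if \<pi> k < rk a then x ! \<pi> k else 0) [0..<?n] \<oplus>\<^bsub>M P\<^esub> map (\<lambda>k. if \<pi> k < rk a then y ! \<pi> k else 0) [0..<?n]"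
      using xy i1K[OF xy(1)] i1K[OF xy(2)] i1K[OF add_closed[OF xy]]
      by (intro K_eqI[of _ P]) (auto simp: rkP sPk)
  next
    fix x y assume xy: "x \<in> K b" "y \<in> K b"
    show "map (\<lambda>k. if \<pi> k < rk a then 0 else (x \<oplus>\<^bsub>M b\<^esub> y) ! (\<pi> k - rk a)) [0..<?n] =
      map (\<lambda>k. if \<pi> k < rk a then 0 else x ! (\<pi> k - rk a)) [0..<?n] \<oplus>\<^bsub>M P\<^esub> map (\<lambda>k. if \<pi> k < rk a then 0 else y ! (\<pi> k - rk a)) [0..<?n]"
      using xy i2K[OF xy(1)] i2K[OF xy(2)] i2K[OF add_closed[OF xy]] sub
      by (intro K_eqI[of _ P]) (auto simp: rkP sPk)
  next
    fix x y assume xy: "x \<in> K P" "y \<in> K P"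
    show "map (\<lambda>j. (x \<oplus>\<^bsub>M P\<^esub> y) ! \<psi> j) [0..<rk a] = map (\<lambda>j. x ! \<psi> j) [0..<rk a] \<oplus>\<^bsub>M a\<^esub> map (\<lambda>j. y ! \<psi> j) [0..<rk a]"
      using xy p1K[OF xy(1)] p1K[OF xy(2)] p1K[OF add_closed[OF xy]] \<psi>_lt
      by (intro K_eqI[of _ a]) (auto simp: rkP sPk perm)
    show "map (\<lambda>j. (x \<oplus>\<^bsub>M P\<^esub> y) ! \<psi> (rk a + j)) [0..<rk b] =
      map (\<lambda>j. x ! \<psi> (rk a + j)) [0..<rk b] \<oplus>\<^bsub>M b\<^esub> map (\<lambda>j. y ! \<psi> (rk a + j)) [0..<rk b]"
      using xy p2K[OF xy(1)] p2K[OF xy(2)] p2K[OF add_closed[OF xy]] \<psi>_lt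
      by (intro K_eqI[of _ b]) (auto simp: rkP sPk perm)
  qed
  have nth: "x \<in> K a \<Longrightarrow> k < ?n \<Longrightarrow> i1 x ! k = (if \<pi> k < rk a then x ! \<pi> k else 0)"
    "y \<in> K b \<Longrightarrow> k < ?n \<Longrightarrow> i2 y ! k = (if \<pi> k < rk a then 0 else y ! (\<pi> k - rk a))"
    "z \<in> K P \<Longrightarrow> j < rk a \<Longrightarrow> p1 z ! j = z ! \<psi> j"
    "z \<in> K P \<Longrightarrow> l < rk b \<Longrightarrow> p2 z ! l = z ! \<psi> (rk a + l)" for x y z k j l
    by (simp_all add: i1_def i2_def p1_def p2_def)
  have "p1 (i1 x) = x \<and> p2 (i1 x) = \<zero>\<^bsub>M b\<^esub>" if x: "x \<in> K a" for x
  proof (rule conjI[OF K_eqI[of _ a] K_eqI[of _ b]])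
    have K: "i1 x \<in> K P" using h x by simp
    then show "p1 (i1 x) \<in> K a" "p2 (i1 x) \<in> K b" using h by simp_all
    show "p1 (i1 x) ! j = x ! j" if "j < rk a" for j
      using that K x \<psi>_lt[of j] by (simp add: nth perm)
    show "p2 (i1 x) ! j = \<zero>\<^bsub>M b\<^esub> ! j" if "j < rk b" for j
      using that K x \<psi>_lt[of "rk a + j"] by (simp add: nth perm)
  qed (use x in simp_all)
  moreover have "p2 (i2 y) = y \<and> p1 (i2 y) = \<zero>\<^bsub>M a\<^esub>" if y: "y \<in> K b" for y
  proof (rule conjI[OF K_eqI[of _ b] K_eqI[of _ a]])
    have K: "i2 y \<in> K P" using h y by simp
    then show "p1 (i2 y) \<in> K a" "p2 (i2 y) \<in> K b" using h by simp_all
    show "p1 (i2 y) ! j = \<zero>\<^bsub>M a\<^esub> ! j" if "j < rk a" for j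
      using that K y \<psi>_lt[of j] by (simp add: nth perm)
    show "p2 (i2 y) ! j = y ! j" if "j < rk b" for j
      using that K y \<psi>_lt[of "rk a + j"] by (simp add: nth perm)
  qed (use y in simp_all)
  moreover have "i1 (p1 z) \<oplus>\<^bsub>M P\<^esub> i2 (p2 z) = z" if z: "z \<in> K P" for z
  proof (rule K_eqI[of _ P])
    have K: "i1 (p1 z) \<in> K P" "i2 (p2 z) \<in> K P" "p1 z \<in> K a" "p2 z \<in> K b" using h z Hom_closed by blast+
    then show "i1 (p1 z) \<oplus>\<^bsub>M P\<^esub> i2 (p2 z) \<in> K P" by simp
    fix k assume k: "k < rk P"
    then have "i1 (p1 z) ! k + i2 (p2 z) ! k = z ! k"
      using K z sub[of k] \<pi>_lt[of k] by (auto simp: nth rkP perm not_less)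
    then show "(i1 (p1 z) \<oplus>\<^bsub>M P\<^esub> i2 (p2 z)) ! k = z ! k" using K z k by simp
  qed (rule z)
  moreover have "P \<in> E_obj m" by (simp add: P_def)
  ultimately have "hom_biproduct a b P i1 i2 p1 p2" using h by (simp add: hom_biproduct_def)
  then show ?thesis by blast
qed


lemma Idn_cls: "Idn C a = cls p m a a (hid a)" and Zer_cls: "Zer C a b = cls p m a b (hzero a b)"
  by (simp_all add: stable_cat_simps)

lemma biproduct_cls:
  assumes ab: "a \<in> E_obj m" "b \<in> E_obj m" and bi: "hom_biproduct a b P i1 i2 p1 p2"
  shows "biproduct C a b P (cls p m a P i1) (cls p m b P i2) (cls p m P a p1) (cls p m P b p2)"
proof -
  note P = bi[unfolded hom_biproduct_def]
  have H: "i1 \<in> Hom a P" "i2 \<in> Hom b P" "p1 \<in> Hom P a" "p2 \<in> Hom P b" using P by auto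
  show ?thesis
    unfolding biproduct_def
    using ab P E_comp_Hom[OF H(1,3)] E_comp_Hom[OF H(1,4)] E_comp_Hom[OF H(2,3)] E_comp_Hom[OF H(2,4)]
      E_comp_Hom[OF H(3,1)] E_comp_Hom[OF H(4,2)]
    by (auto simp: cls_Mor Cmp_cls Add_cls Idn_cls Zer_cls intro!: cls_cong)
qed

sublocale additive_category C
proof
  fix a b assume "a \<in> Obj C" "b \<in> Obj C"
  then have ab: "a \<in> E_obj m" "b \<in> E_obj m" by simp_all
  show "\<exists>P i1 i2 p1 p2. biproduct C a b P i1 i2 p1 p2"
    using ex_hom_biproduct[OF ab] biproduct_cls[OF ab] by blast
  fix F G H
  assume "F \<in> Mor C a b" then obtain f where f: "f \<in> Hom a b" "F = cls p m a b f" by (rule Mor_cases)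
  assume "G \<in> Mor C a b" then obtain g where g: "g \<in> Hom a b" "G = cls p m a b g" by (rule Mor_cases)
  show "Add C F G \<in> Mor C a b" using ab f g by (simp add: Add_cls cls_Mor)
  show "Add C F G = Add C G F" using ab f g by (auto simp: Add_cls M.a_comm intro!: cls_cong)
  assume "H \<in> Mor C a b" then obtain h where h: "h \<in> Hom a b" "H = cls p m a b h" by (rule Mor_cases)
  show "Add C (Add C F G) H = Add C F (Add C G H)"
    using ab f g h by (auto simp: Add_cls M.a_assoc intro!: cls_cong)
next
  fix a b F assume "a \<in> Obj C" "b \<in> Obj C" "F \<in> Mor C a b"
  then obtain f where ab: "a \<in> E_obj m" "b \<in> E_obj m" and f: "f \<in> Hom a b" "F = cls p m a b f"
    by (auto elim: Mor_cases)
  show "Neg C F \<in> Mor C a b" using ab f by (simp add: Neg_cls cls_Mor)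
  show "Add C F (Zer C a b) = F" using ab f by (auto simp: Add_cls Zer_cls intro!: cls_cong)
  show "Add C F (Neg C F) = Zer C a b" using ab f by (auto simp: Add_cls Neg_cls Zer_cls M.r_neg intro!: cls_cong)
  show "Cmp C (Idn C a) F = F" "Cmp C F (Idn C b) = F"
    using ab f E_comp_Hom[OF hid_Hom f(1)] E_comp_Hom[OF f(1) hid_Hom] by (auto simp: Cmp_cls Idn_cls intro!: cls_cong)
next
  fix a b assume "a \<in> Obj C" "b \<in> Obj C"
  show "Idn C a \<in> Mor C a a" "Zer C a b \<in> Mor C a b" by (simp_all add: Idn_cls Zer_cls cls_Mor)
next
  fix a b c F G assume "a \<in> Obj C" "b \<in> Obj C" "c \<in> Obj C" "F \<in> Mor C a b" "G \<in> Mor C b c"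
  then obtain f g where *: "a \<in> E_obj m" "b \<in> E_obj m" "f \<in> Hom a b" "g \<in> Hom b c" and FG: "F = cls p m a b f" "G = cls p m b c g"
    by (auto elim!: Mor_cases)
  show "Cmp C F G \<in> Mor C a c" unfolding FG Cmp_cls[OF *] using * by (intro cls_Mor E_comp_Hom)
  fix d H assume "d \<in> Obj C" "H \<in> Mor C c d"
  then obtain h where h: "h \<in> Hom c d" "H = cls p m c d h" by (auto elim!: Mor_cases)
  have c: "c \<in> E_obj m" using \<open>c \<in> Obj C\<close> by simp
  have "E_comp p a f g \<in> Hom a c" "E_comp p b g h \<in> Hom b d"
    "E_comp p a (E_comp p a f g) h \<in> Hom a d" "E_comp p a f (E_comp p b g h) \<in> Hom a d"
    using * h by (metis E_comp_Hom)+
  then show "Cmp C (Cmp C F G) H = Cmp C F (Cmp C G H)"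
    unfolding FG h using * h c by (auto simp: Cmp_cls intro!: cls_cong)
next
  fix a b c F G H assume "a \<in> Obj C" "b \<in> Obj C" "c \<in> Obj C" "F \<in> Mor C a b" "G \<in> Mor C a b" "H \<in> Mor C b c"
  then obtain f g h where *: "a \<in> E_obj m" "b \<in> E_obj m" "f \<in> Hom a b" "g \<in> Hom a b" "h \<in> Hom b c"
    and FG: "F = cls p m a b f" "G = cls p m a b g" "H = cls p m b c h"
    by (auto elim!: Mor_cases)
  have "E_comp p a f h \<in> Hom a c" "E_comp p a g h \<in> Hom a c" "E_comp p a (hsum a b f g) h \<in> Hom a c"
    using * hsum_Hom[of f a b g] by (metis E_comp_Hom)+
  then show "Cmp C (Add C F G) H = Add C (Cmp C F H) (Cmp C G H)"
    unfolding FG using * by (auto simp: Cmp_cls Add_cls Hom_add intro!: cls_cong)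
next
  fix a b c F G H assume "a \<in> Obj C" "b \<in> Obj C" "c \<in> Obj C" "F \<in> Mor C a b" "G \<in> Mor C b c" "H \<in> Mor C b c"
  then obtain f g h where *: "a \<in> E_obj m" "b \<in> E_obj m" "f \<in> Hom a b" "g \<in> Hom b c" "h \<in> Hom b c"
    and FG: "F = cls p m a b f" "G = cls p m b c g" "H = cls p m b c h"
    by (auto elim!: Mor_cases)
  have "E_comp p a f g \<in> Hom a c" "E_comp p a f h \<in> Hom a c" "E_comp p a f (hsum b c g h) \<in> Hom a c"
    using * hsum_Hom[of g b c h] by (metis E_comp_Hom)+
  then show "Cmp C F (Add C G H) = Add C (Cmp C F G) (Cmp C F H)"
    unfolding FG using * by (auto simp: Cmp_cls Add_cls intro!: cls_cong)
qed

section \<open>From exact sequences of modules to exact pairs of stable morphisms\<close>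

lemma cls_eqI_null:
  assumes "a \<in> E_obj m" "f \<in> Hom a b" "g \<in> Hom a b" "null a b k" "\<And>x. x \<in> K a \<Longrightarrow> f x \<ominus>\<^bsub>M b\<^esub> g x = k x"
  shows "cls p m a b f = cls p m a b g"
proof -
  have "null a b (hdiff a b f g) \<longleftrightarrow> null a b k" using assms by (intro null_cong) (simp add: hdiff_apply del: hsum_apply)
  then show ?thesis using assms by (simp add: cls_eq_iff)
qed

lemma minus_minus_self: "x \<in> K a \<Longrightarrow> y \<in> K a \<Longrightarrow> x \<ominus>\<^bsub>M a\<^esub> (x \<ominus>\<^bsub>M a\<^esub> y) = y"
  by (intro K_eqI[of _ a]) (auto simp: mod_simps)

lemma short_exact_exact_pair:
  assumes abc: "a \<in> E_obj m" "b \<in> E_obj m" "c \<in> E_obj m" and se: "short_exact p m a b c g h"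
  shows "exact_pair a b c (cls p m a b g) (cls p m b c h)"
proof (rule exact_pairI)
  have g: "g \<in> Hom a b" "inj_on g (K a)" and h: "h \<in> Hom b c" "h ` K b = K c"
    and img: "g ` K a = {x \<in> K b. h x = \<zero>\<^bsub>M c\<^esub>}" using se by (auto simp: short_exact_def)
  show "cls p m a b g \<in> Mor C a b" "cls p m b c h \<in> Mor C b c" using g h by (auto intro: cls_Mor)
  have "h (g x) = \<zero>\<^bsub>M c\<^esub>" if "x \<in> K a" for x using img that by blast
  then show "Cmp C (cls p m a b g) (cls p m b c h) = Zer C a c"
    using abc g h E_comp_Hom[OF g(1) h(1)] by (auto simp: Cmp_cls Zer_cls intro!: cls_cong)
  fix T :: obj and F :: arr assume "T \<in> Obj C"
  then have T: "T \<in> E_obj m" by simp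
  {
    assume "F \<in> Mor C T b" and F0: "Cmp C F (cls p m b c h) = Zer C T c"
    then obtain t where t: "t \<in> Hom T b" "F = cls p m T b t" by (auto elim: Mor_cases)
    have "null T c (E_comp p T t h)"
      using F0 T abc t h E_comp_Hom[OF t(1) h(1)] by (simp add: Cmp_cls cls_eq_Zer_iff)
    then obtain k where k: "k \<in> Hom (mid m T) c" "\<And>x. x \<in> K T \<Longrightarrow> h (t x) = k (ifl T x)"
      by (auto simp: null_def)
    \<comment> \<open>Lifting the extension \<open>k\<close> through \<open>h\<close> gives a stably
      zero correction \<open>n\<close> with the same image under \<open>h\<close> as
      \<open>t\<close>; hence \<open>t - n\<close> takes values in the image of
      \<open>g\<close>.\<close>
    obtain l where l: "l \<in> Hom (mid m T) b" "\<And>x. x \<in> K (mid m T) \<Longrightarrow> h (l x) = k x"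
      using mid_lift[OF abc(2,3) h k(1)] by blast
    define n where "n = E_comp p T (ifl T) l"
    have n: "n \<in> Hom T b" "null T b n" "\<And>x. x \<in> K T \<Longrightarrow> h (n x) = h (t x)"
      unfolding n_def using T l k E_comp_Hom[OF infl_Hom[OF T] l(1)] by (auto simp: null_def)
    have "hdiff T b t n x \<in> g ` K a" if "x \<in> K T" for x
      using that t n h by (auto simp: img hdiff_apply Hom_minus minus_eq_zero_iff simp del: hsum_apply)
    then obtain s where s: "s \<in> Hom T a" "\<And>x. x \<in> K T \<Longrightarrow> g (s x) = hdiff T b t n x"
      using factor_through_mono[OF g, of "hdiff T b t n" T] t n by auto
    have "cls p m T b t = cls p m T b (E_comp p T s g)"
    proof (rule cls_eqI_null[OF T t(1) E_comp_Hom[OF s(1) g(1)] n(2)])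
      fix x assume "x \<in> K T"
      then show "t x \<ominus>\<^bsub>M b\<^esub> E_comp p T s g x = n x"
        using t n s by (simp add: hdiff_apply minus_minus_self del: hsum_apply)
    qed
    then have "Cmp C (cls p m T a s) (cls p m a b g) = F" using T abc s g t by (simp add: Cmp_cls)
    then show "\<exists>S\<in>Mor C T a. Cmp C S (cls p m a b g) = F" using cls_Mor[OF s(1)] by blast
  next
    assume "F \<in> Mor C b T" and F0: "Cmp C (cls p m a b g) F = Zer C a T"
    then obtain t where t: "t \<in> Hom b T" "F = cls p m b T t" by (auto elim: Mor_cases)
    have "null a T (E_comp p a g t)"
      using F0 T abc t g E_comp_Hom[OF g(1) t(1)] by (simp add: Cmp_cls cls_eq_Zer_iff)
    then obtain k where k: "k \<in> Hom (mid m a) T" "\<And>x. x \<in> K a \<Longrightarrow> t (g x) = k (ifl a x)"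
      by (auto simp: null_def)
    \<comment> \<open>Dually, extending the distinguished monomorphism of \<open>a\<close> along
      \<open>g\<close> gives a stably zero \<open>n\<close> that agrees with \<open>t\<close> on the
      image of \<open>g\<close>, so \<open>t - n\<close> factors through \<open>h\<close>.\<close>
    obtain e where e: "e \<in> Hom b (mid m a)" "\<And>x. x \<in> K a \<Longrightarrow> e (g x) = ifl a x"
      using bijective_extend[OF bijective_mid abc(1,2) g infl_Hom[OF abc(1)]] by blast
    define n where "n = E_comp p b e k"
    have n: "n \<in> Hom b T" "null b T n" "\<And>x. x \<in> K a \<Longrightarrow> n (g x) = t (g x)"
      unfolding n_def using abc e k g E_comp_Hom[OF e(1) k(1)]
      by (auto intro!: null_factor[OF abc(2) bijective_mid[of a] e(1) k(1)])
    have "hdiff b T t n x = \<zero>\<^bsub>M T\<^esub>" if x: "x \<in> K b" "h x = \<zero>\<^bsub>M c\<^esub>" for x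
    proof -
      have "x \<in> g ` K a" using img x by simp
      then show ?thesis using x t n by (auto simp: hdiff_apply minus_eq_zero_iff simp del: hsum_apply)
    qed
    then obtain s where s: "s \<in> Hom c T" "\<And>x. x \<in> K b \<Longrightarrow> s (h x) = hdiff b T t n x"
      using factor_through_epi[OF h, of "hdiff b T t n" T] t n by auto
    have "cls p m b T t = cls p m b T (E_comp p b h s)"
    proof (rule cls_eqI_null[OF abc(2) t(1) E_comp_Hom[OF h(1) s(1)] n(2)])
      fix x assume "x \<in> K b"
      then show "t x \<ominus>\<^bsub>M T\<^esub> E_comp p b h s x = n x"
        using t n s by (simp add: hdiff_apply minus_minus_self del: hsum_apply)
    qed
    then have "Cmp C (cls p m b c h) (cls p m c T s) = F" using abc s h t by (simp add: Cmp_cls)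
    then show "\<exists>S\<in>Mor C c T. Cmp C (cls p m b c h) S = F" using cls_Mor[OF s(1)] by blast
  }
qed

text \<open>Short exactness of \<open>a\<close>, the sum of \<open>b\<close> and \<open>b'\<close>,
  and \<open>d\<close>, written out on elements so that no biproduct has to be chosen.\<close>

definition bicartesian :: "obj \<Rightarrow> obj \<Rightarrow> obj \<Rightarrow> obj \<Rightarrow> fn \<Rightarrow> fn \<Rightarrow> fn \<Rightarrow> fn \<Rightarrow> bool" where
  "bicartesian a b b' d f g h k \<longleftrightarrow>
     f \<in> Hom a b \<and> g \<in> Hom a b' \<and> h \<in> Hom b d \<and> k \<in> Hom b' d \<and>
     (\<forall>x\<in>K a. h (f x) = k (g x)) \<and>
     (\<forall>x\<in>K a. f x = \<zero>\<^bsub>M b\<^esub> \<and> g x = \<zero>\<^bsub>M b'\<^esub> \<longrightarrow> x = \<zero>\<^bsub>M a\<^esub>) \<and>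
     (\<forall>y\<in>K b. \<forall>z\<in>K b'. h y = k z \<longrightarrow> (\<exists>x\<in>K a. f x = y \<and> g x = z)) \<and>
     (\<forall>w\<in>K d. \<exists>y\<in>K b. \<exists>z\<in>K b'. w = h y \<oplus>\<^bsub>M d\<^esub> k z)"

lemma bicartesian_weak_square:
  assumes O: "a \<in> E_obj m" "b \<in> E_obj m" "b' \<in> E_obj m" "d \<in> E_obj m" and bi: "bicartesian a b b' d f g h k"
  shows "weak_square C a b b' d (cls p m a b f) (cls p m a b' g) (cls p m b d h) (cls p m b' d k)"
proof -
  note B = bi[unfolded bicartesian_def]
  have H: "f \<in> Hom a b" "g \<in> Hom a b'" "h \<in> Hom b d" "k \<in> Hom b' d" using B by auto
  obtain P i1 i2 p1 p2 where hb: "hom_biproduct b b' P i1 i2 p1 p2"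
    using ex_hom_biproduct[OF O(2,3)] by blast
  note hb' = hb[unfolded hom_biproduct_def]
  have P: "P \<in> E_obj m" "i1 \<in> Hom b P" "i2 \<in> Hom b' P" "p1 \<in> Hom P b" "p2 \<in> Hom P b'"
    and bip: "\<And>x. x \<in> K b \<Longrightarrow> p1 (i1 x) = x" "\<And>x. x \<in> K b \<Longrightarrow> p2 (i1 x) = \<zero>\<^bsub>M b'\<^esub>"
    "\<And>y. y \<in> K b' \<Longrightarrow> p2 (i2 y) = y" "\<And>y. y \<in> K b' \<Longrightarrow> p1 (i2 y) = \<zero>\<^bsub>M b\<^esub>"
    "\<And>z. z \<in> K P \<Longrightarrow> i1 (p1 z) \<oplus>\<^bsub>M P\<^esub> i2 (p2 z) = z"
    using hb' by auto
  define u where "u = hsum a P (E_comp p a f i1) (E_comp p a g i2)"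
  define v where "v = hsum P d (E_comp p P p1 h) (E_comp p P p2 (hneg b' d k))"
  have cH: "E_comp p a f i1 \<in> Hom a P" "E_comp p a g i2 \<in> Hom a P" "E_comp p P p1 h \<in> Hom P d" "E_comp p P p2 (hneg b' d k) \<in> Hom P d"
    using H P hneg_Hom[OF H(4)] by (metis E_comp_Hom)+
  have uv: "u \<in> Hom a P" "v \<in> Hom P d" unfolding u_def v_def using cH by simp_all
  have p1u: "p1 (u x) = f x" and p2u: "p2 (u x) = g x" if "x \<in> K a" for x
    using that H P bip by (simp_all add: u_def Hom_add)
  have v: "v z = h (p1 z) \<ominus>\<^bsub>M d\<^esub> k (p2 z)" if "z \<in> K P" for z
    using that H P by (simp add: v_def M.minus_eq)
  have "short_exact p m a P d u v"
    unfolding short_exact_def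
  proof (intro conjI uv)
    show "inj_on u (K a)"
    proof (rule Hom_inj_onI[OF uv(1)])
      fix x assume x: "x \<in> K a" "u x = \<zero>\<^bsub>M P\<^esub>"
      then have "f x = \<zero>\<^bsub>M b\<^esub>" "g x = \<zero>\<^bsub>M b'\<^esub>" using p1u[OF x(1)] p2u[OF x(1)] P by simp_all
      then show "x = \<zero>\<^bsub>M a\<^esub>" using B x by blast
    qed
    show "v ` K P = K d"
    proof (intro equalityI subsetI)
      fix w assume "w \<in> K d"
      then obtain y z where yz: "y \<in> K b" "z \<in> K b'" "w = h y \<oplus>\<^bsub>M d\<^esub> k z" using B by meson
      \<comment> \<open>The sign given to \<open>z\<close> compensates the minus sign in
        \<open>v\<close>.\<close>
      have K: "\<ominus>\<^bsub>M b'\<^esub> z \<in> K b'" "i1 y \<in> K P" "i2 (\<ominus>\<^bsub>M b'\<^esub> z) \<in> K P" using yz P by simp_all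
      have "v (i1 y \<oplus>\<^bsub>M P\<^esub> i2 (\<ominus>\<^bsub>M b'\<^esub> z)) = w"
        using yz K P H bip by (simp add: v Hom_add Hom_neg M.minus_eq)
      then show "w \<in> v ` K P" using K by (metis M.a_closed imageI)
    qed (use uv in auto)
    show "u ` K a = {z \<in> K P. v z = \<zero>\<^bsub>M d\<^esub>}"
    proof (intro equalityI subsetI)
      fix z assume "z \<in> u ` K a"
      then obtain x where x: "x \<in> K a" "z = u x" by blast
      then have "h (f x) = k (g x)" using B by blast
      then show "z \<in> {z \<in> K P. v z = \<zero>\<^bsub>M d\<^esub>}"
        using x uv H by (simp add: v p1u p2u minus_eq_zero_iff)
    next
      fix z assume "z \<in> {z \<in> K P. v z = \<zero>\<^bsub>M d\<^esub>}"
      then have z: "z \<in> K P" "h (p1 z) = k (p2 z)" "p1 z \<in> K b" "p2 z \<in> K b'" using H P by (auto simp: v minus_eq_zero_iff)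
      then obtain x where x: "x \<in> K a" "f x = p1 z" "g x = p2 z" using B by blast
      then have "u x = z" using bip(5)[OF z(1)] by (simp add: u_def)
      then show "z \<in> u ` K a" using x by blast
    qed
  qed
  then have ex: "exact_pair a P d (cls p m a P u) (cls p m P d v)" using O P by (intro short_exact_exact_pair)
  have "cls p m a P u = Add C (Cmp C (cls p m a b f) (cls p m b P i1)) (Cmp C (cls p m a b' g) (cls p m b' P i2))"
    using O P H cH by (simp add: Cmp_cls Add_cls u_def)
  moreover have "cls p m P d v = Add C (Cmp C (cls p m P b p1) (cls p m b d h)) (Cmp C (cls p m P b' p2) (Neg C (cls p m b' d k)))"
    using O P H cH hneg_Hom[OF H(4)] by (simp add: Cmp_cls Add_cls Neg_cls v_def)
  moreover have "biproduct C b b' P (cls p m b P i1) (cls p m b' P i2) (cls p m P b p1) (cls p m P b' p2)"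
    using biproduct_cls[OF O(2,3) hb] .
  ultimately have sq: "\<exists>P i1 i2 p1 p2. biproduct C b b' P i1 i2 p1 p2 \<and>
     (let a' = Add C (Cmp C (cls p m a b f) i1) (Cmp C (cls p m a b' g) i2);
          d' = Add C (Cmp C p1 (cls p m b d h)) (Cmp C p2 (Neg C (cls p m b' d k)))
      in weak_kernel C a P d a' d' \<and> weak_cokernel C a P d a' d')"
    using ex unfolding exact_pair_def Let_def by metis
  have "Cmp C (cls p m a b f) (cls p m b d h) = Cmp C (cls p m a b' g) (cls p m b' d k)"
    using O H B E_comp_Hom[OF H(1,3)] E_comp_Hom[OF H(2,4)] by (auto simp: Cmp_cls intro!: cls_cong)
  then show ?thesis
    unfolding weak_square_def using O H sq by (intro conjI) (simp_all add: cls_Mor)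
qed


section \<open>Shift and distinguished triangles\<close>

text \<open>The condition in \<open>stable_shift\<close> on elements: \<open>f\<close> and
  \<open>g\<close> are the outer components of a morphism of distinguished sequences.\<close>

definition shift_rel :: "obj \<Rightarrow> obj \<Rightarrow> fn \<Rightarrow> fn \<Rightarrow> bool" where
  "shift_rel a b f g \<longleftrightarrow> (\<exists>h\<in>Hom (mid m a) (mid m b).
     (\<forall>x\<in>K a. h (ifl a x) = ifl b (f x)) \<and> (\<forall>y\<in>K (mid m a). dfl b (h y) = g (dfl a y)))"

lemma shift_rel_E_comp:
  assumes ab: "a \<in> E_obj m" "b \<in> E_obj m" and f: "f \<in> Hom a b" and g: "g \<in> Hom (rev a) (rev b)"
  shows "shift_rel a b f g \<longleftrightarrow> (\<exists>h\<in>Hom (mid m a) (mid m b).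
        E_comp p a (ifl a) h = E_comp p a f (ifl b) \<and> E_comp p (mid m a) h (dfl b) = E_comp p (mid m a) (dfl a) g)"
  unfolding shift_rel_def
proof (intro bex_cong refl conj_cong)
  fix h assume h: "h \<in> Hom (mid m a) (mid m b)"
  have "E_comp p a (ifl a) h \<in> Hom a (mid m b)" "E_comp p a f (ifl b) \<in> Hom a (mid m b)"
    "E_comp p (mid m a) h (dfl b) \<in> Hom (mid m a) (rev b)" "E_comp p (mid m a) (dfl a) g \<in> Hom (mid m a) (rev b)"
    using ab f g h infl_Hom[OF ab(1)] infl_Hom[OF ab(2)] defl_Hom[OF ab(1)] defl_Hom[OF ab(2)] by (metis E_comp_Hom)+
  note * = this
  show "(\<forall>x\<in>K a. h (ifl a x) = ifl b (f x)) \<longleftrightarrow> E_comp p a (ifl a) h = E_comp p a f (ifl b)"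
    using Hom_ext[OF *(1,2)] by (metis E_comp_apply)
  show "(\<forall>y\<in>K (mid m a). dfl b (h y) = g (dfl a y)) \<longleftrightarrow> E_comp p (mid m a) h (dfl b) = E_comp p (mid m a) (dfl a) g"
    using Hom_ext[OF *(3,4)] by (metis E_comp_apply)
qed

text \<open>Injectivity of the middle term of \<open>b\<close> extends \<open>f\<close>, and the
  extension induces a map on cokernels. Hence the set in \<open>stable_shift\<close> is not
  empty.\<close>

lemma shift_ex:
  assumes ab: "a \<in> E_obj m" "b \<in> E_obj m" and f: "f \<in> Hom a b"
  shows "\<exists>g\<in>Hom (rev a) (rev b). shift_rel a b f g"
proof -
  obtain h where h: "h \<in> Hom (mid m a) (mid m b)" "\<And>x. x \<in> K a \<Longrightarrow> h (ifl a x) = ifl b (f x)"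
    using bijective_extend[OF bijective_mid[of b] ab(1) mid_E_obj infl_Hom[OF ab(1)] infl_inj[OF ab(1)]
        E_comp_Hom[OF f infl_Hom[OF ab(2)]]] by auto
  have "dfl b (h y) = \<zero>\<^bsub>M (rev b)\<^esub>" if y: "y \<in> K (mid m a)" "dfl a y = \<zero>\<^bsub>M (rev a)\<^esub>" for y
  proof -
    obtain x where "x \<in> K a" "y = ifl a x" using y defl_zero_iff[OF ab(1) y(1)] by blast
    then show ?thesis using h f ab by (simp add: defl_zero_iff)
  qed
  then obtain g where "g \<in> Hom (rev a) (rev b)" "\<And>y. y \<in> K (mid m a) \<Longrightarrow> g (dfl a y) = dfl b (h y)"
    using factor_through_epi[OF defl_Hom[OF ab(1)] defl_surj[OF ab(1)] E_comp_Hom[OF h(1) defl_Hom[OF ab(2)]]] by auto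
  then show ?thesis unfolding shift_rel_def using h by metis
qed

lemma shift_rel_hdiff:
  assumes ab: "a \<in> E_obj m" "b \<in> E_obj m" and f: "f \<in> Hom a b" "f' \<in> Hom a b"
    and g: "g \<in> Hom (rev a) (rev b)" "g' \<in> Hom (rev a) (rev b)"
    and "shift_rel a b f g" "shift_rel a b f' g'"
  shows "shift_rel a b (hdiff a b f f') (hdiff (rev a) (rev b) g g')"
proof -
  obtain h h' where h: "h \<in> Hom (mid m a) (mid m b)" "\<And>x. x \<in> K a \<Longrightarrow> h (ifl a x) = ifl b (f x)"
      "\<And>y. y \<in> K (mid m a) \<Longrightarrow> dfl b (h y) = g (dfl a y)"
    and h': "h' \<in> Hom (mid m a) (mid m b)" "\<And>x. x \<in> K a \<Longrightarrow> h' (ifl a x) = ifl b (f' x)"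
      "\<And>y. y \<in> K (mid m a) \<Longrightarrow> dfl b (h' y) = g' (dfl a y)"
    using assms unfolding shift_rel_def by blast
  show ?thesis
    unfolding shift_rel_def
    using ab f g h h' Hom_add[OF infl_Hom[OF ab(2)]] Hom_neg[OF infl_Hom[OF ab(2)]]
      Hom_add[OF defl_Hom[OF ab(2)]] Hom_neg[OF defl_Hom[OF ab(2)]]
    by (intro bexI[of _ "hdiff (mid m a) (mid m b) h h'"]) auto
qed

text \<open>If \<open>f\<close> extends to \<open>k\<close> on the middle term, then
  \<open>h\<close> minus \<open>k\<close> followed by \<open>ifl b\<close> kills the image of
  \<open>ifl a\<close>; it descends along \<open>dfl a\<close> and factors \<open>g\<close> through
  \<open>mid m b\<close>. Conversely, a factorization of \<open>g\<close> lifts through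
  \<open>dfl b\<close>, and subtracting the lift from \<open>h\<close> leaves a map into the image
  of \<open>ifl b\<close> that extends \<open>f\<close>. One direction makes the shift well defined,
  the other makes it injective.\<close>

lemma shift_rel_null:
  assumes ab: "a \<in> E_obj m" "b \<in> E_obj m" and f: "f \<in> Hom a b" and g: "g \<in> Hom (rev a) (rev b)"
    and rel: "shift_rel a b f g"
  shows "null a b f \<longleftrightarrow> null (rev a) (rev b) g"
proof
  obtain h where h: "h \<in> Hom (mid m a) (mid m b)" "\<And>x. x \<in> K a \<Longrightarrow> h (ifl a x) = ifl b (f x)"
    "\<And>y. y \<in> K (mid m a) \<Longrightarrow> dfl b (h y) = g (dfl a y)"
    using rel unfolding shift_rel_def by blast
  have ra: "rev a \<in> E_obj m" using ab by simp
  {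
    assume "null a b f"
    then obtain k where k: "k \<in> Hom (mid m a) b" "\<And>x. x \<in> K a \<Longrightarrow> f x = k (ifl a x)" by (auto simp: null_def)
    define h' where "h' = hdiff (mid m a) (mid m b) h (E_comp p (mid m a) k (ifl b))"
    have ki: "E_comp p (mid m a) k (ifl b) \<in> Hom (mid m a) (mid m b)" by (rule E_comp_Hom[OF k(1) infl_Hom[OF ab(2)]])
    have h': "h' \<in> Hom (mid m a) (mid m b)" unfolding h'_def using ki h by simp
    have h'y: "h' y = h y \<ominus>\<^bsub>M (mid m b)\<^esub> ifl b (k y)" if "y \<in> K (mid m a)" for y
      using that by (simp add: h'_def M.minus_eq)
    have ker: "h' y = \<zero>\<^bsub>M (mid m b)\<^esub>" if y: "y \<in> K (mid m a)" "dfl a y = \<zero>\<^bsub>M (rev a)\<^esub>" for y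
    proof -
      obtain x where "x \<in> K a" "y = ifl a x" using y defl_zero_iff[OF ab(1) y(1)] by blast
      then show ?thesis using h k f ab by (simp add: h'y minus_eq_zero_iff)
    qed
    obtain s where s: "s \<in> Hom (rev a) (mid m b)" "\<And>y. y \<in> K (mid m a) \<Longrightarrow> s (dfl a y) = h' y"
      using factor_through_epi[OF defl_Hom[OF ab(1)] defl_surj[OF ab(1)] h' ker] by blast
    have "g z = dfl b (s z)" if z: "z \<in> K (rev a)" for z
    proof -
      obtain y where y: "y \<in> K (mid m a)" "z = dfl a y" using z defl_surj[OF ab(1)] by blast
      have "dfl b (ifl b (k y)) = \<zero>\<^bsub>M (rev b)\<^esub>" using k y ab by (simp add: defl_zero_iff)
      then show ?thesis
        using y s h k ab g h'y[OF y(1)] Hom_minus[OF defl_Hom[OF ab(2)], of "h y" "ifl b (k y)"] by (simp add: M.minus_eq)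
    qed
    then show "null (rev a) (rev b) g"
      using null_factor[OF ra bijective_mid s(1) defl_Hom[OF ab(2)]] by blast
  next
    assume "null (rev a) (rev b) g"
    then obtain k where k: "k \<in> Hom (mid m (rev a)) (rev b)" "\<And>z. z \<in> K (rev a) \<Longrightarrow> g z = k (ifl (rev a) z)"
      by (auto simp: null_def)
    obtain l where l: "l \<in> Hom (mid m (rev a)) (mid m b)" "\<And>y. y \<in> K (mid m (rev a)) \<Longrightarrow> dfl b (l y) = k y"
      using mid_lift[OF mid_E_obj _ defl_Hom[OF ab(2)] defl_surj[OF ab(2)] k(1)] ab by auto
    define s where "s = E_comp p (mid m a) (dfl a) (E_comp p (rev a) (ifl (rev a)) l)"
    have s: "s \<in> Hom (mid m a) (mid m b)"
      unfolding s_def by (rule E_comp_Hom[OF defl_Hom[OF ab(1)] E_comp_Hom[OF infl_Hom[OF ra] l(1)]])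
    have sy: "s y = l (ifl (rev a) (dfl a y))" if "y \<in> K (mid m a)" for y
      using that ab by (simp add: s_def)
    define h' where "h' = hdiff (mid m a) (mid m b) h s"
    have h': "h' \<in> Hom (mid m a) (mid m b)" unfolding h'_def using s h by simp
    have h'y: "h' y = h y \<ominus>\<^bsub>M (mid m b)\<^esub> s y" if "y \<in> K (mid m a)" for y
      using that by (simp add: h'_def M.minus_eq)
    have im: "h' y \<in> ifl b ` K b" if y: "y \<in> K (mid m a)" for y
    proof -
      have "dfl b (h' y) = \<zero>\<^bsub>M (rev b)\<^esub>"
        using y h s l k g ab Hom_minus[OF defl_Hom[OF ab(2)], of "h y" "s y"]
        by (simp add: h'y sy minus_eq_zero_iff)
      then show ?thesis using defl_zero_iff[OF ab(2)] h' y by simp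
    qed
    obtain w where w: "w \<in> Hom (mid m a) b" "\<And>y. y \<in> K (mid m a) \<Longrightarrow> ifl b (w y) = h' y"
      using factor_through_mono[OF infl_Hom[OF ab(2)] infl_inj[OF ab(2)] h' im] by blast
    have "f x = w (ifl a x)" if x: "x \<in> K a" for x
    proof -
      have ix: "ifl a x \<in> K (mid m a)" using x ab by simp
      have "dfl a (ifl a x) = \<zero>\<^bsub>M (rev a)\<^esub>" using x ab ix by (simp add: defl_zero_iff)
      then have "s (ifl a x) = \<zero>\<^bsub>M (mid m b)\<^esub>" using l ra ix by (simp add: sy Hom_zero[OF infl_Hom[OF ra]])
      then have "ifl b (w (ifl a x)) = ifl b (f x)" using w(2)[OF ix] h(2)[OF x] x ix f ab by (simp add: h'y M.minus_eq)
      then show ?thesis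
        using inj_onD[OF infl_inj[OF ab(2)], of "w (ifl a x)" "f x"] Hom_closed[OF w(1) ix] Hom_closed[OF f x] by simp
    qed
    then show "null a b f" using w by (auto simp: null_def)
  }
qed

text \<open>A lift of the difference, precomposed with \<open>dfl a\<close>, is added to the middle
  map; it vanishes on the image of \<open>ifl a\<close>, so \<open>f\<close> is kept. The set in
  \<open>stable_shift\<close> is therefore a full residue class and not a proper part of
  one.\<close>

lemma shift_rel_add_null:
  assumes ab: "a \<in> E_obj m" "b \<in> E_obj m" and f: "f \<in> Hom a b"
    and g: "g \<in> Hom (rev a) (rev b)" "g' \<in> Hom (rev a) (rev b)"
    and rel: "shift_rel a b f g" and n: "null (rev a) (rev b) (hdiff (rev a) (rev b) g' g)"
  shows "shift_rel a b f g'"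
proof -
  have ra: "rev a \<in> E_obj m" using ab by simp
  obtain h where h: "h \<in> Hom (mid m a) (mid m b)" "\<And>x. x \<in> K a \<Longrightarrow> h (ifl a x) = ifl b (f x)"
    "\<And>y. y \<in> K (mid m a) \<Longrightarrow> dfl b (h y) = g (dfl a y)"
    using rel unfolding shift_rel_def by blast
  obtain k where k: "k \<in> Hom (mid m (rev a)) (rev b)" "\<And>z. z \<in> K (rev a) \<Longrightarrow> g' z \<ominus>\<^bsub>M (rev b)\<^esub> g z = k (ifl (rev a) z)"
    using n by (auto simp: null_def M.minus_eq)
  obtain l where l: "l \<in> Hom (mid m (rev a)) (mid m b)" "\<And>y. y \<in> K (mid m (rev a)) \<Longrightarrow> dfl b (l y) = k y"
    using mid_lift[OF mid_E_obj _ defl_Hom[OF ab(2)] defl_surj[OF ab(2)] k(1)] ab by auto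
  define s where "s = E_comp p (mid m a) (dfl a) (E_comp p (rev a) (ifl (rev a)) l)"
  have s: "s \<in> Hom (mid m a) (mid m b)"
    unfolding s_def by (rule E_comp_Hom[OF defl_Hom[OF ab(1)] E_comp_Hom[OF infl_Hom[OF ra] l(1)]])
  have sy: "s y = l (ifl (rev a) (dfl a y))" if "y \<in> K (mid m a)" for y
    using that ab by (simp add: s_def)
  show ?thesis
    unfolding shift_rel_def
  proof (intro bexI[of _ "hsum (mid m a) (mid m b) h s"] conjI ballI)
    fix x assume x: "x \<in> K a"
    then have ix: "ifl a x \<in> K (mid m a)" using ab by simp
    have "dfl a (ifl a x) = \<zero>\<^bsub>M (rev a)\<^esub>" using x ab ix by (simp add: defl_zero_iff)
    then have "s (ifl a x) = \<zero>\<^bsub>M (mid m b)\<^esub>" using l ra ix by (simp add: sy Hom_zero[OF infl_Hom[OF ra]])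
    then show "hsum (mid m a) (mid m b) h s (ifl a x) = ifl b (f x)" using h(2)[OF x] ix x f ab by simp
  next
    fix y assume y: "y \<in> K (mid m a)"
    then have dy: "dfl a y \<in> K (rev a)" using ab by simp
    have "dfl b (s y) = g' (dfl a y) \<ominus>\<^bsub>M (rev b)\<^esub> g (dfl a y)"
      using k(2)[OF dy] l(2) infl_closed[OF ra dy] by (simp add: sy[OF y])
    then show "dfl b (hsum (mid m a) (mid m b) h s y) = g' (dfl a y)"
      using y h s g dy ab Hom_add[OF defl_Hom[OF ab(2)], of "h y" "s y"] by (simp add: add_minus_cancel)
  qed (use h s in simp)
qed

section \<open>The shift on stable morphisms\<close>

lemma stable_shift_cls:
  assumes ab: "a \<in> E_obj m" "b \<in> E_obj m" and f: "f \<in> Hom a b" and g: "g \<in> Hom (rev a) (rev b)"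
    and rel: "shift_rel a b f g"
  shows "stable_shift p m (cls p m a b f) = cls p m (rev a) (rev b) g"
proof -
  have rab: "rev a \<in> E_obj m" "rev b \<in> E_obj m" using ab by simp_all
  have "{g' \<in> Hom (rev a) (rev b). \<exists>f'\<in>stab p m a b `` {f}. \<exists>h\<in>Hom (mid m a) (mid m b).
      E_comp p a (ifl a) h = E_comp p a f' (ifl b) \<and> E_comp p (mid m a) h (dfl b) = E_comp p (mid m a) (dfl a) g'} =
    {g' \<in> Hom (rev a) (rev b). \<exists>f'\<in>stab p m a b `` {f}. shift_rel a b f' g'}"
    using ab by (intro Collect_cong conj_cong refl bex_cong) (auto simp: shift_rel_E_comp stab_iff)
  also have "\<dots> = stab p m (rev a) (rev b) `` {g}"
  proof (intro equalityI subsetI)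
    fix g' assume "g' \<in> {g' \<in> Hom (rev a) (rev b). \<exists>f'\<in>stab p m a b `` {f}. shift_rel a b f' g'}"
    then obtain f' where g': "g' \<in> Hom (rev a) (rev b)" "shift_rel a b f' g'" and f': "f' \<in> Hom a b" "null a b (hdiff a b f f')"
      using ab by (auto simp: stab_iff)
    then have "null (rev a) (rev b) (hdiff (rev a) (rev b) g g')"
      using shift_rel_null[OF ab _ _ shift_rel_hdiff[OF ab f f'(1) g g'(1) rel g'(2)]] f g by simp
    then show "g' \<in> stab p m (rev a) (rev b) `` {g}" using rab g g' by (simp add: stab_iff)
  next
    fix g' assume "g' \<in> stab p m (rev a) (rev b) `` {g}"
    then have "(g, g') \<in> stab p m (rev a) (rev b)" by simp
    then have "(g', g) \<in> stab p m (rev a) (rev b)" using stab_equiv[OF rab(1)] by (meson equivE symD)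
    then have "g' \<in> Hom (rev a) (rev b)" "null (rev a) (rev b) (hdiff (rev a) (rev b) g' g)" using rab by (auto simp: stab_iff)
    moreover have "f \<in> stab p m a b `` {f}" using equiv_class_self[OF stab_equiv[OF ab(1)] f] .
    ultimately show "g' \<in> {g' \<in> Hom (rev a) (rev b). \<exists>f'\<in>stab p m a b `` {f}. shift_rel a b f' g'}"
      using shift_rel_add_null[OF ab f g _ rel] by blast
  qed
  finally show ?thesis by (simp add: stable_shift_def cls_def)
qed

lemma ShM_eq: "ShM C = stable_shift p m" and ShO_eq: "ShO C = rev" and Dist_eq: "Dist C = stable_dist p m"
  by (simp_all add: stable_cat_simps)

lemma shift_cases:
  assumes "a \<in> E_obj m" "b \<in> E_obj m" "F \<in> Mor C a b"
  obtains f g where "f \<in> Hom a b" "g \<in> Hom (rev a) (rev b)" "shift_rel a b f g"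
    "F = cls p m a b f" "stable_shift p m F = cls p m (rev a) (rev b) g"
proof -
  obtain f where f: "f \<in> Hom a b" "F = cls p m a b f" using assms(3) by (rule Mor_cases)
  moreover obtain g where "g \<in> Hom (rev a) (rev b)" "shift_rel a b f g" using shift_ex[OF assms(1,2) f(1)] by blast
  ultimately show thesis using that stable_shift_cls[OF assms(1,2)] by blast
qed

lemma stable_shift_Mor:
  "a \<in> E_obj m \<Longrightarrow> b \<in> E_obj m \<Longrightarrow> F \<in> Mor C a b \<Longrightarrow> stable_shift p m F \<in> Mor C (rev a) (rev b)"
  by (metis shift_cases cls_Mor)

text \<open>Reverse direction of \<open>shift_rel_null\<close>, applied to a difference of
  representatives. It allows values of a periodic diagram to be recovered from their shifts.\<close>

lemma stable_shift_inj:
  assumes ab: "a \<in> E_obj m" "b \<in> E_obj m" and F: "F \<in> Mor C a b" "F' \<in> Mor C a b"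
    and eq: "stable_shift p m F = stable_shift p m F'"
  shows "F = F'"
proof -
  obtain f g where f: "f \<in> Hom a b" "g \<in> Hom (rev a) (rev b)" "shift_rel a b f g"
    "F = cls p m a b f" "stable_shift p m F = cls p m (rev a) (rev b) g" using shift_cases[OF ab F(1)] by blast
  obtain f' g' where f': "f' \<in> Hom a b" "g' \<in> Hom (rev a) (rev b)" "shift_rel a b f' g'"
    "F' = cls p m a b f'" "stable_shift p m F' = cls p m (rev a) (rev b) g'" using shift_cases[OF ab F(2)] by blast
  have "null (rev a) (rev b) (hdiff (rev a) (rev b) g g')" using eq f f' ab by (simp add: cls_eq_iff)
  then have "null a b (hdiff a b f f')"
    using shift_rel_null[OF ab _ _ shift_rel_hdiff[OF ab f(1) f'(1) f(2) f'(2) f(3) f'(3)]] f f' by simp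
  then show ?thesis using f f' ab by (simp add: cls_eq_iff)
qed

lemma stable_shift_Cmp:
  assumes abc: "a \<in> E_obj m" "b \<in> E_obj m" "c \<in> E_obj m" and F: "F \<in> Mor C a b" and G: "G \<in> Mor C b c"
  shows "stable_shift p m (Cmp C F G) = Cmp C (stable_shift p m F) (stable_shift p m G)"
proof -
  obtain f f' where f: "f \<in> Hom a b" "f' \<in> Hom (rev a) (rev b)" "shift_rel a b f f'"
    "F = cls p m a b f" "stable_shift p m F = cls p m (rev a) (rev b) f'" using shift_cases[OF abc(1,2) F] by blast
  obtain g g' where g: "g \<in> Hom b c" "g' \<in> Hom (rev b) (rev c)" "shift_rel b c g g'"
    "G = cls p m b c g" "stable_shift p m G = cls p m (rev b) (rev c) g'" using shift_cases[OF abc(2,3) G] by blast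
  obtain h where h: "h \<in> Hom (mid m a) (mid m b)" "\<And>x. x \<in> K a \<Longrightarrow> h (ifl a x) = ifl b (f x)"
    "\<And>y. y \<in> K (mid m a) \<Longrightarrow> dfl b (h y) = f' (dfl a y)" using f(3) by (auto simp: shift_rel_def)
  obtain k where k: "k \<in> Hom (mid m b) (mid m c)" "\<And>x. x \<in> K b \<Longrightarrow> k (ifl b x) = ifl c (g x)"
    "\<And>y. y \<in> K (mid m b) \<Longrightarrow> dfl c (k y) = g' (dfl b y)" using g(3) by (auto simp: shift_rel_def)
  have "shift_rel a c (E_comp p a f g) (E_comp p (rev a) f' g')"
    unfolding shift_rel_def using abc f(1,2) g(1,2) h k
    by (intro bexI[of _ "E_comp p (mid m a) h k"] E_comp_Hom[OF h(1) k(1)]) auto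
  then have "stable_shift p m (cls p m a c (E_comp p a f g)) = cls p m (rev a) (rev c) (E_comp p (rev a) f' g')"
    by (rule stable_shift_cls[OF abc(1,3) E_comp_Hom[OF f(1) g(1)] E_comp_Hom[OF f(2) g(2)]])
  then show ?thesis using abc f g by (simp add: Cmp_cls)
qed

lemma stable_shift_Idn: "a \<in> E_obj m \<Longrightarrow> stable_shift p m (Idn C a) = Idn C (rev a)"
  unfolding Idn_cls
  by (rule stable_shift_cls) (auto simp: shift_rel_def intro!: bexI[of _ "hid (mid m a)"])

lemma stable_shift_Zer: "a \<in> E_obj m \<Longrightarrow> b \<in> E_obj m \<Longrightarrow> stable_shift p m (Zer C a b) = Zer C (rev a) (rev b)"
  unfolding Zer_cls
  by (rule stable_shift_cls)
    (auto simp: shift_rel_def intro!: bexI[of _ "hzero (mid m a) (mid m b)"] simp: Hom_zero[OF infl_Hom] Hom_zero[OF defl_Hom])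

lemma stable_shift_iso:
  assumes "isomorphism C a b u"
  shows "isomorphism C (rev a) (rev b) (stable_shift p m u)"
proof -
  obtain v where ab: "a \<in> E_obj m" "b \<in> E_obj m" and uv: "u \<in> Mor C a b" "v \<in> Mor C b a" "Cmp C u v = Idn C a" "Cmp C v u = Idn C b"
    using assms unfolding isomorphism_def by auto
  then have "Cmp C (stable_shift p m u) (stable_shift p m v) = Idn C (rev a)"
    "Cmp C (stable_shift p m v) (stable_shift p m u) = Idn C (rev b)"
    using stable_shift_Cmp[OF ab(1,2,1)] stable_shift_Cmp[OF ab(2,1,2)] by (metis stable_shift_Idn)+
  then show ?thesis
    unfolding isomorphism_def
    using ab stable_shift_Mor[OF ab uv(1)] by (auto intro!: bexI[OF _ stable_shift_Mor[OF ab(2,1) uv(2)]])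
qed

text \<open>The two exact rows have the same cokernel term with the identity on it, so a diagram
  chase shows that the square of kernel and middle terms is bicartesian.\<close>

lemma standard_triangle_bicartesian:
  assumes st: "standard_triangle p m a b c f g h"
  shows "\<exists>k. bicartesian a (mid m a) b c (ifl a) f k g"
proof -
  have O: "a \<in> E_obj m" "b \<in> E_obj m" "c \<in> E_obj m" and f: "f \<in> Hom a b"
    and g: "g \<in> Hom b c" "inj_on g (K b)" and h: "h \<in> Hom c (rev a)" "h ` K c = K (rev a)"
    and img: "g ` K b = {x \<in> K c. h x = \<zero>\<^bsub>M (rev a)\<^esub>}"
    using st by (auto simp: standard_triangle_def short_exact_def)
  obtain k where k: "k \<in> Hom (mid m a) c" "E_comp p a (ifl a) k = E_comp p a f g" "E_comp p (mid m a) k h = dfl a"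
    using st by (auto simp: standard_triangle_def)
  have k1: "k (ifl a x) = g (f x)" if "x \<in> K a" for x using k(2) that by (metis E_comp_apply)
  have k2: "h (k y) = dfl a y" if "y \<in> K (mid m a)" for y using k(3) that by (metis E_comp_apply)
  have hg: "h (g y) = \<zero>\<^bsub>M (rev a)\<^esub>" if "y \<in> K b" for y using img that by blast
  have "bicartesian a (mid m a) b c (ifl a) f k g"
    unfolding bicartesian_def
  proof (intro conjI ballI impI)
    fix x assume "x \<in> K a" "ifl a x = \<zero>\<^bsub>M (mid m a)\<^esub> \<and> f x = \<zero>\<^bsub>M b\<^esub>"
    then show "x = \<zero>\<^bsub>M a\<^esub>" using infl_inj[OF O(1)] Hom_zero[OF infl_Hom[OF O(1)]] by (metis inj_onD zero_closed)
  next
    fix y z assume yz: "y \<in> K (mid m a)" "z \<in> K b" "k y = g z"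
    then have "dfl a y = \<zero>\<^bsub>M (rev a)\<^esub>" using hg k2 by metis
    then obtain x where x: "x \<in> K a" "ifl a x = y" using defl_zero_iff[OF O(1) yz(1)] by blast
    then have "g (f x) = g z" using k1 yz by metis
    then have "f x = z" using inj_onD[OF g(2), of "f x" z] Hom_closed[OF f x(1)] yz by simp
    then show "\<exists>x\<in>K a. ifl a x = y \<and> f x = z" using x by blast
  next
    fix w assume w: "w \<in> K c"
    obtain y where y: "y \<in> K (mid m a)" "dfl a y = h w" using defl_surj[OF O(1)] h w by (metis imageE imageI)
    have "h (w \<ominus>\<^bsub>M c\<^esub> k y) = \<zero>\<^bsub>M (rev a)\<^esub>" using w y h k by (simp add: Hom_minus k2 minus_eq_zero_iff)
    then have "w \<ominus>\<^bsub>M c\<^esub> k y \<in> g ` K b" using img w y k by simp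
    then obtain z where z: "z \<in> K b" "w \<ominus>\<^bsub>M c\<^esub> k y = g z" by blast
    have "w = k y \<oplus>\<^bsub>M c\<^esub> g z" using z(2)[symmetric] w y k by (simp add: add_minus_cancel)
    then show "\<exists>y\<in>K (mid m a). \<exists>z\<in>K b. w = k y \<oplus>\<^bsub>M c\<^esub> g z" using y z by blast
  qed (use O f g k k1 in auto)
  then show ?thesis by blast
qed

text \<open>The second pair is the short exact row itself. The first one is an edge of the
  bicartesian square whose opposite corner is the middle term, through which every map is stably
  zero.\<close>

lemma standard_triangle_exact:
  assumes st: "standard_triangle p m a b c f g h"
  shows "exact_pair a b c (cls p m a b f) (cls p m b c g)" "exact_pair b c (rev a) (cls p m b c g) (cls p m c (rev a) h)"
proof -
  have O: "a \<in> E_obj m" "b \<in> E_obj m" "c \<in> E_obj m" "rev a \<in> E_obj m" and se: "short_exact p m b c (rev a) g h"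
    using st by (auto simp: standard_triangle_def)
  show "exact_pair b c (rev a) (cls p m b c g) (cls p m c (rev a) h)" by (rule short_exact_exact_pair[OF O(2-4) se])
  obtain k where bi: "bicartesian a (mid m a) b c (ifl a) f k g" using standard_triangle_bicartesian[OF st] by blast
  then have k: "k \<in> Hom (mid m a) c" by (simp add: bicartesian_def)
  show "exact_pair a b c (cls p m a b f) (cls p m b c g)"
  proof (rule weak_square_exact_right)
    show "weak_square C a (mid m a) b c (cls p m a (mid m a) (ifl a)) (cls p m a b f) (cls p m (mid m a) c k) (cls p m b c g)"
      using O bi by (intro bicartesian_weak_square) auto
    have "null a c (E_comp p a (ifl a) k)" using k by (auto simp: null_def)
    then show "Cmp C (cls p m a (mid m a) (ifl a)) (cls p m (mid m a) c k) = Zer C a c"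
      using O k E_comp_Hom[OF infl_Hom[OF O(1)] k] by (simp add: Cmp_cls cls_eq_Zer_iff)
  qed
qed

lemma Mor_unique: "F \<in> Mor C a b \<Longrightarrow> F \<in> Mor C a' b' \<Longrightarrow> a = a' \<and> b = b'"
  by (auto simp: stable_cat_simps)

lemma stable_acat_eq:
  "Obj (stable_acat p m) = Obj C" "Mor (stable_acat p m) = Mor C" "Cmp (stable_acat p m) = Cmp C" "Idn (stable_acat p m) = Idn C"
  by (simp_all add: stable_cat_def acat.extend_def)

lemma isomorphism_acat: "isomorphism (stable_acat p m) = isomorphism C"
  by (simp add: fun_eq_iff isomorphism_def stable_acat_eq)

lemma stable_dist_exact:
  assumes D: "stable_dist p m F G H" and O: "a' \<in> E_obj m" "b' \<in> E_obj m" "c' \<in> E_obj m"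
    and FGH: "F \<in> Mor C a' b'" "G \<in> Mor C b' c'" "H \<in> Mor C c' (rev a')"
  shows "exact_pair a' b' c' F G" "exact_pair b' c' (rev a') G H"
proof -
  obtain a b c f g h a'' b'' c'' u v w where st: "standard_triangle p m a b c f g h"
    and F'': "F \<in> Mor C a'' b''" "G \<in> Mor C b'' c''"
    and iso: "isomorphism C a'' a u" "isomorphism C b'' b v" "isomorphism C c'' c w"
    and eq: "Cmp C F v = Cmp C u (cls p m a b f)" "Cmp C G w = Cmp C v (cls p m b c g)"
      "Cmp C H (stable_shift p m u) = Cmp C w (cls p m c (rev a) h)"
    using D unfolding stable_dist_def Let_def isomorphism_acat stable_acat_eq by blast
  \<comment> \<open>A stable morphism carries its source and target, so the objects chosen in
    \<open>stable_dist\<close> are the given ones.\<close>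
  have "a'' = a'" "b'' = b'" "c'' = c'" using Mor_unique[OF FGH(1) F''(1)] Mor_unique[OF FGH(2) F''(2)] by auto
  note iso = iso[unfolded this]
  show "exact_pair a' b' c' F G" "exact_pair b' c' (rev a') G H"
    using exact_pair_transport[OF iso FGH(1) eq(1) FGH(2) eq(2) standard_triangle_exact(1)[OF st]]
      exact_pair_transport[OF iso(2,3) stable_shift_iso[OF iso(1)] FGH(2) eq(2) FGH(3) eq(3) standard_triangle_exact(2)[OF st]] by auto
qed

text \<open>Identities are taken on the first two objects: the triangles in question share their
  first morphism with a pushout and differ from it in the cone.\<close>

lemma stable_distI:
  assumes st: "standard_triangle p m a b c f g h" and w: "isomorphism C c' c w"
    and G: "G \<in> Mor C b c'" "Cmp C G w = cls p m b c g"
    and H: "H \<in> Mor C c' (rev a)" "H = Cmp C w (cls p m c (rev a) h)"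
  shows "stable_dist p m (cls p m a b f) G H"
proof -
  have O: "a \<in> E_obj m" "b \<in> E_obj m" "c \<in> E_obj m" "c' \<in> E_obj m" "rev a \<in> E_obj m"
    and fgh: "f \<in> Hom a b" "g \<in> Hom b c" "h \<in> Hom c (rev a)"
    using st w by (auto simp: standard_triangle_def short_exact_def isomorphism_def)
  have O': "a \<in> Obj C" "b \<in> Obj C" "c \<in> Obj C" "c' \<in> Obj C" "rev a \<in> Obj C" using O by simp_all
  have M: "cls p m a b f \<in> Mor C a b" "cls p m b c g \<in> Mor C b c" using fgh by (simp_all add: cls_Mor)
  have 1: "Cmp C (cls p m a b f) (Idn C b) = Cmp C (Idn C a) (cls p m a b f)"
    using Idn_left[OF O'(1,2) M(1)] Idn_right[OF O'(1,2) M(1)] by simp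
  have 2: "Cmp C G w = Cmp C (Idn C b) (cls p m b c g)"
    using Idn_left[OF O'(2,3) M(2)] G(2) by simp
  have 3: "Cmp C H (stable_shift p m (Idn C a)) = Cmp C w (cls p m c (rev a) h)"
    using Idn_right[OF O'(4,5) H(1)] H(2) O by (simp add: stable_shift_Idn)
  show ?thesis
    unfolding stable_dist_def Let_def isomorphism_acat stable_acat_eq
    by (intro exI[of _ a] exI[of _ b] exI[of _ c] exI[of _ f] exI[of _ g] exI[of _ h] exI[of _ c']
        exI[of _ "Idn C a"] exI[of _ "Idn C b"] exI[of _ w] conjI)
      (fact st O' M G(1) H(1) w isomorphism_Idn[OF O'(1)] isomorphism_Idn[OF O'(2)] 1 2 3)+
qed

end

section \<open>Matrices\<close>

lemma card_bounded_lists: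
  "finite {x. length x = length ns \<and> (\<forall>k<length ns. 0 \<le> x ! k \<and> x ! k < int (ns ! k))} \<and>
   card {x. length x = length ns \<and> (\<forall>k<length ns. 0 \<le> x ! k \<and> x ! k < int (ns ! k))} = prod_list ns"
proof (induction ns)
  case (Cons n ns)
  let ?S = "\<lambda>ns. {x. length x = length ns \<and> (\<forall>k<length ns. 0 \<le> x ! k \<and> x ! k < int (ns ! k))}"
  have "?S (n # ns) = (\<lambda>(t, x). t # x) ` ({0..<int n} \<times> ?S ns)"
  proof (intro equalityI subsetI)
    fix x assume x: "x \<in> ?S (n # ns)"
    then obtain t y where ty: "x = t # y" by (cases x) auto
    have "0 \<le> x ! k \<and> x ! k < int ((n # ns) ! k)" if "k < Suc (length ns)" for k using x that by simp
    from this[of 0] this[of "Suc k" for k] have "t \<in> {0..<int n}" "y \<in> ?S ns" using x ty by auto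
    then show "x \<in> (\<lambda>(t, x). t # x) ` ({0..<int n} \<times> ?S ns)" using ty by auto
  next
    fix x assume "x \<in> (\<lambda>(t, x). t # x) ` ({0..<int n} \<times> ?S ns)"
    then show "x \<in> ?S (n # ns)" by (auto simp: nth_Cons split: nat.splits)
  qed
  moreover have "inj_on (\<lambda>(t, x). t # x) ({0..<int n} \<times> ?S ns)" by (auto intro: inj_onI)
  ultimately show ?case using Cons by (simp add: card_image card_cartesian_product)
qed simp

context primary_modules begin

lemma card_K: "card (K a) = p ^ sum_list (summands a)"
proof -
  have "K a = {x. length x = length (map ((^) p) (summands a)) \<and>
    (\<forall>k<length (map ((^) p) (summands a)). 0 \<le> x ! k \<and> x ! k < int (map ((^) p) (summands a) ! k))}"
    by (auto simp: K_bounds intro!: K_I)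
  then have "card (K a) = prod_list (map ((^) p) (summands a))" using card_bounded_lists by presburger
  moreover have "prod_list (map ((^) p) es) = p ^ sum_list es" for es by (induction es) (auto simp: power_add)
  ultimately show ?thesis by simp
qed

text \<open>Adding a chosen preimage of \<open>w\<close> to the image of \<open>x\<close> defines an
  injective map from \<open>K a \<times> K d\<close> to \<open>K b \<times> K b'\<close>, which is
  onto by comparison of cardinalities. The pairs with \<open>h y = k z\<close> are those over
  \<open>w = 0\<close>, and this gives exactness in the middle.\<close>

lemma bicartesian_by_card:
  assumes f: "f \<in> Hom a b" and g: "g \<in> Hom a b'" and h: "h \<in> Hom b d" and k: "k \<in> Hom b' d"
    and comm: "\<And>x. x \<in> K a \<Longrightarrow> h (f x) = k (g x)"
    and inj: "\<And>x. x \<in> K a \<Longrightarrow> f x = \<zero>\<^bsub>M b\<^esub> \<Longrightarrow> g x = \<zero>\<^bsub>M b'\<^esub> \<Longrightarrow> x = \<zero>\<^bsub>M a\<^esub>"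
    and surj: "\<And>w. w \<in> K d \<Longrightarrow> \<exists>y\<in>K b. \<exists>z\<in>K b'. w = h y \<oplus>\<^bsub>M d\<^esub> k z"
    and card: "card (K a) * card (K d) = card (K b) * card (K b')"
  shows "bicartesian a b b' d f g h k"
proof -
  have "\<exists>yz. w \<in> K d \<longrightarrow> fst yz \<in> K b \<and> snd yz \<in> K b' \<and> w = h (fst yz) \<ominus>\<^bsub>M d\<^esub> k (snd yz) \<and>
      (w = \<zero>\<^bsub>M d\<^esub> \<longrightarrow> yz = (\<zero>\<^bsub>M b\<^esub>, \<zero>\<^bsub>M b'\<^esub>))" for w
  proof (cases "w \<in> K d \<and> w \<noteq> \<zero>\<^bsub>M d\<^esub>")
    case True
    then obtain y z where "y \<in> K b" "z \<in> K b'" "w = h y \<oplus>\<^bsub>M d\<^esub> k z" using surj by blast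
    then show ?thesis using True k by (intro exI[of _ "(y, \<ominus>\<^bsub>M b'\<^esub> z)"]) (simp add: Hom_neg M.minus_eq)
  next
    case False
    then show ?thesis using h k by (intro exI[of _ "(\<zero>\<^bsub>M b\<^esub>, \<zero>\<^bsub>M b'\<^esub>)"]) (auto simp: M.minus_eq)
  qed
  \<comment> \<open>The section need not be additive, but it is normalized at zero, so that a pair
    lying over zero comes from \<open>x\<close> alone.\<close>
  then obtain \<sigma> where \<sigma>: "fst (\<sigma> w) \<in> K b" "snd (\<sigma> w) \<in> K b'" "h (fst (\<sigma> w)) \<ominus>\<^bsub>M d\<^esub> k (snd (\<sigma> w)) = w"
      "w = \<zero>\<^bsub>M d\<^esub> \<longrightarrow> \<sigma> w = (\<zero>\<^bsub>M b\<^esub>, \<zero>\<^bsub>M b'\<^esub>)" if "w \<in> K d" for w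
    by metis
  define \<Theta> where "\<Theta> = (\<lambda>(x, w). (f x \<oplus>\<^bsub>M b\<^esub> fst (\<sigma> w), g x \<oplus>\<^bsub>M b'\<^esub> snd (\<sigma> w)))"
  have \<Theta>_in: "\<Theta> ` (K a \<times> K d) \<subseteq> K b \<times> K b'" using f g \<sigma> by (auto simp: \<Theta>_def)
  have \<Theta>_val: "h (fst (\<Theta> (x, w))) \<ominus>\<^bsub>M d\<^esub> k (snd (\<Theta> (x, w))) = w" if xw: "x \<in> K a" "w \<in> K d" for x w
  proof -
    have cancel: "(u \<oplus>\<^bsub>M d\<^esub> v) \<ominus>\<^bsub>M d\<^esub> (u \<oplus>\<^bsub>M d\<^esub> v') = v \<ominus>\<^bsub>M d\<^esub> v'" if "u \<in> K d" "v \<in> K d" "v' \<in> K d" for u v v'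
      using that by (intro K_eqI[of _ d]) (auto simp: mod_simps)
    have K: "k (g x) \<in> K d" "h (fst (\<sigma> w)) \<in> K d" "k (snd (\<sigma> w)) \<in> K d" using xw f g h k \<sigma>(1,2)[OF xw(2)] by auto
    have "h (fst (\<Theta> (x, w))) = k (g x) \<oplus>\<^bsub>M d\<^esub> h (fst (\<sigma> w))" "k (snd (\<Theta> (x, w))) = k (g x) \<oplus>\<^bsub>M d\<^esub> k (snd (\<sigma> w))"
      using xw f g h k \<sigma>(1,2)[OF xw(2)] by (simp_all add: \<Theta>_def Hom_add comm)
    then show ?thesis using cancel[OF K] \<sigma>(3)[OF xw(2)] by simp
  qed
  have "inj_on \<Theta> (K a \<times> K d)"
  proof (rule inj_onI, clarify)
    fix x w x' w' assume xw: "x \<in> K a" "w \<in> K d" "x' \<in> K a" "w' \<in> K d" and eq: "\<Theta> (x, w) = \<Theta> (x', w')"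
    then have w: "w = w'" using \<Theta>_val by metis
    then have "f x = f x'" "g x = g x'" using eq xw f g \<sigma>[OF xw(2)] by (auto simp: \<Theta>_def)
    then have "x \<ominus>\<^bsub>M a\<^esub> x' = \<zero>\<^bsub>M a\<^esub>" using xw f g by (intro inj) (simp_all add: Hom_minus minus_eq_zero_iff)
    then show "x = x' \<and> w = w'" using w xw by (simp add: minus_eq_zero_iff)
  qed
  then have img: "\<Theta> ` (K a \<times> K d) = K b \<times> K b'"
    using \<Theta>_in card finite_K by (intro card_subset_eq) (auto simp: card_image card_cartesian_product)
  have ex: "\<exists>x\<in>K a. f x = y \<and> g x = z" if yz: "y \<in> K b" "z \<in> K b'" "h y = k z" for y z
  proof -
    have "(y, z) \<in> \<Theta> ` (K a \<times> K d)" unfolding img using yz by simp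
    then obtain x w where xw: "x \<in> K a" "w \<in> K d" "(y, z) = \<Theta> (x, w)" by (elim imageE SigmaE) simp
    have "w = \<zero>\<^bsub>M d\<^esub>" 
      using \<Theta>_val[OF xw(1,2)] yz minus_eq_zero_iff[OF Hom_closed[OF k yz(2)] Hom_closed[OF k yz(2)]] by (simp flip: xw(3))
    then have "y = f x \<and> z = g x" using xw \<sigma>(4)[OF xw(2)] f g by (simp add: \<Theta>_def)
    then show ?thesis using xw by blast
  qed
  show ?thesis unfolding bicartesian_def using f g h k comm inj surj ex by blast
qed

text \<open>Converse of \<open>standard_triangle_bicartesian\<close>. The square makes
  \<open>g\<close> injective and lets both images generate \<open>c\<close>; the two equations for
  \<open>h\<close> then identify its kernel with the image of \<open>g\<close>.\<close>

lemma bicartesian_triangle: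
  assumes O: "a \<in> E_obj m" "b \<in> E_obj m" "c \<in> E_obj m"
    and bi: "bicartesian a (mid m a) b c (ifl a) f k g" and h: "h \<in> Hom c (rev a)"
    and gh: "\<And>y. y \<in> K b \<Longrightarrow> h (g y) = \<zero>\<^bsub>M (rev a)\<^esub>" and kh: "\<And>y. y \<in> K (mid m a) \<Longrightarrow> h (k y) = dfl a y"
  shows "standard_triangle p m a b c f g h"
proof -
  note B = bi[unfolded bicartesian_def]
  have H: "f \<in> Hom a b" "g \<in> Hom b c" "k \<in> Hom (mid m a) c" using B by auto
  have "E_comp p a (ifl a) k = E_comp p a f g"
    using B by (intro Hom_ext[OF E_comp_Hom[OF infl_Hom[OF O(1)] H(3)] E_comp_Hom[OF H(1,2)]]) simp
  moreover have "E_comp p (mid m a) k h = dfl a"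
    using kh by (intro Hom_ext[OF E_comp_Hom[OF H(3) h] defl_Hom[OF O(1)]]) simp
  moreover have "short_exact p m b c (rev a) g h"
    unfolding short_exact_def
  proof (intro conjI H h)
    show "inj_on g (K b)"
    proof (rule Hom_inj_onI[OF H(2)])
      fix y assume y: "y \<in> K b" "g y = \<zero>\<^bsub>M c\<^esub>"
      then have "k \<zero>\<^bsub>M (mid m a)\<^esub> = g y" using H by simp
      then obtain x where x: "x \<in> K a" "ifl a x = \<zero>\<^bsub>M (mid m a)\<^esub>" "f x = y" using B y zero_closed by blast
      then have "x = \<zero>\<^bsub>M a\<^esub>" using infl_inj[OF O(1)] Hom_zero[OF infl_Hom[OF O(1)]] by (metis inj_onD zero_closed)
      then show "y = \<zero>\<^bsub>M b\<^esub>" using x H by simp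
    qed
    show "h ` K c = K (rev a)"
    proof (intro equalityI subsetI)
      fix z assume "z \<in> K (rev a)"
      then obtain y where "y \<in> K (mid m a)" "z = dfl a y" using defl_surj[OF O(1)] by blast
      then show "z \<in> h ` K c" using kh H by (metis Hom_closed imageI)
    qed (use h in auto)
    show "g ` K b = {x \<in> K c. h x = \<zero>\<^bsub>M (rev a)\<^esub>}"
    proof (intro equalityI subsetI)
      fix w assume "w \<in> {x \<in> K c. h x = \<zero>\<^bsub>M (rev a)\<^esub>}"
      then have w: "w \<in> K c" "h w = \<zero>\<^bsub>M (rev a)\<^esub>" by auto
      obtain y z where yz: "y \<in> K (mid m a)" "z \<in> K b" "w = k y \<oplus>\<^bsub>M c\<^esub> g z" using B w by meson
      then have "dfl a y = \<zero>\<^bsub>M (rev a)\<^esub>" using w H h kh gh O by (simp add: Hom_add)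
      then obtain x where x: "x \<in> K a" "y = ifl a x" using defl_zero_iff[OF O(1) yz(1)] by blast
      then have "k y = g (f x)" using B by blast
      then have "w = g (f x \<oplus>\<^bsub>M b\<^esub> z)" using yz x H by (simp add: Hom_add)
      then show "w \<in> g ` K b" using yz x H by simp
    qed (use gh H in auto)
  qed
  ultimately show ?thesis unfolding standard_triangle_def using O H by blast
qed

text \<open>Sortedness makes \<open>dsum\<close> keep the order of the list, so that rows and
  columns of a matrix refer to the exponents as written.\<close>

definition valid :: "nat list \<Rightarrow> bool" where
  "valid es \<longleftrightarrow> sorted es \<and> (\<forall>e\<in>set es. e \<le> m)"

lemma summands_valid [simp]: "valid es \<Longrightarrow> summands (dsum m es) = es"
  unfolding valid_def by (subst summands_dsum) (auto simp: sorted_sort_id)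

lemma rev_dsum: "valid es \<Longrightarrow> rev (dsum m es) = dsum m (rev (map (\<lambda>e. m - e) es))"
proof (rule nth_equalityI)
  fix i assume es: "valid es" and "i < length (rev (dsum m es))"
  then have i: "i \<le> m" by (simp add: dsum_def)
  have "count_list (map (\<lambda>e. m - e) es) i = count_list es (m - i)"
    using es i unfolding valid_def by (induction es) auto
  then show "rev (dsum m es) ! i = dsum m (rev (map (\<lambda>e. m - e) es)) ! i"
    using i by (simp add: dsum_def rev_nth count_list_rev del: upt_Suc)
qed (simp add: dsum_def)

lemma valid_shift: "valid es \<Longrightarrow> valid (rev (map (\<lambda>e. m - e) es))"
  unfolding valid_def by (auto simp: sorted_wrt_rev sorted_wrt_map intro: sorted_wrt_mono_rel[of _ "(\<le>)"])

abbreviation q :: int where "q \<equiv> int p"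

text \<open>\<open>admissible\<close> read off from exponent lists: for concrete lists it becomes
  divisibility by explicit powers of \<open>q\<close>.\<close>

definition adm :: "nat list \<Rightarrow> nat list \<Rightarrow> int list list \<Rightarrow> bool" where
  "adm es fs L \<longleftrightarrow> (\<forall>r<length es. \<forall>s<length fs. q ^ (fs ! s) dvd q ^ (es ! r) * L ! r ! s)"

definition marr :: "nat list \<Rightarrow> nat list \<Rightarrow> int list list \<Rightarrow> arr" where
  "marr es fs L = cls p m (dsum m es) (dsum m fs) (lin p (dsum m es) (dsum m fs) L)"

lemma adm_admissible: "valid es \<Longrightarrow> valid fs \<Longrightarrow> adm es fs L \<longleftrightarrow> admissible (dsum m es) (dsum m fs) L"
  by (simp add: adm_def admissible_def)

lemma marr_lin: "valid es \<Longrightarrow> valid fs \<Longrightarrow> adm es fs L \<Longrightarrow> lin p (dsum m es) (dsum m fs) L \<in> Hom (dsum m es) (dsum m fs)"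
  by (simp add: adm_admissible)

lemma marr_Mor: "valid es \<Longrightarrow> valid fs \<Longrightarrow> adm es fs L \<Longrightarrow> marr es fs L \<in> Mor C (dsum m es) (dsum m fs)"
  unfolding marr_def by (intro cls_Mor marr_lin)

lemma marr_eqI:
  assumes v: "valid es" "valid fs" and L: "adm es fs L" "adm es fs L'"
    and eq: "\<And>r s. r < length es \<Longrightarrow> s < length fs \<Longrightarrow> q ^ min (m - es ! r) (fs ! s) dvd L ! r ! s - L' ! r ! s"
  shows "marr es fs L = marr es fs L'"
  unfolding marr_def
proof (rule cls_eqI_null)
  let ?a = "dsum m es" and ?b = "dsum m fs"
  \<comment> \<open>If \<open>m - e \<le> f\<close>, the difference of entries is divisible by
    \<open>q ^ (m - e)\<close>, and the quotient is its extension to the middle term. Otherwise it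
    is divisible by \<open>q ^ f\<close>, represents zero, and extends by 0.\<close>
  define D where "D = map (\<lambda>r. map (\<lambda>s. if m - es ! r \<le> fs ! s then (L ! r ! s - L' ! r ! s) div q ^ (m - es ! r) else 0)
      [0..<length fs]) [0..<length es]"
  have D: "[L ! r ! s - L' ! r ! s = q ^ (m - es ! r) * D ! r ! s] (mod q ^ (fs ! s))" if rs: "r < length es" "s < length fs" for r s
    using eq[OF rs] rs by (auto simp: D_def min_def cong_iff_dvd_diff split: if_splits)
  have adm_D: "admissible (mid m ?a) ?b D"
    using v by (auto simp: admissible_def valid_def intro!: dvd_mult2 le_imp_power_dvd)
  show "lin p ?a ?b L \<in> Hom ?a ?b" "lin p ?a ?b L' \<in> Hom ?a ?b" using v L by (simp_all add: marr_lin)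
  let ?k = "\<lambda>x. lin p (mid m ?a) ?b D (ifl ?a x)"
  show "null ?a ?b ?k" unfolding null_def using adm_D by auto
  fix x assume x: "x \<in> K ?a"
  show "lin p ?a ?b L x \<ominus>\<^bsub>M ?b\<^esub> lin p ?a ?b L' x = ?k x"
  proof (rule K_eqI[of _ ?b])
    fix s assume "s < rk ?b"
    then have s: "s < length fs" using v by simp
    have "[(\<Sum>r<length es. x ! r * L ! r ! s) - (\<Sum>r<length es. x ! r * L' ! r ! s) =
        (\<Sum>r<length es. x ! r * (q ^ (m - es ! r) * D ! r ! s))] (mod q ^ (fs ! s))"
      unfolding sum_subtractf[symmetric] right_diff_distrib[symmetric]
      using D s by (intro cong_sum cong_mult) auto
    then show "(lin p ?a ?b L x \<ominus>\<^bsub>M ?b\<^esub> lin p ?a ?b L' x) ! s = ?k x ! s"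
      using x v s by (simp add: mod_simps cong_def mult.assoc mult.left_commute)
  qed (use x in auto)
qed simp

definition mprod :: "nat \<Rightarrow> nat \<Rightarrow> nat \<Rightarrow> int list list \<Rightarrow> int list list \<Rightarrow> int list list" where
  "mprod i j k L N = map (\<lambda>r. map (\<lambda>s. \<Sum>t<j. L ! r ! t * N ! t ! s) [0..<k]) [0..<i]"

lemma adm_mprod:
  assumes "adm es fs L" "adm fs gs N"
  shows "adm es gs (mprod (length es) (length fs) (length gs) L N)"
  unfolding adm_def
proof (intro allI impI)
  fix r s assume rs: "r < length es" "s < length gs"
  have "q ^ (gs ! s) dvd q ^ (es ! r) * (L ! r ! t * N ! t ! s)" if t: "t < length fs" for t
  proof -
    have "q ^ (gs ! s) dvd q ^ (fs ! t) * N ! t ! s" "q ^ (fs ! t) dvd q ^ (es ! r) * L ! r ! t"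
      using assms rs t by (auto simp: adm_def)
    then have "q ^ (gs ! s) dvd (q ^ (es ! r) * L ! r ! t) * N ! t ! s"
      by (rule dvd_trans[OF _ mult_dvd_mono[OF _ dvd_refl]])
    then show ?thesis by (simp only: mult.assoc)
  qed
  then show "q ^ (gs ! s) dvd q ^ (es ! r) * mprod (length es) (length fs) (length gs) L N ! r ! s"
    using rs by (auto simp: mprod_def sum_distrib_left intro!: dvd_sum)
qed

lemma marr_Cmp:
  assumes v: "valid es" "valid fs" "valid gs" and L: "adm es fs L" "adm fs gs N" "adm es gs J"
    and eq: "\<And>r s. r < length es \<Longrightarrow> s < length gs \<Longrightarrow>
      q ^ min (m - es ! r) (gs ! s) dvd (\<Sum>t<length fs. L ! r ! t * N ! t ! s) - J ! r ! s"
  shows "Cmp C (marr es fs L) (marr fs gs N) = marr es gs J"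
proof -
  let ?P = "mprod (length es) (length fs) (length gs) L N"
  have "Cmp C (marr es fs L) (marr fs gs N) = marr es gs ?P"
    unfolding marr_def using v L
    by (subst Cmp_cls) (auto simp: marr_lin adm_admissible mprod_def intro!: arg_cong[of _ _ "cls p m _ _"] lin_comp)
  also have "\<dots> = marr es gs J"
    using v L eq adm_mprod[OF L(1,2)] by (intro marr_eqI) (auto simp: mprod_def)
  finally show ?thesis .
qed

lemma marr_Zer:
  assumes "valid es" "valid fs"
  shows "Zer C (dsum m es) (dsum m fs) = marr es fs (replicate (length es) (replicate (length fs) 0))"
  unfolding marr_def Zer_cls using assms
  by (intro cls_cong) (auto simp: marr_lin adm_def intro!: K_eqI[of _ "dsum m fs"])

lemma marr_Idn:
  assumes "valid es"
  shows "Idn C (dsum m es) = marr es es (map (\<lambda>r. map (\<lambda>s. if s = r then 1 else 0) [0..<length es]) [0..<length es])"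
proof -
  have "x ! k mod q ^ (es ! k) = x ! k" if "x \<in> K (dsum m es)" "k < length es" for x k
    using nth_K_mod[OF that(1), of k] that assms by simp
  then show ?thesis
    unfolding marr_def Idn_cls using assms
    by (intro cls_cong) (auto simp: marr_lin adm_def if_distrib[of "(*) _"] intro!: K_eqI[of _ "dsum m es"] cong: if_cong)
qed

text \<open>The rule that multiplies an entry by \<open>p ^ (i - j)\<close> is stated with both
  sides multiplied out, as the exponent may be negative. One matrix between the free middle terms,
  namely \<open>G\<close> with its rows and columns in reverse order, restricts to \<open>L\<close>
  on kernel terms and induces \<open>G\<close> on cokernel terms.\<close>

lemma marr_shift:
  assumes v: "valid es" "valid fs" and L: "adm es fs L"
    and H: "\<And>r s. r < length es \<Longrightarrow> s < length fs \<Longrightarrow>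
      q ^ (m - es ! r) * G ! (length es - Suc r) ! (length fs - Suc s) = q ^ (m - fs ! s) * L ! r ! s"
  shows "stable_shift p m (marr es fs L) = marr (rev (map (\<lambda>e. m - e) es)) (rev (map (\<lambda>e. m - e) fs)) G"
proof -
  let ?a = "dsum m es" and ?b = "dsum m fs" and ?es = "rev (map (\<lambda>e. m - e) es)" and ?fs = "rev (map (\<lambda>e. m - e) fs)"
  note v' = valid_shift[OF v(1)] valid_shift[OF v(2)]
  have ab: "?a \<in> E_obj m" "?b \<in> E_obj m" by simp_all
  have ra: "rev ?a = dsum m ?es" "rev ?b = dsum m ?fs" using v by (simp_all add: rev_dsum)
  have G: "adm ?es ?fs G"
    unfolding adm_def
  proof (intro allI impI)
    fix r s assume rs: "r < length ?es" "s < length ?fs"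
    then have "q ^ (m - es ! (length es - Suc r)) * G ! r ! s = q ^ (m - fs ! (length fs - Suc s)) * L ! (length es - Suc r) ! (length fs - Suc s)"
      using H[of "length es - Suc r" "length fs - Suc s"] by (simp add: Suc_diff_Suc)
    then show "q ^ (?fs ! s) dvd q ^ (?es ! r) * G ! r ! s" using rs by (simp add: rev_nth)
  qed
  define N where "N = map (\<lambda>r. map (\<lambda>s. G ! (length es - Suc r) ! (length fs - Suc s)) [0..<length fs]) [0..<length es]"
  have N: "admissible (mid m ?a) (mid m ?b) N" using v by (simp add: admissible_def)
  let ?f = "lin p ?a ?b L" and ?g = "lin p (rev ?a) (rev ?b) G" and ?h = "lin p (mid m ?a) (mid m ?b) N"
  have f: "?f \<in> Hom ?a ?b" and g: "?g \<in> Hom (rev ?a) (rev ?b)"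
    using v v' L G unfolding ra by (simp_all add: marr_lin)
  have "shift_rel ?a ?b ?f ?g"
    unfolding shift_rel_def
  proof (intro bexI[of _ ?h] conjI ballI)
    show "?h \<in> Hom (mid m ?a) (mid m ?b)" using N by simp
    fix x assume x: "x \<in> K ?a"
    show "?h (ifl ?a x) = ifl ?b (?f x)"
    proof (rule K_eqI[of _ "mid m ?b"])
      fix s assume "s < rk (mid m ?b)"
      then have s: "s < length fs" using v by simp
      have fm: "q ^ m = q ^ (m - fs ! s) * q ^ (fs ! s)" using v s by (simp add: valid_def flip: power_add)
      have "(\<Sum>r<length es. q ^ (m - es ! r) * x ! r * N ! r ! s) = q ^ (m - fs ! s) * (\<Sum>r<length es. x ! r * L ! r ! s)"
        unfolding sum_distrib_left
      proof (rule sum.cong[OF refl])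
        fix r assume "r \<in> {..<length es}"
        then have e: "q ^ (m - es ! r) * N ! r ! s = q ^ (m - fs ! s) * L ! r ! s" using H s by (simp add: N_def)
        have "q ^ (m - es ! r) * x ! r * N ! r ! s = x ! r * (q ^ (m - es ! r) * N ! r ! s)" by simp
        also have "\<dots> = q ^ (m - fs ! s) * (x ! r * L ! r ! s)" unfolding e by simp
        finally show "q ^ (m - es ! r) * x ! r * N ! r ! s = q ^ (m - fs ! s) * (x ! r * L ! r ! s)" .
      qed
      moreover have "?h (ifl ?a x) ! s = (\<Sum>r<length es. q ^ (m - es ! r) * x ! r * N ! r ! s) mod q ^ m"
        using x v s ab by simp
      moreover have "ifl ?b (?f x) ! s = q ^ (m - fs ! s) * ((\<Sum>r<length es. x ! r * L ! r ! s) mod q ^ (fs ! s))"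
        using x v s f by simp
      ultimately show "?h (ifl ?a x) ! s = ifl ?b (?f x) ! s" by (simp only: fm mult_mod_right)
    qed (use x f ab in simp_all)
  next
    fix y assume y: "y \<in> K (mid m ?a)"
    show "dfl ?b (?h y) = ?g (dfl ?a y)"
    proof (rule K_eqI[of _ "rev ?b"])
      fix s assume "s < rk (rev ?b)"
      then have s: "s < length fs" using v by simp
      let ?s = "length fs - Suc s" and ?n = "length es"
      have s': "?s < length fs" using s by simp
      define z where "z = map (\<lambda>r. y ! (?n - Suc r)) [0..<?n]"
      have z: "length z = rk (rev ?a)" using v by (simp add: z_def)
      have "dfl ?a y = reduce p (rev ?a) z"
        using y v ab z by (intro K_eqI[of _ "rev ?a"]) (auto simp: z_def)
      then have "?g (dfl ?a y) ! s = (\<Sum>r<?n. z ! r * G ! r ! s) mod q ^ (m - fs ! ?s)"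
        using lin_reduce[of "rev ?a" "rev ?b" G z s] G v v' s z adm_admissible[OF v' ] unfolding ra by (simp add: rev_nth)
      also have "(\<Sum>r<?n. z ! r * G ! r ! s) = (\<Sum>r<?n. y ! (?n - Suc r) * G ! r ! s)" by (simp add: z_def)
      also have "\<dots> = (\<Sum>r<?n. y ! r * G ! (?n - Suc r) ! s)"
        by (subst sum.nat_diff_reindex[symmetric]) (auto intro!: sum.cong simp: Suc_diff_Suc)
      also have "\<dots> = (\<Sum>r<?n. y ! r * N ! r ! ?s)" using s s' by (simp add: N_def Suc_diff_Suc del: diff_Suc_less)
      finally show "dfl ?b (?h y) ! s = ?g (dfl ?a y) ! s"
        using y v s ab by (simp add: mod_mod_cancel le_imp_power_dvd)
    qed (use y g ab in simp_all)
  qed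
  then show ?thesis unfolding marr_def using stable_shift_cls[OF ab f g] by (simp add: ra)
qed


text \<open>The matrices \<open>X\<close>, \<open>X'\<close> certify joint injectivity, by recovering \<open>p\<close> to the power \<open>\<kappa> ! j\<close> times the \<open>j\<close>th coordinate from
  the image; \<open>Y\<close>, \<open>Z\<close> certify joint surjectivity, by giving preimages of the generators.\<close>

lemma lin_bicartesian:
  assumes adm: "admissible a b F" "admissible a b' G" "admissible b d H" "admissible b' d N"
    and comm: "\<And>r s. r < rk a \<Longrightarrow> s < rk d \<Longrightarrow>
      ord d s dvd (\<Sum>t<rk b. F ! r ! t * H ! t ! s) - (\<Sum>t<rk b'. G ! r ! t * N ! t ! s)"
    and inj: "\<And>r j. r < rk a \<Longrightarrow> j < rk a \<Longrightarrow>
      (\<Sum>t<rk b. F ! r ! t * X ! t ! j) + (\<Sum>t<rk b'. G ! r ! t * X' ! t ! j) = (if r = j then q ^ (\<kappa> ! j) else 0)"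
    and X: "\<And>t j. t < rk b \<Longrightarrow> j < rk a \<Longrightarrow> q ^ (\<kappa> ! j + summands a ! j) dvd ord b t * X ! t ! j"
    and X': "\<And>t j. t < rk b' \<Longrightarrow> j < rk a \<Longrightarrow> q ^ (\<kappa> ! j + summands a ! j) dvd ord b' t * X' ! t ! j"
    and surj: "\<And>s j. s < rk d \<Longrightarrow> j < rk d \<Longrightarrow>
      ord d j dvd (\<Sum>t<rk b. Y ! s ! t * H ! t ! j) + (\<Sum>t<rk b'. Z ! s ! t * N ! t ! j) - (if s = j then 1 else 0)"
    and count: "sum_list (summands a) + sum_list (summands d) = sum_list (summands b) + sum_list (summands b')"
  shows "bicartesian a b b' d (lin p a b F) (lin p a b' G) (lin p b d H) (lin p b' d N)"
proof (rule bicartesian_by_card)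
  have swap: "(\<Sum>t<k. (\<Sum>r<n. x r * A r t) * B t) = (\<Sum>r<n. x r * (\<Sum>t<k. A r t * B t))" for k n and x :: "nat \<Rightarrow> int" and A B
    unfolding sum_distrib_left sum_distrib_right by (subst sum.swap) (simp add: mult.assoc)
  show "lin p a b F \<in> Hom a b" "lin p a b' G \<in> Hom a b'" "lin p b d H \<in> Hom b d" "lin p b' d N \<in> Hom b' d"
    using adm by simp_all
  show "card (K a) * card (K d) = card (K b) * card (K b')" using count by (simp add: card_K flip: power_add)
  show "lin p b d H (lin p a b F x) = lin p b' d N (lin p a b' G x)" if x: "x \<in> K a" for x
  proof (rule K_eqI[of _ d])
    fix s assume s: "s < rk d"
    define y where "y = map (\<lambda>t. \<Sum>r<rk a. x ! r * F ! r ! t) [0..<rk b]"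
    define z where "z = map (\<lambda>t. \<Sum>r<rk a. x ! r * G ! r ! t) [0..<rk b']"
    have e: "lin p a b F x = reduce p b y" "lin p a b' G x = reduce p b' z" using x by (simp_all add: y_def z_def lin_def)
    have "lin p b d H (lin p a b F x) ! s = (\<Sum>t<rk b. (\<Sum>r<rk a. x ! r * F ! r ! t) * H ! t ! s) mod ord d s"
      unfolding e using lin_reduce[OF adm(3) _ s, of y] by (simp add: y_def)
    also have "\<dots> = (\<Sum>t<rk b'. (\<Sum>r<rk a. x ! r * G ! r ! t) * N ! t ! s) mod ord d s"
      unfolding swap using comm s unfolding cong_def[symmetric]
      by (intro cong_sum cong_mult) (auto simp: cong_iff_dvd_diff)
    also have "\<dots> = lin p b' d N (lin p a b' G x) ! s"
      unfolding e using lin_reduce[OF adm(4) _ s, of z] by (simp add: z_def)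
    finally show "lin p b d H (lin p a b F x) ! s = lin p b' d N (lin p a b' G x) ! s" .
  qed (use x in simp_all)
  show "x = \<zero>\<^bsub>M a\<^esub>" if x: "x \<in> K a" and f0: "lin p a b F x = \<zero>\<^bsub>M b\<^esub>" and g0: "lin p a b' G x = \<zero>\<^bsub>M b'\<^esub>" for x
  proof (rule K_eqI[OF x zero_closed])
    fix j assume j: "j < rk a"
    \<comment> \<open>The certificate recovers \<open>q ^ (\<kappa> ! j)\<close> times the
      coordinate modulo \<open>q ^ ?e\<close>; cancelling that factor leaves divisibility by the
      full order of the coordinate.\<close>
    let ?e = "\<kappa> ! j + summands a ! j"
    have "q ^ ?e dvd (\<Sum>r<rk a. x ! r * F ! r ! t) * X ! t ! j" if t: "t < rk b" for t
    proof -
      have "(\<Sum>r<rk a. x ! r * F ! r ! t) mod ord b t = 0" using lin_nth[OF x t, of F] t by (simp add: f0)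
      then have "ord b t dvd (\<Sum>r<rk a. x ! r * F ! r ! t)" by (rule mod_0_imp_dvd)
      then show ?thesis by (intro dvd_trans[OF X[OF t j]] mult_dvd_mono dvd_refl)
    qed
    moreover have "q ^ ?e dvd (\<Sum>r<rk a. x ! r * G ! r ! t) * X' ! t ! j" if t: "t < rk b'" for t
    proof -
      have "(\<Sum>r<rk a. x ! r * G ! r ! t) mod ord b' t = 0" using lin_nth[OF x t, of G] t by (simp add: g0)
      then have "ord b' t dvd (\<Sum>r<rk a. x ! r * G ! r ! t)" by (rule mod_0_imp_dvd)
      then show ?thesis by (intro dvd_trans[OF X'[OF t j]] mult_dvd_mono dvd_refl)
    qed
    ultimately have "q ^ ?e dvd (\<Sum>t<rk b. (\<Sum>r<rk a. x ! r * F ! r ! t) * X ! t ! j) + (\<Sum>t<rk b'. (\<Sum>r<rk a. x ! r * G ! r ! t) * X' ! t ! j)"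
      by (intro dvd_add dvd_sum) auto
    also have "\<dots> = (\<Sum>r<rk a. x ! r * (if r = j then q ^ (\<kappa> ! j) else 0))"
      unfolding swap sum.distrib[symmetric] distrib_left[symmetric] using inj j by (intro sum.cong) auto
    also have "\<dots> = x ! j * q ^ (\<kappa> ! j)" using j by (simp add: if_distrib cong: if_cong)
    finally have "ord a j dvd x ! j" using p_pos by (simp add: power_add mult.commute)
    then show "x ! j = \<zero>\<^bsub>M a\<^esub> ! j" using nth_K_mod[OF x j] j by (simp add: mod_eq_0_iff_dvd[symmetric])
  qed
  show "\<exists>y\<in>K b. \<exists>z\<in>K b'. w = lin p b d H y \<oplus>\<^bsub>M d\<^esub> lin p b' d N z" if w: "w \<in> K d" for w
  proof (intro bexI)
    define y where "y = map (\<lambda>t. \<Sum>s<rk d. w ! s * Y ! s ! t) [0..<rk b]"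
    define z where "z = map (\<lambda>t. \<Sum>s<rk d. w ! s * Z ! s ! t) [0..<rk b']"
    show K: "reduce p b y \<in> K b" "reduce p b' z \<in> K b'" by (simp_all add: y_def z_def)
    show "w = lin p b d H (reduce p b y) \<oplus>\<^bsub>M d\<^esub> lin p b' d N (reduce p b' z)"
    proof (rule K_eqI[OF w])
      show "lin p b d H (reduce p b y) \<oplus>\<^bsub>M d\<^esub> lin p b' d N (reduce p b' z) \<in> K d" using K by simp
      fix j assume j: "j < rk d"
      have "(lin p b d H (reduce p b y) \<oplus>\<^bsub>M d\<^esub> lin p b' d N (reduce p b' z)) ! j =
        ((\<Sum>t<rk b. (\<Sum>s<rk d. w ! s * Y ! s ! t) * H ! t ! j) + (\<Sum>t<rk b'. (\<Sum>s<rk d. w ! s * Z ! s ! t) * N ! t ! j)) mod ord d j"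
        using lin_reduce[OF adm(3) _ j, of y] lin_reduce[OF adm(4) _ j, of z] K j
        by (simp add: y_def z_def mod_add_eq del: lin_nth)
      also have "\<dots> = (\<Sum>s<rk d. w ! s * (if s = j then 1 else 0)) mod ord d j"
        unfolding swap sum.distrib[symmetric] distrib_left[symmetric] using surj j unfolding cong_def[symmetric]
        by (intro cong_sum cong_mult) (auto simp: cong_iff_dvd_diff)
      also have "\<dots> = w ! j" using j w by (simp add: if_distrib cong: if_cong)
      finally show "w ! j = (lin p b d H (reduce p b y) \<oplus>\<^bsub>M d\<^esub> lin p b' d N (reduce p b' z)) ! j" by simp
    qed
  qed
qed

text \<open>For concrete exponent lists and certificates all hypotheses are finite arithmetic with
  powers of \<open>q\<close>, which simplification can decide.\<close>

lemma marr_weak_square: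
  assumes v: "valid as" "valid bs" "valid bs'" "valid ds"
    and adm: "adm as bs F" "adm as bs' G" "adm bs ds H" "adm bs' ds N"
    and comm: "\<And>r s. r < length as \<Longrightarrow> s < length ds \<Longrightarrow>
      q ^ (ds ! s) dvd (\<Sum>t<length bs. F ! r ! t * H ! t ! s) - (\<Sum>t<length bs'. G ! r ! t * N ! t ! s)"
    and inj: "\<And>r j. r < length as \<Longrightarrow> j < length as \<Longrightarrow>
      (\<Sum>t<length bs. F ! r ! t * X ! t ! j) + (\<Sum>t<length bs'. G ! r ! t * X' ! t ! j) = (if r = j then q ^ (\<kappa> ! j) else 0)"
    and X: "\<And>t j. t < length bs \<Longrightarrow> j < length as \<Longrightarrow> q ^ (\<kappa> ! j + as ! j) dvd q ^ (bs ! t) * X ! t ! j"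
    and X': "\<And>t j. t < length bs' \<Longrightarrow> j < length as \<Longrightarrow> q ^ (\<kappa> ! j + as ! j) dvd q ^ (bs' ! t) * X' ! t ! j"
    and surj: "\<And>s j. s < length ds \<Longrightarrow> j < length ds \<Longrightarrow>
      q ^ (ds ! j) dvd (\<Sum>t<length bs. Y ! s ! t * H ! t ! j) + (\<Sum>t<length bs'. Z ! s ! t * N ! t ! j) - (if s = j then 1 else 0)"
    and count: "sum_list as + sum_list ds = sum_list bs + sum_list bs'"
  shows "weak_square C (dsum m as) (dsum m bs) (dsum m bs') (dsum m ds) (marr as bs F) (marr as bs' G) (marr bs ds H) (marr bs' ds N)"
  unfolding marr_def using assms
  by (intro bicartesian_weak_square lin_bicartesian[where X = X and X' = X' and Y = Y and Z = Z and \<kappa> = \<kappa>]) (auto simp flip: adm_admissible)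

text \<open>With the distinguished monomorphism as a diagonal matrix, a pushout square consists of
  matrices only and \<open>lin_bicartesian\<close> applies to it.\<close>

lemma infl_lin:
  assumes v: "valid as"
  shows "ifl (dsum m as) = lin p (dsum m as) (mid m (dsum m as)) (map (\<lambda>r. map (\<lambda>s. if r = s then q ^ (m - as ! r) else 0) [0..<length as]) [0..<length as])"
proof (rule extensionalityI[of _ "K (dsum m as)"])
  fix x assume x: "x \<in> K (dsum m as)"
  have "ifl (dsum m as) x \<in> K (mid m (dsum m as))" using x by simp
  then have "q ^ (m - as ! k) * x ! k mod q ^ m = q ^ (m - as ! k) * x ! k" if "k < length as" for k
    using nth_K_mod[of "ifl (dsum m as) x" "mid m (dsum m as)" k] that v x by simp
  then show "ifl (dsum m as) x = lin p (dsum m as) (mid m (dsum m as)) (map (\<lambda>r. map (\<lambda>s. if r = s then q ^ (m - as ! r) else 0) [0..<length as]) [0..<length as]) x"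
    using x v by (intro K_eqI[of _ "mid m (dsum m as)"]) (auto simp: if_distrib[of "(*) _"] mult.commute cong: if_cong)
qed (auto simp: infl_def lin_def)

lemma marr_standard_triangle:
  assumes v: "valid as" "valid bs" "valid cs"
    and adm: "adm as bs F" "adm bs cs G" and h: "adm cs (rev (map (\<lambda>e. m - e) as)) H"
    and comm: "\<And>r s. r < length as \<Longrightarrow> s < length cs \<Longrightarrow>
      q ^ (cs ! s) dvd q ^ (m - as ! r) * N ! r ! s - (\<Sum>t<length bs. F ! r ! t * G ! t ! s)"
    and gh: "\<And>r s. r < length bs \<Longrightarrow> s < length as \<Longrightarrow>
      q ^ (m - as ! (length as - Suc s)) dvd (\<Sum>t<length cs. G ! r ! t * H ! t ! s)"
    and kh: "\<And>r s. r < length as \<Longrightarrow> s < length as \<Longrightarrow>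
      q ^ (m - as ! (length as - Suc s)) dvd (\<Sum>t<length cs. N ! r ! t * H ! t ! s) - (if s = length as - Suc r then 1 else 0)"
    and surj: "\<And>s j. s < length cs \<Longrightarrow> j < length cs \<Longrightarrow>
      q ^ (cs ! j) dvd (\<Sum>t<length as. Y ! s ! t * N ! t ! j) + (\<Sum>t<length bs. Z ! s ! t * G ! t ! j) - (if s = j then 1 else 0)"
    and count: "sum_list as + sum_list cs = length as * m + sum_list bs"
  shows "standard_triangle p m (dsum m as) (dsum m bs) (dsum m cs)
    (lin p (dsum m as) (dsum m bs) F) (lin p (dsum m bs) (dsum m cs) G) (lin p (dsum m cs) (rev (dsum m as)) H)"
proof (rule bicartesian_triangle)
  let ?a = "dsum m as" and ?b = "dsum m bs" and ?c = "dsum m cs"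
  let ?D = "map (\<lambda>r. map (\<lambda>s. if r = s then q ^ (m - as ! r) else 0) [0..<length as]) [0..<length as]"
  let ?I = "map (\<lambda>r. map (\<lambda>s. if r = s then 1 else 0) [0..<length as]) [0..<length as]"
  let ?O = "replicate (length bs) (replicate (length as) 0)"
  let ?\<kappa> = "map (\<lambda>r. m - as ! r) [0..<length as]"
  have as_le: "as ! r \<le> m" if "r < length as" for r using v that by (simp add: valid_def)
  have cs_le: "cs ! r \<le> m" if "r < length cs" for r using v that by (simp add: valid_def)
  note v' = valid_shift[OF v(1)]
  have ra: "rev ?a = dsum m (rev (map (\<lambda>e. m - e) as))" using v by (simp add: rev_dsum)
  have N: "admissible (mid m ?a) ?c N" using v cs_le by (auto simp: admissible_def intro!: dvd_mult2 le_imp_power_dvd)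
  have D: "admissible ?a (mid m ?a) ?D" using v as_le by (auto simp: admissible_def simp flip: power_add)
  have G: "admissible ?b ?c G" using v adm by (simp flip: adm_admissible)
  have H: "admissible ?c (rev ?a) H" using v v' h unfolding ra by (simp flip: adm_admissible)
  show "bicartesian ?a (mid m ?a) ?b ?c (ifl ?a) (lin p ?a ?b F) (lin p (mid m ?a) ?c N) (lin p ?b ?c G)"
    unfolding infl_lin[OF v(1)]
  \<comment> \<open>The diagonal matrix of the distinguished monomorphism already returns
    \<open>q ^ (m - e)\<close> times each coordinate. This determines \<open>\<kappa>\<close> and
    allows the identity and zero as injectivity certificates.\<close>
  proof (rule lin_bicartesian[where X = ?I and X' = ?O and Y = Y and Z = Z and \<kappa> = ?\<kappa>])
    show "admissible ?a ?b F" "admissible ?b ?c G" using v adm by (simp_all flip: adm_admissible)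
    fix r j assume "r < rk ?a" "j < rk ?a"
    then show "(\<Sum>t<rk (mid m ?a). ?D ! r ! t * ?I ! t ! j) + (\<Sum>t<rk ?b. F ! r ! t * ?O ! t ! j) = (if r = j then q ^ (?\<kappa> ! j) else 0)"
      using v by (simp add: if_distrib[of "\<lambda>x. x * _"] if_distrib[of "(*) _"] cong: if_cong)
  qed (use v N D comm surj count as_le in \<open>auto simp: if_distrib[of "\<lambda>x. x * _"] sum_list_replicate simp flip: power_add cong: if_cong\<close>)
  show "lin p ?c (rev ?a) H \<in> Hom ?c (rev ?a)" using H by simp
  have comp0: "E_comp p ?b (lin p ?b ?c G) (lin p ?c (rev ?a) H) = lin p ?b (rev ?a) (replicate (length bs) (replicate (length as) 0))"
    using v G H gh by (intro lin_comp) (auto simp: cong_0_iff)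
  show "lin p ?c (rev ?a) H (lin p ?b ?c G y) = \<zero>\<^bsub>M (rev ?a)\<^esub>" if y: "y \<in> K ?b" for y
  proof -
    have "lin p ?c (rev ?a) H (lin p ?b ?c G y) = lin p ?b (rev ?a) (replicate (length bs) (replicate (length as) 0)) y"
      using fun_cong[OF comp0, of y] y by simp
    also have "\<dots> = \<zero>\<^bsub>M (rev ?a)\<^esub>" using y v by (intro K_eqI[of _ "rev ?a"]) auto
    finally show ?thesis .
  qed
  \<comment> \<open>Antidiagonal, because \<open>defl\<close> reverses the order of the
    summands.\<close>
  let ?E = "map (\<lambda>r. map (\<lambda>s. if s = length as - Suc r then 1 else 0) [0..<length as]) [0..<length as]"
  have comp1: "E_comp p (mid m ?a) (lin p (mid m ?a) ?c N) (lin p ?c (rev ?a) H) = lin p (mid m ?a) (rev ?a) ?E"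
    using v N H kh by (intro lin_comp) (auto simp: cong_iff_dvd_diff)
  show "lin p ?c (rev ?a) H (lin p (mid m ?a) ?c N y) = dfl ?a y" if y: "y \<in> K (mid m ?a)" for y
  proof -
    have "lin p ?c (rev ?a) H (lin p (mid m ?a) ?c N y) = lin p (mid m ?a) (rev ?a) ?E y"
      using fun_cong[OF comp1, of y] y by simp
    also have "\<dots> = dfl ?a y"
    proof (rule K_eqI[of _ "rev ?a"])
      fix k assume "k < rk (rev ?a)"
      then have k: "k < length as" using v by simp
      have "(\<Sum>r<length as. y ! r * ?E ! r ! k) = (\<Sum>r<length as. if r = length as - Suc k then y ! r else 0)"
        using k by (intro sum.cong) auto
      also have "\<dots> = y ! (length as - Suc k)" using k by simp
      finally show "lin p (mid m ?a) (rev ?a) ?E y ! k = dfl ?a y ! k" using y v k by simp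
    qed (use y in simp_all)
    finally show ?thesis .
  qed
qed simp_all

text \<open>\<open>N\<close> is the map from the middle term to the pushout \<open>cs\<close>, and \<open>cs'\<close> is \<open>cs\<close> without its free summand,
  with \<open>W\<close>, \<open>W'\<close> the inclusion and the projection.\<close>

lemma marr_dist:
  assumes v: "valid as" "valid bs" "valid cs" "valid cs'"
    and adm: "adm as bs F" "adm bs cs G" "adm cs (rev (map (\<lambda>e. m - e) as)) H"
    and adm': "adm bs cs' G'" "adm cs' (rev (map (\<lambda>e. m - e) as)) H'" "adm cs' cs W" "adm cs cs' W'"
    and comm: "\<And>r s. r < length as \<Longrightarrow> s < length cs \<Longrightarrow>
      q ^ (cs ! s) dvd q ^ (m - as ! r) * N ! r ! s - (\<Sum>t<length bs. F ! r ! t * G ! t ! s)"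
    and gh: "\<And>r s. r < length bs \<Longrightarrow> s < length as \<Longrightarrow>
      q ^ (m - as ! (length as - Suc s)) dvd (\<Sum>t<length cs. G ! r ! t * H ! t ! s)"
    and kh: "\<And>r s. r < length as \<Longrightarrow> s < length as \<Longrightarrow>
      q ^ (m - as ! (length as - Suc s)) dvd (\<Sum>t<length cs. N ! r ! t * H ! t ! s) - (if s = length as - Suc r then 1 else 0)"
    and surj: "\<And>s j. s < length cs \<Longrightarrow> j < length cs \<Longrightarrow>
      q ^ (cs ! j) dvd (\<Sum>t<length as. Y ! s ! t * N ! t ! j) + (\<Sum>t<length bs. Z ! s ! t * G ! t ! j) - (if s = j then 1 else 0)"
    and count: "sum_list as + sum_list cs = length as * m + sum_list bs"
    and WW': "\<And>r s. r < length cs' \<Longrightarrow> s < length cs' \<Longrightarrow>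
      q ^ min (m - cs' ! r) (cs' ! s) dvd (\<Sum>t<length cs. W ! r ! t * W' ! t ! s) - (if s = r then 1 else 0)"
    and W'W: "\<And>r s. r < length cs \<Longrightarrow> s < length cs \<Longrightarrow>
      q ^ min (m - cs ! r) (cs ! s) dvd (\<Sum>t<length cs'. W' ! r ! t * W ! t ! s) - (if s = r then 1 else 0)"
    and GW: "\<And>r s. r < length bs \<Longrightarrow> s < length cs \<Longrightarrow>
      q ^ min (m - bs ! r) (cs ! s) dvd (\<Sum>t<length cs'. G' ! r ! t * W ! t ! s) - G ! r ! s"
    and WH: "\<And>r s. r < length cs' \<Longrightarrow> s < length as \<Longrightarrow>
      q ^ min (m - cs' ! r) (m - as ! (length as - Suc s)) dvd (\<Sum>t<length cs. W ! r ! t * H ! t ! s) - H' ! r ! s"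
  shows "stable_dist p m (marr as bs F) (marr bs cs' G') (marr cs' (rev (map (\<lambda>e. m - e) as)) H')"
proof -
  let ?ra = "rev (map (\<lambda>e. m - e) as)"
  have ra: "rev (dsum m as) = dsum m ?ra" and v': "valid ?ra" using v by (simp_all add: rev_dsum valid_shift)
  have id: "adm xs xs (map (\<lambda>r. map (\<lambda>s. if s = r then 1 else 0) [0..<length xs]) [0..<length xs])" for xs
    by (simp add: adm_def)
  show ?thesis
    unfolding marr_def[of as bs]
  proof (rule stable_distI)
    show "standard_triangle p m (dsum m as) (dsum m bs) (dsum m cs)
      (lin p (dsum m as) (dsum m bs) F) (lin p (dsum m bs) (dsum m cs) G) (lin p (dsum m cs) (rev (dsum m as)) H)"
      by (rule marr_standard_triangle[OF v(1-3) adm comm gh kh surj count])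
    have "Cmp C (marr cs' cs W) (marr cs cs' W') = Idn C (dsum m cs')"
      unfolding marr_Idn[OF v(4)] using v adm' id WW' by (intro marr_Cmp) auto
    moreover have "Cmp C (marr cs cs' W') (marr cs' cs W) = Idn C (dsum m cs)"
      unfolding marr_Idn[OF v(3)] using v adm' id W'W by (intro marr_Cmp) auto
    ultimately show "isomorphism C (dsum m cs') (dsum m cs) (marr cs' cs W)"
      unfolding isomorphism_def using v adm' marr_Mor by auto
    show "marr bs cs' G' \<in> Mor C (dsum m bs) (dsum m cs')" using v adm' by (intro marr_Mor)
    show "Cmp C (marr bs cs' G') (marr cs' cs W) = cls p m (dsum m bs) (dsum m cs) (lin p (dsum m bs) (dsum m cs) G)"
      unfolding marr_def[of bs cs, symmetric] using v adm adm' GW by (intro marr_Cmp)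
    show "marr cs' ?ra H' \<in> Mor C (dsum m cs') (rev (dsum m as))" unfolding ra using v v' adm' by (intro marr_Mor)
    show "marr cs' ?ra H' = Cmp C (marr cs' cs W) (cls p m (dsum m cs) (rev (dsum m as)) (lin p (dsum m cs) (rev (dsum m as)) H))"
      unfolding ra marr_def[of cs ?ra, symmetric] using v v' adm adm' WH
      by (intro marr_Cmp[symmetric]) (auto simp: rev_nth)
  qed
qed

end

section \<open>Diagrams on the strip\<close>

text \<open>A diagram on the strip is extended by zero objects to all of \<open>\<int> \<times> \<int>\<close>, so that paths may leave the strip
  and functoriality follows from the commutation of the unit squares.\<close>

locale grid = additive_category +
  fixes Ob :: "int \<Rightarrow> int \<Rightarrow> 'a" and R V :: "int \<Rightarrow> int \<Rightarrow> 'b"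
  assumes Ob: "Ob b a \<in> Obj C"
    and R: "R b a \<in> Mor C (Ob b a) (Ob (b + 1) a)"
    and V: "V b a \<in> Mor C (Ob b a) (Ob b (a + 1))"
    and comm: "Cmp C (R b a) (V (b + 1) a) = Cmp C (V b a) (R b (a + 1))"
begin

primrec Rp :: "nat \<Rightarrow> int \<Rightarrow> int \<Rightarrow> 'b" where
  "Rp 0 b a = Idn C (Ob b a)"
| "Rp (Suc n) b a = Cmp C (Rp n b a) (R (b + int n) a)"

primrec Vp :: "nat \<Rightarrow> int \<Rightarrow> int \<Rightarrow> 'b" where
  "Vp 0 b a = Idn C (Ob b a)"
| "Vp (Suc n) b a = Cmp C (Vp n b a) (V b (a + int n))"

definition path :: "int \<Rightarrow> int \<Rightarrow> int \<Rightarrow> int \<Rightarrow> 'b" where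
  "path b a b' a' = Cmp C (Rp (nat (b' - b)) b a) (Vp (nat (a' - a)) b' a)"

lemma Rp_Mor: "Rp n b a \<in> Mor C (Ob b a) (Ob (b + int n) a)"
proof (induction n)
  case (Suc n)
  have "R (b + int n) a \<in> Mor C (Ob (b + int n) a) (Ob (b + int (Suc n)) a)" using R[of "b + int n" a] by (simp add: ac_simps)
  then show ?case using Suc Ob by (simp add: Cmp_closed[of _ "Ob (b + int n) a"])
qed (simp add: Idn_closed Ob)

lemma Vp_Mor: "Vp n b a \<in> Mor C (Ob b a) (Ob b (a + int n))"
proof (induction n)
  case (Suc n)
  have "V b (a + int n) \<in> Mor C (Ob b (a + int n)) (Ob b (a + int (Suc n)))" using V[of b "a + int n"] by (simp add: ac_simps)
  then show ?case using Suc Ob by (simp add: Cmp_closed[of _ "Ob b (a + int n)"])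
qed (simp add: Idn_closed Ob)

lemma Rp_1: "Rp (Suc 0) b a = R b a"
  using Idn_left[OF Ob Ob R] by simp

lemma Vp_1: "Vp (Suc 0) b a = V b a"
  using Idn_left[OF Ob Ob V] by simp

lemma Rp_add: "Cmp C (Rp i b a) (Rp j (b + int i) a) = Rp (i + j) b a"
proof (induction j)
  case 0
  show ?case using Idn_right[OF Ob Ob Rp_Mor] by simp
next
  case (Suc j)
  have "Cmp C (Rp i b a) (Rp (Suc j) (b + int i) a) = Cmp C (Cmp C (Rp i b a) (Rp j (b + int i) a)) (R (b + int i + int j) a)"
    using Cmp_assoc[OF Ob Ob Ob Ob Rp_Mor Rp_Mor R, of i b a j] by simp
  then show ?case using Suc by (simp add: add.assoc)
qed

lemma Vp_add: "Cmp C (Vp i b a) (Vp j b (a + int i)) = Vp (i + j) b a"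
proof (induction j)
  case 0
  show ?case using Idn_right[OF Ob Ob Vp_Mor] by simp
next
  case (Suc j)
  have "Cmp C (Vp i b a) (Vp (Suc j) b (a + int i)) = Cmp C (Cmp C (Vp i b a) (Vp j b (a + int i))) (V b (a + int i + int j))"
    using Cmp_assoc[OF Ob Ob Ob Ob Vp_Mor Vp_Mor V, of i b a j] by simp
  then show ?case using Suc by (simp add: add.assoc)
qed

lemma R_Vp: "Cmp C (R b a) (Vp j (b + 1) a) = Cmp C (Vp j b a) (R b (a + int j))"
proof (induction j)
  case 0
  show ?case using Idn_right[OF Ob Ob R] Idn_left[OF Ob Ob R] by simp
next
  case (Suc j)
  have "Cmp C (R b a) (Vp (Suc j) (b + 1) a) = Cmp C (Cmp C (R b a) (Vp j (b + 1) a)) (V (b + 1) (a + int j))"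
    using Cmp_assoc[OF Ob Ob Ob Ob R Vp_Mor V, of b a j] by simp
  also have "\<dots> = Cmp C (Vp j b a) (Cmp C (R b (a + int j)) (V (b + 1) (a + int j)))"
    unfolding Suc using Cmp_assoc[OF Ob Ob Ob Ob Vp_Mor R V, of j b a] by simp
  also have "\<dots> = Cmp C (Vp (Suc j) b a) (R b (a + int j + 1))"
    unfolding comm using Cmp_assoc[OF Ob Ob Ob Ob Vp_Mor V R, of j b a] by simp
  finally show ?case by (simp add: ac_simps)
qed

lemma Rp_Vp: "Cmp C (Rp i b a) (Vp j (b + int i) a) = Cmp C (Vp j b a) (Rp i b (a + int j))"
proof (induction i)
  case 0
  show ?case using Idn_right[OF Ob Ob Vp_Mor] Idn_left[OF Ob Ob Vp_Mor] by simp
next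
  case (Suc i)
  have e: "b + int (Suc i) = b + int i + 1" by simp
  have "Cmp C (Rp (Suc i) b a) (Vp j (b + int (Suc i)) a) = Cmp C (Rp i b a) (Cmp C (R (b + int i) a) (Vp j (b + int i + 1) a))"
    unfolding e using Cmp_assoc[OF Ob Ob Ob Ob Rp_Mor R Vp_Mor, of i b a j] by simp
  also have "\<dots> = Cmp C (Cmp C (Rp i b a) (Vp j (b + int i) a)) (R (b + int i) (a + int j))"
    unfolding R_Vp using Cmp_assoc[OF Ob Ob Ob Ob Rp_Mor Vp_Mor R, of i b a j] by simp
  also have "\<dots> = Cmp C (Vp j b a) (Cmp C (Rp i b (a + int j)) (R (b + int i) (a + int j)))"
    unfolding Suc using Cmp_assoc[OF Ob Ob Ob Ob Vp_Mor Rp_Mor R, of j b a i] by simp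
  finally show ?case by simp
qed

lemma path_Mor:
  assumes "b \<le> b'" "a \<le> a'"
  shows "path b a b' a' \<in> Mor C (Ob b a) (Ob b' a')"
  using Cmp_closed[OF Ob Ob Ob Rp_Mor Vp_Mor, of "nat (b' - b)" b a "nat (a' - a)"] assms by (simp add: path_def)

lemma path_Idn: "path b a b a = Idn C (Ob b a)"
  using Idn_left[OF Ob Ob Idn_closed[OF Ob]] by (simp add: path_def)

text \<open>By \<open>Rp_Vp\<close> the vertical part of the first path moves past the horizontal
  part of the second, and the parts of equal direction merge.\<close>

lemma path_Cmp:
  assumes "b \<le> b'" "b' \<le> b''" "a \<le> a'" "a' \<le> a''"
  shows "Cmp C (path b a b' a') (path b' a' b'' a'') = path b a b'' a''"
proof -
  define i j k l where ijkl: "i = nat (b' - b)" "j = nat (a' - a)" "k = nat (b'' - b')" "l = nat (a'' - a')"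
  have eq: "b' = b + int i" "a' = a + int j" "b'' = b + int i + int k" "a'' = a + int j + int l"
    using assms by (simp_all add: ijkl)
  note M = Rp_Mor[of i b a] Vp_Mor[of j "b + int i" a] Rp_Mor[of k "b + int i" "a + int j"] Vp_Mor[of l "b + int i + int k" "a + int j"]
    Rp_Mor[of k "b + int i" a] Vp_Mor[of j "b + int i + int k" a]
  note c = Cmp_closed[OF Ob Ob Ob]
  have "Cmp C (Cmp C (Rp i b a) (Vp j b' a)) (Cmp C (Rp k b' a') (Vp l b'' a')) =
    Cmp C (Rp i b a) (Cmp C (Cmp C (Vp j b' a) (Rp k b' a')) (Vp l b'' a'))"
    unfolding eq
    using Cmp_assoc[OF Ob Ob Ob Ob M(1,2) c[OF M(3,4)]] Cmp_assoc[OF Ob Ob Ob Ob M(2,3,4)] by simp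
  also have "Cmp C (Vp j b' a) (Rp k b' a') = Cmp C (Rp k b' a) (Vp j b'' a)"
    unfolding eq by (rule Rp_Vp[symmetric])
  also have "Cmp C (Rp i b a) (Cmp C (Cmp C (Rp k b' a) (Vp j b'' a)) (Vp l b'' a')) =
    Cmp C (Cmp C (Rp i b a) (Rp k b' a)) (Cmp C (Vp j b'' a) (Vp l b'' a'))"
    unfolding eq
    using Cmp_assoc[OF Ob Ob Ob Ob M(1,5) c[OF M(6,4)]] Cmp_assoc[OF Ob Ob Ob Ob M(5,6,4)] by simp
  also have "\<dots> = Cmp C (Rp (i + k) b a) (Vp (j + l) b'' a)"
    unfolding eq Rp_add Vp_add ..
  finally have "Cmp C (path b a b' a') (path b' a' b'' a'') = Cmp C (Rp (i + k) b a) (Vp (j + l) b'' a)"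
    by (simp add: path_def ijkl)
  moreover have "i + k = nat (b'' - b)" "j + l = nat (a'' - a)" using assms by (simp_all add: ijkl)
  ultimately show ?thesis by (simp add: path_def)
qed

lemma path_R: "b \<le> b' \<Longrightarrow> path b a b' a = Rp (nat (b' - b)) b a"
  using Idn_right[OF Ob Ob Rp_Mor, of "nat (b' - b)" b a] by (simp add: path_def)

lemma path_V: "a \<le> a' \<Longrightarrow> path b a b a' = Vp (nat (a' - a)) b a"
  using Idn_left[OF Ob Ob Vp_Mor, of b a "nat (a' - a)"] by (simp add: path_def)

end

text \<open>The bijection \<open>i\<^sup>+\<^sup>z \<mapsto> 4 z + i\<close> between the symbols with \<open>n = 3\<close> and the integers.\<close>

definition sym_int :: "sym \<Rightarrow> int" where
  "sym_int \<alpha> = 4 * snd \<alpha> + int (fst \<alpha>)"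

definition int_sym :: "int \<Rightarrow> sym" where
  "int_sym x = (nat (x mod 4), x div 4)"

lemma sym_int_int_sym [simp]: "sym_int (int_sym x) = x"
  by (simp add: sym_int_def int_sym_def)

lemma int_sym_sym_int [simp]: "\<alpha> \<in> Dbar 3 \<Longrightarrow> int_sym (sym_int \<alpha>) = \<alpha>"
  by (cases \<alpha>) (simp add: sym_int_def int_sym_def Dbar_def mod_pos_pos_trivial div_pos_pos_trivial)

lemma int_sym_Dbar [simp]: "int_sym x \<in> Dbar 3"
  using pos_mod_bound[of 4 x] by (simp add: int_sym_def Dbar_def)

lemma sym_le_iff: "\<alpha> \<in> Dbar 3 \<Longrightarrow> \<beta> \<in> Dbar 3 \<Longrightarrow> \<alpha> \<preceq> \<beta> \<longleftrightarrow> sym_int \<alpha> \<le> sym_int \<beta>"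
  by (auto simp: sym_le_def sym_int_def Dbar_def)

lemma sym_int_shift [simp]: "sym_int (sym_shift w \<alpha>) = sym_int \<alpha> + 4 * w"
  by (simp add: sym_int_def sym_shift_def)

lemma int_sym_shift: "sym_shift w (int_sym x) = int_sym (x + 4 * w)"
  by (simp add: int_sym_def sym_shift_def)

lemma sym_shift_Dbar [simp]: "sym_shift w \<alpha> \<in> Dbar n \<longleftrightarrow> \<alpha> \<in> Dbar n"
  by (simp add: sym_shift_def Dbar_def)

lemma strip_iff: "(\<beta>, \<alpha>) \<in> strip 3 \<longleftrightarrow> \<alpha> \<in> Dbar 3 \<and> \<beta> \<in> Dbar 3 \<and> sym_int \<alpha> \<le> sym_int \<beta> \<and> sym_int \<beta> \<le> sym_int \<alpha> + 4"
  by (auto simp: strip_def sym_le_iff)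

definition int_pt :: "int \<Rightarrow> int \<Rightarrow> pt" where
  "int_pt b a = (int_sym b, int_sym a)"

lemma int_pt_strip: "int_pt b a \<in> strip 3 \<longleftrightarrow> a \<le> b \<and> b \<le> a + 4"
  by (simp add: int_pt_def strip_iff)

lemma strip_cases:
  assumes "u \<in> strip 3"
  obtains b a where "u = int_pt b a" "a \<le> b" "b \<le> a + 4"
proof -
  obtain \<beta> \<alpha> where u: "u = (\<beta>, \<alpha>)" by (cases u)
  then show thesis using that[of "sym_int \<beta>" "sym_int \<alpha>"] assms by (simp add: strip_iff int_pt_def)
qed

lemma int_pt_le: "int_pt b a \<sqsubseteq> int_pt b' a' \<longleftrightarrow> b \<le> b' \<and> a \<le> a'"
  by (simp add: int_pt_def pt_le_def sym_le_iff)

lemma int_pt_shift: "pt_shift (int_pt b a) = int_pt (a + 4) b"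
  by (simp add: int_pt_def pt_shift_def int_sym_shift)

lemma is_functor_int:
  "is_functor C 3 X \<longleftrightarrow>
    (\<forall>a b. a \<le> b \<and> b \<le> a + 4 \<longrightarrow> DO X (int_pt b a) \<in> Obj C \<and> DM X (int_pt b a) (int_pt b a) = Idn C (DO X (int_pt b a))) \<and>
    (\<forall>a b a' b'. a \<le> b \<and> b \<le> a + 4 \<and> a' \<le> b' \<and> b' \<le> a' + 4 \<and> a \<le> a' \<and> b \<le> b' \<longrightarrow>
      DM X (int_pt b a) (int_pt b' a') \<in> Mor C (DO X (int_pt b a)) (DO X (int_pt b' a'))) \<and>
    (\<forall>a b a' b' a'' b''. a \<le> b \<and> b \<le> a + 4 \<and> a' \<le> b' \<and> b' \<le> a' + 4 \<and> a'' \<le> b'' \<and> b'' \<le> a'' + 4 \<and>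
        a \<le> a' \<and> b \<le> b' \<and> a' \<le> a'' \<and> b' \<le> b'' \<longrightarrow>
      Cmp C (DM X (int_pt b a) (int_pt b' a')) (DM X (int_pt b' a') (int_pt b'' a'')) = DM X (int_pt b a) (int_pt b'' a''))"
  (is "?L \<longleftrightarrow> ?A \<and> ?B \<and> ?C")
proof
  assume ?L
  then show "?A \<and> ?B \<and> ?C" by (auto simp: is_functor_def int_pt_strip int_pt_le)
next
  assume R: "?A \<and> ?B \<and> ?C"
  show ?L
    unfolding is_functor_def
  proof (intro conjI ballI impI)
    fix u assume u: "u \<in> strip 3"
    show "DO X u \<in> Obj C" "DM X u u = Idn C (DO X u)" using R u by (auto elim!: strip_cases)
    fix v assume v: "v \<in> strip 3"
    show "DM X u v \<in> Mor C (DO X u) (DO X v)" if "u \<sqsubseteq> v" using R u v that by (auto elim!: strip_cases simp: int_pt_le)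
    fix w assume w: "w \<in> strip 3"
    show "Cmp C (DM X u v) (DM X v w) = DM X u w" if "u \<sqsubseteq> v \<and> v \<sqsubseteq> w" using R u v w that by (auto elim!: strip_cases simp: int_pt_le)
  qed
qed

lemma periodic_int:
  "periodic C 3 X \<longleftrightarrow>
    (\<forall>a b. a \<le> b \<and> b \<le> a + 4 \<longrightarrow> DO X (int_pt (a + 4) b) = ShO C (DO X (int_pt b a))) \<and>
    (\<forall>a b a' b'. a \<le> b \<and> b \<le> a + 4 \<and> a' \<le> b' \<and> b' \<le> a' + 4 \<and> a \<le> a' \<and> b \<le> b' \<longrightarrow>
      DM X (int_pt (a + 4) b) (int_pt (a' + 4) b') = ShM C (DM X (int_pt b a) (int_pt b' a')))"
  (is "?L \<longleftrightarrow> ?A \<and> ?B")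
proof
  assume L: ?L
  show "?A \<and> ?B"
  proof (intro conjI allI impI)
    fix a b a' b' :: int
    show "DO X (int_pt (a + 4) b) = ShO C (DO X (int_pt b a))" if "a \<le> b \<and> b \<le> a + 4"
      using L that by (auto simp: periodic_def int_pt_strip simp flip: int_pt_shift)
    show "DM X (int_pt (a + 4) b) (int_pt (a' + 4) b') = ShM C (DM X (int_pt b a) (int_pt b' a'))"
      if "a \<le> b \<and> b \<le> a + 4 \<and> a' \<le> b' \<and> b' \<le> a' + 4 \<and> a \<le> a' \<and> b \<le> b'"
      using L that by (auto simp: periodic_def int_pt_strip int_pt_le simp flip: int_pt_shift)
  qed
next
  assume R: "?A \<and> ?B"
  show ?L
    unfolding periodic_def
  proof (intro conjI ballI impI)
    fix u assume u: "u \<in> strip 3"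
    show "DO X (pt_shift u) = ShO C (DO X u)" using R u by (auto elim!: strip_cases simp: int_pt_shift)
    fix v assume v: "v \<in> strip 3"
    show "DM X (pt_shift u) (pt_shift v) = ShM C (DM X u v)" if "u \<sqsubseteq> v" using R u v that by (auto elim!: strip_cases simp: int_pt_le int_pt_shift)
  qed
qed

lemma pretriangle_intI:
  assumes F: "is_functor C 3 X"
    and Z: "\<And>a. zero_object C (DO X (int_pt a a)) \<and> zero_object C (DO X (int_pt (a + 4) a))"
    and S: "\<And>a b c d. a \<le> b \<and> b \<le> c \<and> c \<le> d \<and> d \<le> a + 4 \<Longrightarrow>
      weak_square C (DO X (int_pt c a)) (DO X (int_pt d a)) (DO X (int_pt c b)) (DO X (int_pt d b))
        (DM X (int_pt c a) (int_pt d a)) (DM X (int_pt c a) (int_pt c b))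
        (DM X (int_pt d a) (int_pt d b)) (DM X (int_pt c b) (int_pt d b))"
  shows "pretriangle C 3 X"
  unfolding pretriangle_def
proof (intro conjI ballI impI F)
  fix \<alpha> assume \<alpha>: "\<alpha> \<in> Dbar 3"
  define a where "a = sym_int \<alpha>"
  have a: "\<alpha> = int_sym a" using \<alpha> by (simp add: a_def)
  show "zero_object C (DO X (\<alpha>, \<alpha>))" "zero_object C (DO X (sym_shift 1 \<alpha>, \<alpha>))"
    using Z unfolding a int_sym_shift int_pt_def by simp_all
  fix \<beta> \<gamma> \<delta>
  assume D: "\<beta> \<in> Dbar 3" "\<gamma> \<in> Dbar 3" "\<delta> \<in> Dbar 3"
    and le: "sym_shift (-1) \<delta> \<preceq> \<alpha> \<and> \<alpha> \<preceq> \<beta> \<and> \<beta> \<preceq> \<gamma> \<and> \<gamma> \<preceq> \<delta> \<and> \<delta> \<preceq> sym_shift 1 \<alpha>"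
  define b c d where bcd: "b = sym_int \<beta>" "c = sym_int \<gamma>" "d = sym_int \<delta>"
  have eq: "\<beta> = int_sym b" "\<gamma> = int_sym c" "\<delta> = int_sym d" using D by (simp_all add: bcd)
  have "a \<le> b \<and> b \<le> c \<and> c \<le> d \<and> d \<le> a + 4" using le D \<alpha> by (simp add: a_def bcd sym_le_iff)
  then show "weak_square C (DO X (\<gamma>, \<alpha>)) (DO X (\<delta>, \<alpha>)) (DO X (\<gamma>, \<beta>)) (DO X (\<delta>, \<beta>))
        (DM X (\<gamma>, \<alpha>) (\<delta>, \<alpha>)) (DM X (\<gamma>, \<alpha>) (\<gamma>, \<beta>))
        (DM X (\<delta>, \<alpha>) (\<delta>, \<beta>)) (DM X (\<gamma>, \<beta>) (\<delta>, \<beta>))"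
    using S unfolding a eq int_pt_def by blast
qed

section \<open>Pullback along periodic monotone maps\<close>

lemma periodic_monotone_shift_neg:
  assumes "periodic_monotone k n d" "\<alpha> \<in> Dbar k"
  shows "d (sym_shift (-1) \<alpha>) = sym_shift (-1) (d \<alpha>)"
proof -
  have "d (sym_shift 1 (sym_shift (-1) \<alpha>)) = sym_shift 1 (d (sym_shift (-1) \<alpha>))"
    using assms by (simp add: periodic_monotone_def)
  then show ?thesis by (simp add: sym_shift_def prod_eq_iff)
qed

lemma pullback_strip:
  assumes d: "periodic_monotone k n d" and u: "u \<in> strip k"
  shows "map_prod d d u \<in> strip n"
proof -
  obtain \<beta> \<alpha> where ba: "u = (\<beta>, \<alpha>)" by (cases u)
  have D: "\<alpha> \<in> Dbar k" "\<beta> \<in> Dbar k" "sym_shift (-1) \<beta> \<preceq> \<alpha>" "\<alpha> \<preceq> \<beta>" "\<beta> \<preceq> sym_shift 1 \<alpha>"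
    using u by (auto simp: ba strip_def)
  have "d (sym_shift (-1) \<beta>) \<preceq> d \<alpha>" "d \<alpha> \<preceq> d \<beta>" "d \<alpha> \<in> Dbar n" "d \<beta> \<in> Dbar n"
    using d D unfolding periodic_monotone_def by auto
  moreover have "d \<beta> \<preceq> d (sym_shift 1 \<alpha>)"
    using d D sym_shift_Dbar[of 1 \<alpha> k] unfolding periodic_monotone_def by blast
  ultimately show ?thesis
    using d D periodic_monotone_shift_neg[OF d D(2)] by (simp add: ba strip_def periodic_monotone_def)
qed

lemma pullback_le:
  assumes d: "periodic_monotone k n d" and "u \<in> strip k" "v \<in> strip k" "u \<sqsubseteq> v"
  shows "map_prod d d u \<sqsubseteq> map_prod d d v"
  using assms by (auto simp: pt_le_def strip_def periodic_monotone_def)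

lemma pullback_pretriangle:
  assumes d: "periodic_monotone k n d" and X: "pretriangle C n X"
  shows "pretriangle C k (pullback_diagram X d)"
  unfolding pretriangle_def
proof (intro conjI ballI impI)
  have F: "is_functor C n X" using X by (simp add: pretriangle_def)
  show "is_functor C k (pullback_diagram X d)"
    using F pullback_strip[OF d] pullback_le[OF d] unfolding is_functor_def pullback_diagram_def by simp
  fix \<alpha> assume \<alpha>: "\<alpha> \<in> Dbar k"
  then have d\<alpha>: "d \<alpha> \<in> Dbar n" "d (sym_shift 1 \<alpha>) = sym_shift 1 (d \<alpha>)" using d by (auto simp: periodic_monotone_def)
  then show "zero_object C (DO (pullback_diagram X d) (\<alpha>, \<alpha>))" "zero_object C (DO (pullback_diagram X d) (sym_shift 1 \<alpha>, \<alpha>))"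
    using X by (simp_all add: pretriangle_def pullback_diagram_def)
  fix \<beta> \<gamma> \<delta>
  assume D: "\<beta> \<in> Dbar k" "\<gamma> \<in> Dbar k" "\<delta> \<in> Dbar k"
    and le: "sym_shift (-1) \<delta> \<preceq> \<alpha> \<and> \<alpha> \<preceq> \<beta> \<and> \<beta> \<preceq> \<gamma> \<and> \<gamma> \<preceq> \<delta> \<and> \<delta> \<preceq> sym_shift 1 \<alpha>"
  have "d (sym_shift (-1) \<delta>) \<preceq> d \<alpha>" "d \<alpha> \<preceq> d \<beta>" "d \<beta> \<preceq> d \<gamma>" "d \<gamma> \<preceq> d \<delta>" 
    "d \<beta> \<in> Dbar n" "d \<gamma> \<in> Dbar n" "d \<delta> \<in> Dbar n"
    using d D \<alpha> le unfolding periodic_monotone_def by auto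
  moreover have "d \<delta> \<preceq> d (sym_shift 1 \<alpha>)"
    using d D(3) le sym_shift_Dbar[of 1 \<alpha> k] \<alpha> unfolding periodic_monotone_def by blast
  ultimately show "weak_square C (DO (pullback_diagram X d) (\<gamma>, \<alpha>)) (DO (pullback_diagram X d) (\<delta>, \<alpha>))
      (DO (pullback_diagram X d) (\<gamma>, \<beta>)) (DO (pullback_diagram X d) (\<delta>, \<beta>))
      (DM (pullback_diagram X d) (\<gamma>, \<alpha>) (\<delta>, \<alpha>)) (DM (pullback_diagram X d) (\<gamma>, \<alpha>) (\<gamma>, \<beta>))
      (DM (pullback_diagram X d) (\<delta>, \<alpha>) (\<delta>, \<beta>)) (DM (pullback_diagram X d) (\<gamma>, \<beta>) (\<delta>, \<beta>))"
    using X d\<alpha> periodic_monotone_shift_neg[OF d D(3)] unfolding pretriangle_def pullback_diagram_def by simp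
qed

lemma pullback_periodic:
  assumes d: "periodic_monotone k n d" and X: "periodic C n X"
  shows "periodic C k (pullback_diagram X d)"
proof -
  have "map_prod d d (pt_shift u) = pt_shift (map_prod d d u)" if "u \<in> strip k" for u
    using that d by (auto simp: pt_shift_def periodic_monotone_def strip_def)
  then show ?thesis
    using X pullback_strip[OF d] pullback_le[OF d] unfolding periodic_def pullback_diagram_def by simp
qed

section \<open>The two octahedra\<close>

locale octahedron = primary_modules p 6 for p :: nat +
  fixes t :: int
begin

lemma valid_lists: "valid []" "valid [3]" "valid [1, 5]" "valid [2, 4]" "valid [3, 6]" "valid [1, 5, 6]" "valid [2, 4, 6]"
  by (simp_all add: valid_def)

text \<open>\<open>P'\<close> and \<open>Q'\<close> are the shifts of \<open>P\<close> and \<open>Q\<close>.\<close>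

abbreviation "P \<equiv> [[q, 0], [t, 1]]"
abbreviation "Q \<equiv> [[1, 0], [- t, q]]"
abbreviation "P' \<equiv> [[q, t * q ^ 3], [0, 1]]"
abbreviation "Q' \<equiv> [[1, - (t * q ^ 3)], [0, q]]"

section \<open>Identities between the matrices\<close>

lemma adm_mats:
  "adm [3] [3] [[q]]" "adm [3] [1, 5] [[1, q ^ 2]]" "adm [3] [2, 4] [[1, q]]"
  "adm [1, 5] [2, 4] P" "adm [2, 4] [1, 5] Q" "adm [1, 5] [2, 4] P'" "adm [2, 4] [1, 5] Q'"
  "adm [2, 4] [3] [[- q], [1]]" "adm [1, 5] [3] [[- (q ^ 2)], [1]]" "adm [2, 4] [3] [[q], [- 1]]" "adm [1, 5] [3] [[q ^ 2], [- 1]]"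
  by (auto simp: adm_def less_Suc_eq numeral_eq_Suc)

text \<open>With \<open>marr_square_right\<close>, the two ways around the unit square at
  \<open>b - a = 2\<close> for \<open>a mod 4\<close> equal to 0, 1, 2, 3. The products contain
  additional terms in \<open>t\<close>, but these are divisible by the power of \<open>q\<close> at
  which an entry vanishes stably, so every integer \<open>t\<close> is possible.\<close>

lemma marr_square_left:
  "Cmp C (marr [3] [3] [[q]]) (marr [3] [2, 4] [[1, q]]) = marr [3] [2, 4] [[q, q ^ 2]]"
  "Cmp C (marr [2, 4] [3] [[- q], [1]]) (marr [3] [3] [[q]]) = marr [2, 4] [3] [[- (q ^ 2)], [q]]"
  "Cmp C (marr [3] [1, 5] [[1, q ^ 2]]) (marr [1, 5] [2, 4] P') = marr [3] [2, 4] [[q, q ^ 2]]"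
  "Cmp C (marr [2, 4] [1, 5] Q') (marr [1, 5] [3] [[q ^ 2], [- 1]]) = marr [2, 4] [3] [[q ^ 2], [- q]]"
  by (rule marr_Cmp; (rule valid_lists)?;
    auto simp: adm_def less_Suc_eq numeral_eq_Suc algebra_simps)+

lemma marr_square_right:
  "Cmp C (marr [3] [1, 5] [[1, q ^ 2]]) (marr [1, 5] [2, 4] P) = marr [3] [2, 4] [[q, q ^ 2]]"
  "Cmp C (marr [2, 4] [1, 5] Q) (marr [1, 5] [3] [[- (q ^ 2)], [1]]) = marr [2, 4] [3] [[- (q ^ 2)], [q]]"
  "Cmp C (marr [3] [3] [[q]]) (marr [3] [2, 4] [[1, q]]) = marr [3] [2, 4] [[q, q ^ 2]]"
  "Cmp C (marr [2, 4] [3] [[q], [- 1]]) (marr [3] [3] [[q]]) = marr [2, 4] [3] [[q ^ 2], [- q]]"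
  by (rule marr_Cmp; (rule valid_lists)?;
    auto simp: adm_def less_Suc_eq numeral_eq_Suc algebra_simps)+

text \<open>The horizontal double steps starting at \<open>b - a = 1\<close>, in the order of
  \<open>a mod 4\<close>; with the vertical ones in \<open>marr_VV\<close> they are the longer edges
  of the triangles.\<close>

lemma marr_RR:
  "Cmp C (marr [3] [3] [[q]]) (marr [3] [3] [[q]]) = marr [3] [3] [[q ^ 2]]"
  "Cmp C (marr [1, 5] [2, 4] P) (marr [2, 4] [3] [[- q], [1]]) = marr [1, 5] [3] [[- (q ^ 2)], [1]]"
  "Cmp C (marr [1, 5] [3] [[- (q ^ 2)], [1]]) (marr [3] [1, 5] [[1, q ^ 2]]) = marr [1, 5] [1, 5] [[0, - (q ^ 4)], [1, 0]]"
  "Cmp C (marr [3] [2, 4] [[1, q]]) (marr [2, 4] [1, 5] Q') = marr [3] [1, 5] [[1, q ^ 2]]"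
  by (rule marr_Cmp; (rule valid_lists)?;
    auto simp: adm_def less_Suc_eq numeral_eq_Suc algebra_simps)+

lemma marr_VV:
  "Cmp C (marr [3] [2, 4] [[1, q]]) (marr [2, 4] [1, 5] Q) = marr [3] [1, 5] [[1, q ^ 2]]"
  "Cmp C (marr [3] [3] [[q]]) (marr [3] [3] [[q]]) = marr [3] [3] [[q ^ 2]]"
  "Cmp C (marr [1, 5] [2, 4] P') (marr [2, 4] [3] [[q], [- 1]]) = marr [1, 5] [3] [[q ^ 2], [- 1]]"
  "Cmp C (marr [1, 5] [3] [[q ^ 2], [- 1]]) (marr [3] [1, 5] [[1, q ^ 2]]) = marr [1, 5] [1, 5] [[0, q ^ 4], [- 1, 0]]"
  by (rule marr_Cmp; (rule valid_lists)?;
    auto simp: adm_def less_Suc_eq numeral_eq_Suc algebra_simps)+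

text \<open>Unit squares next to the diagonal, where the other way around passes through the zero
  object at \<open>(a + 1, a + 1)\<close>. In \<open>marr_V_R_zero\<close> the zero object is that
  at \<open>(a + 4, a)\<close>.\<close>

lemma marr_R_V_zero:
  "Cmp C (marr [3] [3] [[q]]) (marr [3] [1, 5] [[1, q ^ 2]]) = Zer C (dsum 6 [3]) (dsum 6 [1, 5])"
  "Cmp C (marr [1, 5] [2, 4] P) (marr [2, 4] [1, 5] Q) = Zer C (dsum 6 [1, 5]) (dsum 6 [1, 5])"
  "Cmp C (marr [1, 5] [3] [[- (q ^ 2)], [1]]) (marr [3] [3] [[q]]) = Zer C (dsum 6 [1, 5]) (dsum 6 [3])"
  "Cmp C (marr [3] [2, 4] [[1, q]]) (marr [2, 4] [3] [[q], [- 1]]) = Zer C (dsum 6 [3]) (dsum 6 [3])"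
  by (subst marr_Zer; (rule valid_lists)?; rule marr_Cmp; (rule valid_lists)?;
    auto simp: adm_def less_Suc_eq numeral_eq_Suc algebra_simps)+

lemma marr_V_R_zero:
  "Cmp C (marr [3] [2, 4] [[1, q]]) (marr [2, 4] [3] [[- q], [1]]) = Zer C (dsum 6 [3]) (dsum 6 [3])"
  "Cmp C (marr [3] [3] [[q]]) (marr [3] [1, 5] [[1, q ^ 2]]) = Zer C (dsum 6 [3]) (dsum 6 [1, 5])"
  "Cmp C (marr [1, 5] [2, 4] P') (marr [2, 4] [1, 5] Q') = Zer C (dsum 6 [1, 5]) (dsum 6 [1, 5])"
  "Cmp C (marr [1, 5] [3] [[q ^ 2], [- 1]]) (marr [3] [3] [[q]]) = Zer C (dsum 6 [1, 5]) (dsum 6 [3])"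
  by (subst marr_Zer; (rule valid_lists)?; rule marr_Cmp; (rule valid_lists)?;
    auto simp: adm_def less_Suc_eq numeral_eq_Suc algebra_simps)+

text \<open>Ordered by \<open>b - a = 1\<close> and then \<open>b - a = 2\<close>, each time with
  \<open>a mod 4\<close> from 0 to 3, hence the repeated entry. \<open>marr_shift_V\<close> proceeds
  likewise with differences 2 and 3.\<close>

lemma marr_shift_R:
  "stable_shift p 6 (marr [3] [3] [[q]]) = marr [3] [3] [[q]]"
  "stable_shift p 6 (marr [1, 5] [2, 4] P) = marr [1, 5] [2, 4] P'"
  "stable_shift p 6 (marr [1, 5] [3] [[- (q ^ 2)], [1]]) = marr [1, 5] [3] [[q ^ 2], [- 1]]"
  "stable_shift p 6 (marr [3] [2, 4] [[1, q]]) = marr [3] [2, 4] [[1, q]]"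
  "stable_shift p 6 (marr [3] [3] [[q]]) = marr [3] [3] [[q]]"
  "stable_shift p 6 (marr [2, 4] [3] [[- q], [1]]) = marr [2, 4] [3] [[q], [- 1]]"
  "stable_shift p 6 (marr [3] [1, 5] [[1, q ^ 2]]) = marr [3] [1, 5] [[1, q ^ 2]]"
  "stable_shift p 6 (marr [2, 4] [1, 5] Q') = marr [2, 4] [1, 5] Q"
  by (rule marr_shift[THEN trans]; (rule valid_lists)?;
    auto simp: adm_def less_Suc_eq numeral_eq_Suc algebra_simps)+

lemma marr_shift_V:
  "stable_shift p 6 (marr [3] [1, 5] [[1, q ^ 2]]) = marr [3] [1, 5] [[1, q ^ 2]]"
  "stable_shift p 6 (marr [2, 4] [1, 5] Q) = marr [2, 4] [1, 5] Q'"
  "stable_shift p 6 (marr [3] [3] [[q]]) = marr [3] [3] [[q]]"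
  "stable_shift p 6 (marr [2, 4] [3] [[q], [- 1]]) = marr [2, 4] [3] [[- q], [1]]"
  "stable_shift p 6 (marr [3] [2, 4] [[1, q]]) = marr [3] [2, 4] [[1, q]]"
  "stable_shift p 6 (marr [3] [3] [[q]]) = marr [3] [3] [[q]]"
  "stable_shift p 6 (marr [1, 5] [2, 4] P') = marr [1, 5] [2, 4] P"
  "stable_shift p 6 (marr [1, 5] [3] [[q ^ 2], [- 1]]) = marr [1, 5] [3] [[- (q ^ 2)], [1]]"
  by (rule marr_shift[THEN trans]; (rule valid_lists)?;
    auto simp: adm_def less_Suc_eq numeral_eq_Suc algebra_simps)+

text \<open>Primes count rotations by two steps: \<open>(f, g, h)\<close> becomes \<open>(h, f[1], g[1])\<close>.\<close>

lemma dist_1: "stable_dist p 6 (marr [3] [3] [[q]]) (marr [3] [1, 5] [[1, q ^ 2]]) (marr [1, 5] [3] [[- (q ^ 2)], [1]])"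
  \<comment> \<open>\<open>marr_dist\<close> yields the target of the third morphism as a computed
    list of exponents; \<open>back_subst\<close> leaves its evaluation as a separate equation. The
    rows of \<open>Y\<close> and \<open>Z\<close> express the generators of the pushout through the
    middle term and \<open>bs\<close>.\<close>
  by (rule marr_dist[where as = "[3]" and cs = "[1, 5]" and G = "[[1, q ^ 2]]" and H = "[[- (q ^ 2)], [1]]" and N = "[[0, 1]]"
    and Y = "[[- (q ^ 2)], [1]]" and Z = "[[1], [0]]" and W = "[[1, 0], [0, 1]]" and W' = "[[1, 0], [0, 1]]",
    THEN back_subst[where P = "stable_dist p 6 _ _"]]; (rule valid_lists)?;
    auto simp: adm_def less_Suc_eq numeral_eq_Suc algebra_simps)

text \<open>As in \<open>dist_1\<close>, the exponents balance without a free summand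
  (\<open>3 + 6 = 6 + 3\<close>): the pushout is the cone itself, and \<open>W\<close>,
  \<open>W'\<close> are identities.\<close>

lemma dist_2: "stable_dist p 6 (marr [3] [3] [[q ^ 2]]) (marr [3] [2, 4] [[1, q]]) (marr [2, 4] [3] [[- q], [1]])"
  by (rule marr_dist[where as = "[3]" and cs = "[2, 4]" and G = "[[1, q]]" and H = "[[- q], [1]]" and N = "[[0, 1]]"
    and Y = "[[- q], [1]]" and Z = "[[1], [0]]" and W = "[[1, 0], [0, 1]]" and W' = "[[1, 0], [0, 1]]",
    THEN back_subst[where P = "stable_dist p 6 _ _"]]; (rule valid_lists)?;
    auto simp: adm_def less_Suc_eq numeral_eq_Suc algebra_simps)

text \<open>The exponents of the pushout add up to 12 and those of the cone to 6, so here, and in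
  all rotated triangles below, a free summand of exponent 6 has to be split off. The last column of
  \<open>G\<close> maps into it; it makes the composite with \<open>H\<close> vanish and is stably
  zero.\<close>

lemma dist_3: "stable_dist p 6 (marr [1, 5] [2, 4] P) (marr [2, 4] [1, 5] Q) (marr [1, 5] [1, 5] [[0, - (q ^ 4)], [1, 0]])"
  by (rule marr_dist[where as = "[1, 5]" and cs = "[1, 5, 6]" and G = "[[1, 0, q ^ 4], [- t, q, - (t * q ^ 4)]]" and H = "[[0, - (q ^ 4)], [1, 0], [0, 1]]" and N = "[[0, 0, 1], [0, 1, 0]]"
    and Y = "[[- (q ^ 4), 0], [0, 1], [1, 0]]" and Z = "[[1, 0], [0, 0], [0, 0]]" and W = "[[1, 0, 0], [0, 1, 0]]" and W' = "[[1, 0], [0, 1], [0, 0]]",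
    THEN back_subst[where P = "stable_dist p 6 _ _"]]; (rule valid_lists)?;
    auto simp: adm_def less_Suc_eq numeral_eq_Suc algebra_simps)

lemma dist_1': "stable_dist p 6 (marr [1, 5] [3] [[- (q ^ 2)], [1]]) (marr [3] [3] [[q]]) (marr [3] [1, 5] [[1, q ^ 2]])"
  by (rule marr_dist[where as = "[1, 5]" and cs = "[3, 6]" and G = "[[q, - (q ^ 3)]]" and H = "[[1, q ^ 2], [0, 1]]" and N = "[[0, 1], [1, - (q ^ 2)]]"
    and Y = "[[q ^ 2, 1], [1, 0]]" and Z = "[[0], [0]]" and W = "[[1, 0]]" and W' = "[[1], [0]]",
    THEN back_subst[where P = "stable_dist p 6 _ _"]]; (rule valid_lists)?;
    auto simp: adm_def less_Suc_eq numeral_eq_Suc algebra_simps)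

lemma dist_2': "stable_dist p 6 (marr [2, 4] [3] [[- q], [1]]) (marr [3] [3] [[q ^ 2]]) (marr [3] [2, 4] [[1, q]])"
  by (rule marr_dist[where as = "[2, 4]" and cs = "[3, 6]" and G = "[[q ^ 2, - (q ^ 3)]]" and H = "[[1, q], [0, 1]]" and N = "[[0, 1], [1, - q]]"
    and Y = "[[q, 1], [1, 0]]" and Z = "[[0], [0]]" and W = "[[1, 0]]" and W' = "[[1], [0]]",
    THEN back_subst[where P = "stable_dist p 6 _ _"]]; (rule valid_lists)?;
    auto simp: adm_def less_Suc_eq numeral_eq_Suc algebra_simps)

lemma dist_1'': "stable_dist p 6 (marr [3] [1, 5] [[1, q ^ 2]]) (marr [1, 5] [3] [[q ^ 2], [- 1]]) (marr [3] [3] [[q]])"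
  by (rule marr_dist[where as = "[3]" and cs = "[3, 6]" and G = "[[q ^ 2, 0], [- 1, q]]" and H = "[[q], [1]]" and N = "[[0, 1]]"
    and Y = "[[q], [1]]" and Z = "[[0, - 1], [0, 0]]" and W = "[[1, 0]]" and W' = "[[1], [0]]",
    THEN back_subst[where P = "stable_dist p 6 _ _"]]; (rule valid_lists)?;
    auto simp: adm_def less_Suc_eq numeral_eq_Suc algebra_simps)

lemma dist_2'': "stable_dist p 6 (marr [3] [2, 4] [[1, q]]) (marr [2, 4] [3] [[q], [- 1]]) (marr [3] [3] [[q ^ 2]])"
  by (rule marr_dist[where as = "[3]" and cs = "[3, 6]" and G = "[[q, 0], [- 1, q ^ 2]]" and H = "[[q ^ 2], [1]]" and N = "[[0, 1]]"
    and Y = "[[q ^ 2], [1]]" and Z = "[[0, - 1], [0, 0]]" and W = "[[1, 0]]" and W' = "[[1], [0]]",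
    THEN back_subst[where P = "stable_dist p 6 _ _"]]; (rule valid_lists)?;
    auto simp: adm_def less_Suc_eq numeral_eq_Suc algebra_simps)

lemma dist_3': "stable_dist p 6 (marr [1, 5] [1, 5] [[0, - (q ^ 4)], [1, 0]]) (marr [1, 5] [2, 4] P') (marr [2, 4] [1, 5] Q')"
  by (rule marr_dist[where as = "[1, 5]" and cs = "[2, 4, 6]" and G = "[[q, t * q ^ 3, 0], [0, 1, - q]]" and H = "[[1, - (t * q ^ 3)], [0, q], [0, 1]]" and N = "[[0, 0, 1], [1, t * q ^ 2, 0]]"
    and Y = "[[- (t * q ^ 3), 1], [q, 0], [1, 0]]" and Z = "[[0, - (t * q ^ 2)], [0, 1], [0, 0]]" and W = "[[1, 0, 0], [0, 1, 0]]" and W' = "[[1, 0], [0, 1], [0, 0]]",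
    THEN back_subst[where P = "stable_dist p 6 _ _"]]; (rule valid_lists)?;
    auto simp: adm_def less_Suc_eq numeral_eq_Suc algebra_simps)

lemma dist_3'': "stable_dist p 6 (marr [2, 4] [1, 5] Q') (marr [1, 5] [1, 5] [[0, q ^ 4], [- 1, 0]]) (marr [1, 5] [2, 4] P)"
  by (rule marr_dist[where as = "[2, 4]" and cs = "[1, 5, 6]" and G = "[[0, q ^ 4, 0], [- 1, 0, q]]" and H = "[[q, 0], [t, 1], [1, 0]]" and N = "[[0, 1, - t], [0, 0, 1]]"
    and Y = "[[0, q], [1, t], [0, 1]]" and Z = "[[0, - 1], [0, 0], [0, 0]]" and W = "[[1, 0, 0], [0, 1, 0]]" and W' = "[[1, 0], [0, 1], [0, 0]]",
    THEN back_subst[where P = "stable_dist p 6 _ _"]]; (rule valid_lists)?;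
    auto simp: adm_def less_Suc_eq numeral_eq_Suc algebra_simps)

text \<open>Here and at position 3 the given matrices commute between the modules: the surplus terms
  \<open>t * q ^ 2\<close> and \<open>t * q ^ 3\<close> vanish in the modules of exponent 2 and 3
  where they occur.\<close>

lemma weak_square_0: "weak_square C (dsum 6 [3]) (dsum 6 [3]) (dsum 6 [1, 5]) (dsum 6 [2, 4])
  (marr [3] [3] [[q]]) (marr [3] [1, 5] [[1, q ^ 2]]) (marr [3] [2, 4] [[1, q]]) (marr [1, 5] [2, 4] P)"
  by (rule marr_weak_square[where X = "[[0]]" and X' = "[[0], [1]]" and \<kappa> = "[2]"
    and Y = "[[1], [- t]]" and Z = "[[t, - q], [- (t * t), 1 + q * t]]"]; (rule valid_lists)?;
    auto simp: adm_def less_Suc_eq numeral_eq_Suc algebra_simps)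

text \<open>At positions \<open>1\<close> and \<open>2\<close> the given matrices commute only stably. Changing one of them within its stable
  class makes the square commute between the modules.\<close>

lemma weak_square_1_exact: "weak_square C (dsum 6 [2, 4]) (dsum 6 [3]) (dsum 6 [1, 5]) (dsum 6 [3])
  (marr [2, 4] [3] [[- q], [1]]) (marr [2, 4] [1, 5] Q) (marr [3] [3] [[q]]) (marr [1, 5] [3] [[- (q ^ 2)], [1 - t * q]])"
  by (rule marr_weak_square[where X = "[[- q, 0]]" and X' = "[[0, 0], [1, 1]]" and \<kappa> = "[2, 1]"
    and Y = "[[t]]" and Z = "[[0, 1]]"]; (rule valid_lists)?;
    auto simp: adm_def less_Suc_eq numeral_eq_Suc algebra_simps)

lemma weak_square_2_exact: "weak_square C (dsum 6 [3]) (dsum 6 [1, 5]) (dsum 6 [3]) (dsum 6 [2, 4])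
  (marr [3] [1, 5] [[1, q ^ 2 - t * q ^ 3]]) (marr [3] [3] [[q]]) (marr [1, 5] [2, 4] P') (marr [3] [2, 4] [[1, q]])"
  by (rule marr_weak_square[where X = "[[0], [1]]" and X' = "[[t * q ^ 2]]" and \<kappa> = "[2]"
    and Y = "[[0, - q], [0, 1]]" and Z = "[[1], [0]]"]; (rule valid_lists)?;
    auto simp: adm_def less_Suc_eq numeral_eq_Suc algebra_simps)

lemma weak_square_3: "weak_square C (dsum 6 [2, 4]) (dsum 6 [1, 5]) (dsum 6 [3]) (dsum 6 [3])
  (marr [2, 4] [1, 5] Q') (marr [2, 4] [3] [[q], [- 1]]) (marr [1, 5] [3] [[q ^ 2], [- 1]]) (marr [3] [3] [[q]])"
  \<comment> \<open>The terms with \<open>t\<close> in \<open>X\<close> and \<open>X'\<close> cancel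
    the contribution of the entry \<open>- (t * q ^ 3)\<close> of \<open>Q'\<close>.\<close>
  by (rule marr_weak_square[where X = "[[t * q ^ 3, t ^ 2 * q ^ 4], [1, 1 + t * q]]" and X' = "[[q, t * q ^ 2]]" and \<kappa> = "[2, 1]"
    and Y = "[[0, - 1]]" and Z = "[[0]]"]; (rule valid_lists)?;
    auto simp: adm_def less_Suc_eq numeral_eq_Suc algebra_simps)

lemma marr_reps:
  "marr [1, 5] [3] [[- (q ^ 2)], [1 - t * q]] = marr [1, 5] [3] [[- (q ^ 2)], [1]]"
  "marr [3] [1, 5] [[1, q ^ 2 - t * q ^ 3]] = marr [3] [1, 5] [[1, q ^ 2]]"
  by (rule marr_eqI; (rule valid_lists)?;
    auto simp: adm_def less_Suc_eq numeral_eq_Suc algebra_simps)+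

lemmas weak_square_1 = weak_square_1_exact[unfolded marr_reps]
lemmas weak_square_2 = weak_square_2_exact[unfolded marr_reps]


text \<open>Otherwise \<open>[1, 5]\<close> is rewritten to \<open>[Suc 0, 5]\<close>, which does not match the matrix facts.\<close>

declare One_nat_def [simp del]

text \<open>The point \<open>\<beta>/\<alpha>\<close> with integers \<open>b\<close>, \<open>a\<close> is described by \<open>k = b - a\<close> and \<open>r = a mod 4\<close>; \<open>R\<close> raises \<open>b\<close> and \<open>V\<close> raises \<open>a\<close>.\<close>

definition exps :: "int \<Rightarrow> int \<Rightarrow> nat list" where
  "exps k r = (if k = 1 then if r = 1 \<or> r = 2 then [1, 5] else [3]
     else if k = 2 then if r = 1 \<or> r = 3 then [2, 4] else [3]
     else if k = 3 then if r = 2 \<or> r = 3 then [1, 5] else [3]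
     else [])"

definition Ob :: "int \<Rightarrow> int \<Rightarrow> obj" where
  "Ob b a = dsum 6 (exps (b - a) (a mod 4))"

definition R :: "int \<Rightarrow> int \<Rightarrow> arr" where
  "R b a = (let k = b - a; r = a mod 4 in
     if k = 1 \<or> k = 2 then marr (exps k r) (exps (k + 1) r)
       (if k = 1 then if r = 0 then [[q]] else if r = 1 then P else if r = 2 then [[- (q ^ 2)], [1]] else [[1, q]]
        else if r = 0 then [[q]] else if r = 1 then [[- q], [1]] else if r = 2 then [[1, q ^ 2]] else Q')
     else Zer C (Ob b a) (Ob (b + 1) a))"

definition V :: "int \<Rightarrow> int \<Rightarrow> arr" where
  "V b a = (let k = b - a; r = a mod 4 in
     if k = 2 \<or> k = 3 then marr (exps k r) (exps (k - 1) ((a + 1) mod 4))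
       (if k = 2 then if r = 0 then [[1, q ^ 2]] else if r = 1 then Q else if r = 2 then [[q]] else [[q], [- 1]]
        else if r = 0 then [[1, q]] else if r = 1 then [[q]] else if r = 2 then P' else [[q ^ 2], [- 1]])
     else Zer C (Ob b a) (Ob b (a + 1)))"

section \<open>The model diagram on all pairs of integers\<close>

lemma residue_cases:
  fixes a :: int
  obtains z where "a = 4 * z" | z where "a = 4 * z + 1" | z where "a = 4 * z + 2" | z where "a = 4 * z + 3"
proof -
  have "\<exists>z. a = 4 * z \<or> a = 4 * z + 1 \<or> a = 4 * z + 2 \<or> a = 4 * z + 3" by presburger
  then show thesis using that by blast
qed

lemma Ob_E_obj [simp]: "Ob b a \<in> E_obj 6"
  by (simp add: Ob_def)

lemma R_V_zero: "b \<noteq> a + 1 \<Longrightarrow> b \<noteq> a + 2 \<Longrightarrow> R b a = Zer C (Ob b a) (Ob (b + 1) a)"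
  "b \<noteq> a + 2 \<Longrightarrow> b \<noteq> a + 3 \<Longrightarrow> V b a = Zer C (Ob b a) (Ob b (a + 1))"
  by (auto simp: R_def V_def Let_def)

lemma R_Mor: "R b a \<in> Mor C (Ob b a) (Ob (b + 1) a)"
proof (cases "b = a + 1 \<or> b = a + 2")
  case True
  then show ?thesis
    by (cases a rule: residue_cases) (auto simp: R_def Ob_def exps_def Let_def intro!: marr_Mor valid_lists adm_mats)
next
  case False
  then show ?thesis by (simp add: R_V_zero Zer_closed)
qed

lemma V_Mor: "V b a \<in> Mor C (Ob b a) (Ob b (a + 1))"
proof (cases "b = a + 2 \<or> b = a + 3")
  case True
  then show ?thesis
    by (cases a rule: residue_cases) (auto simp: V_def Ob_def exps_def Let_def intro!: marr_Mor valid_lists adm_mats)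
next
  case False
  then show ?thesis by (simp add: R_V_zero Zer_closed)
qed

text \<open>Only differences 1, 2, 3 require matrices. For 1 and 3 one way around meets a zero
  object, so the other composite has to vanish; for 2 both composites are computed.\<close>

lemma R_V_comm: "Cmp C (R b a) (V (b + 1) a) = Cmp C (V b a) (R b (a + 1))"
proof -
  have left0: "Cmp C (R b a) (V (b + 1) a) = Zer C (Ob b a) (Ob (b + 1) (a + 1))"
    if "R b a = Zer C (Ob b a) (Ob (b + 1) a) \<or> V (b + 1) a = Zer C (Ob (b + 1) a) (Ob (b + 1) (a + 1))"
    using that Zer_Cmp[OF _ _ _ V_Mor] Cmp_Zer[OF _ _ _ R_Mor] by auto
  have right0: "Cmp C (V b a) (R b (a + 1)) = Zer C (Ob b a) (Ob (b + 1) (a + 1))"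
    if "V b a = Zer C (Ob b a) (Ob b (a + 1)) \<or> R b (a + 1) = Zer C (Ob b (a + 1)) (Ob (b + 1) (a + 1))"
    using that Zer_Cmp[OF _ _ _ R_Mor] Cmp_Zer[OF _ _ _ V_Mor] by auto
  consider (1) "b = a + 1" | (2) "b = a + 2" | (3) "b = a + 3" | (4) "b \<noteq> a + 1" "b \<noteq> a + 2" "b \<noteq> a + 3" by blast
  then show ?thesis
  proof cases
    case 1
    then have "Cmp C (R b a) (V (b + 1) a) = Zer C (Ob b a) (Ob (b + 1) (a + 1))"
      by (cases a rule: residue_cases) (auto simp: R_def V_def Ob_def exps_def Let_def marr_R_V_zero)
    then show ?thesis using 1 right0 R_V_zero(2)[of b a] by simp
  next
    case 2
    then show ?thesis
      by (cases a rule: residue_cases) (auto simp: R_def V_def exps_def Let_def marr_square_left marr_square_right)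
  next
    case 3
    then have "Cmp C (V b a) (R b (a + 1)) = Zer C (Ob b a) (Ob (b + 1) (a + 1))"
      by (cases a rule: residue_cases) (auto simp: R_def V_def Ob_def exps_def Let_def marr_V_R_zero)
    then show ?thesis using 3 left0 R_V_zero(1)[of b a] by simp
  next
    case 4
    then show ?thesis using left0 right0 R_V_zero(1)[of b a] R_V_zero(2)[of b a] by simp
  qed
qed

sublocale grid C Ob R V
  by unfold_locales (simp_all add: R_Mor V_Mor R_V_comm)

lemma rev_dsum_lists: "rev (dsum 6 []) = dsum 6 []" "rev (dsum 6 [3]) = dsum 6 [3]"
  "rev (dsum 6 [1, 5]) = dsum 6 [1, 5]" "rev (dsum 6 [2, 4]) = dsum 6 [2, 4]"
  using rev_dsum[OF valid_lists(1)] rev_dsum[OF valid_lists(2)] rev_dsum[OF valid_lists(3)] rev_dsum[OF valid_lists(4)]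
  by (simp_all add: One_nat_def)

text \<open>Replacing each \<open>e\<close> by \<open>6 - e\<close> and reversing fixes all exponent
  lists that occur, so the shift fixes these objects. What is left is a symmetry of the table
  \<open>exps\<close>, with difference \<open>k\<close> going to \<open>4 - k\<close> and the
  residue of \<open>a\<close> to that of \<open>b\<close>.\<close>

lemma rev_Ob: "rev (Ob b a) = Ob (a + 4) b"
proof -
  consider (1) "b = a + 1" | (2) "b = a + 2" | (3) "b = a + 3" | (4) "b \<noteq> a + 1" "b \<noteq> a + 2" "b \<noteq> a + 3" by blast
  then show ?thesis
  proof cases
    case 4
    then show ?thesis by (simp add: Ob_def exps_def rev_dsum_lists)
  next
    case 1
    then show ?thesis by (cases a rule: residue_cases) (simp_all add: Ob_def exps_def rev_dsum_lists)
  next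
    case 2
    then show ?thesis by (cases a rule: residue_cases) (simp_all add: Ob_def exps_def rev_dsum_lists)
  next
    case 3
    then show ?thesis by (cases a rule: residue_cases) (simp_all add: Ob_def exps_def rev_dsum_lists)
  qed
qed

lemma shift_R: "stable_shift p 6 (R b a) = V (a + 4) b"
proof -
  consider (1) "b = a + 1" | (2) "b = a + 2" | (3) "b \<noteq> a + 1" "b \<noteq> a + 2" by blast
  then show ?thesis
  proof cases
    case 1
    then show ?thesis by (cases a rule: residue_cases) (simp_all add: R_def V_def exps_def Let_def marr_shift_R)
  next
    case 2
    then show ?thesis by (cases a rule: residue_cases) (simp_all add: R_def V_def exps_def Let_def marr_shift_R)
  next
    case 3
    have "V (a + 4) b = Zer C (Ob (a + 4) b) (Ob (a + 4) (b + 1))" using 3 by (intro R_V_zero) auto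
    then show ?thesis using R_V_zero(1)[OF 3] stable_shift_Zer[OF Ob_E_obj Ob_E_obj] by (simp add: rev_Ob)
  qed
qed

lemma shift_V: "stable_shift p 6 (V b a) = R (a + 4) b"
proof -
  consider (1) "b = a + 2" | (2) "b = a + 3" | (3) "b \<noteq> a + 2" "b \<noteq> a + 3" by blast
  then show ?thesis
  proof cases
    case 1
    then show ?thesis by (cases a rule: residue_cases) (simp_all add: R_def V_def exps_def Let_def marr_shift_V)
  next
    case 2
    then show ?thesis by (cases a rule: residue_cases) (simp_all add: R_def V_def exps_def Let_def marr_shift_V)
  next
    case 3
    have "R (a + 4) b = Zer C (Ob (a + 4) b) (Ob (a + 4 + 1) b)" using 3 by (intro R_V_zero) auto
    moreover have "a + 4 + 1 = a + 1 + 4" by simp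
    ultimately show ?thesis
      unfolding R_V_zero(2)[OF 3] stable_shift_Zer[OF Ob_E_obj Ob_E_obj] rev_Ob by simp
  qed
qed

lemma shift_Rp: "stable_shift p 6 (Rp n b a) = Vp n (a + 4) b"
proof (induction n)
  case 0
  show ?case by (simp add: stable_shift_Idn rev_Ob)
next
  case (Suc n)
  show ?case
    unfolding Rp.simps(2) Vp.simps(2) stable_shift_Cmp[OF Ob_E_obj Ob_E_obj Ob_E_obj Rp_Mor R_Mor] Suc shift_R ..
qed

lemma shift_Vp: "stable_shift p 6 (Vp n b a) = Rp n (a + 4) b"
proof (induction n)
  case 0
  show ?case by (simp add: stable_shift_Idn rev_Ob)
next
  case (Suc n)
  have "a + int n + 4 = a + 4 + int n" by simp
  then show ?case
    unfolding Rp.simps(2) Vp.simps(2) stable_shift_Cmp[OF Ob_E_obj Ob_E_obj Ob_E_obj Vp_Mor V_Mor] Suc shift_V by (simp only:)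
qed

text \<open>The shift exchanges horizontal and vertical steps, so the shifted path starts
  vertically; \<open>Rp_Vp\<close> restores the order used in \<open>path\<close>.\<close>

lemma shift_path:
  assumes "b \<le> b'" "a \<le> a'"
  shows "stable_shift p 6 (path b a b' a') = path (a + 4) b (a' + 4) b'"
proof -
  have b': "b' = b + int (nat (b' - b))" using assms by simp
  have "stable_shift p 6 (path b a b' a') = Cmp C (Vp (nat (b' - b)) (a + 4) b) (Rp (nat (a' - a)) (a + 4) b')"
    unfolding path_def using stable_shift_Cmp[OF Ob_E_obj Ob_E_obj Ob_E_obj Rp_Mor[of "nat (b' - b)" b a] Vp_Mor[of "nat (a' - a)" "b + int (nat (b' - b))" a]] b'
    by (simp add: shift_Rp shift_Vp)
  also have "\<dots> = path (a + 4) b (a' + 4) b'"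
    unfolding path_def using Rp_Vp[of "nat (a' - a)" "a + 4" b "nat (b' - b)"] assms by (simp add: ac_simps)
  finally show ?thesis .
qed

lemma zero_object_nil: "zero_object C (dsum 6 [])"
proof -
  have s: "summands (dsum 6 []) = []" using summands_valid[OF valid_lists(1)] by simp
  have "x \<in> K (dsum 6 []) \<longleftrightarrow> x = []" for x unfolding K_iff s by simp
  then have K: "K (dsum 6 []) = {[]}" by blast
  have z: "x = \<zero>\<^bsub>M (dsum 6 [])\<^esub>" if x: "x \<in> K (dsum 6 [])" for x
    using x zero_closed[of "dsum 6 []"] unfolding K by (metis singletonD)
  have "f = hzero (dsum 6 []) b" if f: "f \<in> Hom (dsum 6 []) b" for f b
  proof (rule Hom_ext[OF f hzero_Hom])
    fix x assume x: "x \<in> K (dsum 6 [])"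
    show "f x = hzero (dsum 6 []) b x" unfolding hzero_apply[OF x] using z[OF x] Hom_zero[OF f] by metis
  qed
  then have "F = Zer C (dsum 6 []) b" if "F \<in> Mor C (dsum 6 []) b" for F b
    using that unfolding Zer_cls by (elim Mor_cases) blast
  moreover have "f = hzero b (dsum 6 [])" if f: "f \<in> Hom b (dsum 6 [])" for f b
  proof (rule Hom_ext[OF f hzero_Hom])
    fix x assume x: "x \<in> K b"
    show "f x = hzero b (dsum 6 []) x" unfolding hzero_apply[OF x] using z[OF Hom_closed[OF f x]] .
  qed
  then have "F = Zer C b (dsum 6 [])" if "F \<in> Mor C b (dsum 6 [])" for F b
    using that unfolding Zer_cls by (elim Mor_cases) blast
  moreover have "Zer C a b \<in> Mor C a b" for a b unfolding Zer_cls by (simp add: cls_Mor)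
  ultimately show ?thesis unfolding zero_object_def by (metis dsum_E_obj stable_cat_simps(1))
qed

section \<open>Triangles and weak squares of the model\<close>

lemma Ob_zero: "Ob a a = dsum 6 []" "Ob (a + 4) a = dsum 6 []"
  by (simp_all add: Ob_def exps_def)

text \<open>The three shapes of a chain \<open>a < b < c < a + 4\<close> with four residues of
  \<open>a\<close> make twelve triangles; three pairs of them have equal matrices.\<close>

lemma dist_R_V:
  "stable_dist p 6 (R (a + 1) a) (V (a + 2) a) (Cmp C (R (a + 2) (a + 1)) (R (a + 3) (a + 1)))"
  "stable_dist p 6 (Cmp C (R (a + 1) a) (R (a + 2) a)) (V (a + 3) a) (R (a + 3) (a + 1))"
  "stable_dist p 6 (R (a + 2) a) (Cmp C (V (a + 3) a) (V (a + 3) (a + 1))) (R (a + 3) (a + 2))"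
proof -
  note dists = dist_1 dist_2 dist_3 dist_1' dist_2' dist_1'' dist_2'' dist_3' dist_3''
  show "stable_dist p 6 (R (a + 1) a) (V (a + 2) a) (Cmp C (R (a + 2) (a + 1)) (R (a + 3) (a + 1)))"
    by (cases a rule: residue_cases) (simp_all add: R_def V_def exps_def Let_def marr_RR marr_VV dists)
  show "stable_dist p 6 (Cmp C (R (a + 1) a) (R (a + 2) a)) (V (a + 3) a) (R (a + 3) (a + 1))"
    by (cases a rule: residue_cases) (simp_all add: R_def V_def exps_def Let_def marr_RR marr_VV dists)
  show "stable_dist p 6 (R (a + 2) a) (Cmp C (V (a + 3) a) (V (a + 3) (a + 1))) (R (a + 3) (a + 2))"
    by (cases a rule: residue_cases) (simp_all add: R_def V_def exps_def Let_def marr_RR marr_VV dists)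
qed

lemma dist_Rp_Vp:
  assumes "a < b" "b < c" "c < a + 4"
  shows "stable_dist p 6 (Rp (nat (c - b)) b a) (Vp (nat (b - a)) c a) (Rp (nat (a + 4 - c)) c b)"
proof -
  have RR: "Rp (Suc (Suc 0)) y x = Cmp C (R y x) (R (y + 1) x)" for x y
    using Rp_1[of y x] by (simp only: Rp.simps(2)[of "Suc 0"] int_Suc of_nat_0) simp
  have VV: "Vp (Suc (Suc 0)) y x = Cmp C (V y x) (V y (x + 1))" for x y
    using Vp_1[of y x] by (simp only: Vp.simps(2)[of "Suc 0"] int_Suc of_nat_0) simp
  have 3: "a + 2 + 1 = a + 3" "a + 1 + 1 = a + 2" by simp_all
  consider "b = a + 1" "c = a + 2" | "b = a + 1" "c = a + 3" | "b = a + 2" "c = a + 3" using assms by linarith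
  then show ?thesis
  proof cases
    case 1
    then have "nat (c - b) = Suc 0" "nat (b - a) = Suc 0" "nat (a + 4 - c) = Suc (Suc 0)" by simp_all
    then show ?thesis using dist_R_V(1)[of a] by (simp only: 1 Rp_1 Vp_1 RR VV 3)
  next
    case 2
    then have "nat (c - b) = Suc (Suc 0)" "nat (b - a) = Suc 0" "nat (a + 4 - c) = Suc 0" by simp_all
    then show ?thesis using dist_R_V(2)[of a] by (simp only: 2 Rp_1 Vp_1 RR VV 3)
  next
    case 3
    then have "nat (c - b) = Suc 0" "nat (b - a) = Suc (Suc 0)" "nat (a + 4 - c) = Suc 0" by simp_all
    then show ?thesis using dist_R_V(3)[of a] by (simp only: 3 Rp_1 Vp_1 RR VV)
  qed
qed

lemma exact_Rp_Vp:
  assumes abc: "a < b" "b < c" "c < a + 4"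
  shows "exact_pair (Ob b a) (Ob c a) (Ob c b) (Rp (nat (c - b)) b a) (Vp (nat (b - a)) c a)"
    "exact_pair (Ob c a) (Ob c b) (Ob (a + 4) b) (Vp (nat (b - a)) c a) (Rp (nat (a + 4 - c)) c b)"
proof -
  have M: "Rp (nat (c - b)) b a \<in> Mor C (Ob b a) (Ob c a)" "Vp (nat (b - a)) c a \<in> Mor C (Ob c a) (Ob c b)"
    "Rp (nat (a + 4 - c)) c b \<in> Mor C (Ob c b) (Ob (a + 4) b)"
    using Rp_Mor[of "nat (c - b)" b a] Vp_Mor[of "nat (b - a)" c a] Rp_Mor[of "nat (a + 4 - c)" c b] abc by simp_all
  show "exact_pair (Ob b a) (Ob c a) (Ob c b) (Rp (nat (c - b)) b a) (Vp (nat (b - a)) c a)"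
    "exact_pair (Ob c a) (Ob c b) (Ob (a + 4) b) (Vp (nat (b - a)) c a) (Rp (nat (a + 4 - c)) c b)"
    using stable_dist_exact[OF dist_Rp_Vp[OF abc] _ _ _ M[folded rev_Ob[of b a]]] by (simp_all add: rev_Ob)
qed

lemma weak_square_R_V:
  "weak_square C (Ob (a + 2) a) (Ob (a + 3) a) (Ob (a + 2) (a + 1)) (Ob (a + 3) (a + 1))
     (R (a + 2) a) (V (a + 2) a) (V (a + 3) a) (R (a + 2) (a + 1))"
  by (cases a rule: residue_cases)
    (simp_all add: Ob_def R_def V_def exps_def Let_def weak_square_0 weak_square_1 weak_square_2 weak_square_3)

text \<open>Only \<open>a < b < c < d < a + 4\<close> leaves a square without an identity edge or a
  zero corner, and these inequalities force all steps to be unit steps. The corner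
  \<open>(c, b)\<close> is zero for \<open>b = c\<close>, and \<open>(d, a)\<close> is zero for
  \<open>d = a + 4\<close>.\<close>

lemma weak_square_Rp_Vp:
  assumes "a \<le> b" "b \<le> c" "c \<le> d" "d \<le> a + 4"
  shows "weak_square C (Ob c a) (Ob d a) (Ob c b) (Ob d b)
    (Rp (nat (d - c)) c a) (Vp (nat (b - a)) c a) (Vp (nat (b - a)) d a) (Rp (nat (d - c)) c b)"
proof -
  have M: "Rp (nat (d - c)) c a \<in> Mor C (Ob c a) (Ob d a)" "Vp (nat (b - a)) c a \<in> Mor C (Ob c a) (Ob c b)"
    "Vp (nat (b - a)) d a \<in> Mor C (Ob d a) (Ob d b)" "Rp (nat (d - c)) c b \<in> Mor C (Ob c b) (Ob d b)"
    using Rp_Mor[of "nat (d - c)" c a] Vp_Mor[of "nat (b - a)" c a] Vp_Mor[of "nat (b - a)" d a] Rp_Mor[of "nat (d - c)" c b] assms by simp_all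
  have z: "zero_object C (Ob x x)" "zero_object C (Ob (x + 4) x)" for x using zero_object_nil by (simp_all add: Ob_zero)
  consider "a = b" | "c = d" | "a < b" "b = c" "c < d" | "a < b" "b < c" "c < d" "d = a + 4" | "a < b" "b < c" "c < d" "d < a + 4"
    using assms by linarith
  then show ?thesis
  proof cases
    case 1
    then show ?thesis using weak_square_Idn_vertical[OF _ _ M(1)] by simp
  next
    case 2
    then show ?thesis using weak_square_swap[OF weak_square_Idn_vertical[OF _ _ M(2)]] by simp
  next
    case 3
    \<comment> \<open>For \<open>d = a + 4\<close> the middle object is zero too and no triangle
      enters; otherwise this is the first exact pair of the triangle on \<open>a\<close>,
      \<open>b\<close>, \<open>d\<close>.\<close>
    have "exact_pair (Ob c a) (Ob d a) (Ob d b) (Rp (nat (d - c)) c a) (Vp (nat (b - a)) d a)"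
    proof (cases "d = a + 4")
      case True
      then show ?thesis using M z(2)[of a] by (intro exact_pair_zero_middle) auto
    next
      case False
      then show ?thesis using exact_Rp_Vp(1)[of a b d] 3 assms by simp
    qed
    then show ?thesis using 3 M z(1)[of b] by (intro weak_square_zero_right) auto
  next
    case 4
    then show ?thesis using exact_Rp_Vp(2)[of a b c] M z(2)[of a] by (intro weak_square_zero_left) auto
  next
    case 5
    then have "b = a + 1" "c = a + 2" "d = a + 3" by linarith+
    then show ?thesis using weak_square_R_V[of a] Rp_1 Vp_1 by (simp del: Rp.simps Vp.simps)
  qed
qed

end

text \<open>The downward step is a premise of its own because it rests on a different fact: for
  morphisms it uses injectivity of the shift.\<close>

lemma int_shift_induct:
  fixes a :: int
  assumes "\<And>a. 0 \<le> a \<Longrightarrow> a \<le> 3 \<Longrightarrow> A a" "\<And>a. A a \<Longrightarrow> A (a + 4)" "\<And>a. A (a + 4) \<Longrightarrow> A a"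
  shows "A a"
proof -
  have "0 \<le> a mod 4" "a mod 4 \<le> 3" by presburger+
  then have 0: "A (a mod 4)" by (rule assms(1))
  have up: "A (x + 4 * int n) \<longleftrightarrow> A x" for x n
  proof (induction n)
    case (Suc n)
    have "x + 4 * int (Suc n) = (x + 4 * int n) + 4" by simp
    then show ?case using Suc assms(2,3) by metis
  qed simp
  show ?thesis
  proof (cases "a div 4 \<ge> 0")
    case True
    then obtain n where "a div 4 = int n" using nonneg_int_cases by blast
    then have "a = a mod 4 + 4 * int n" using mod_mult_div_eq[of a 4] by linarith
    then show ?thesis using up[of "a mod 4" n] 0 by simp
  next
    case False
    then obtain n where "- (a div 4) = int n" using nonneg_int_cases[of "- (a div 4)"] by auto
    then have "a mod 4 = a + 4 * int n" using mod_mult_div_eq[of a 4] by linarith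
    then show ?thesis using up[of a n] 0 by simp
  qed
qed

context octahedron begin

section \<open>The prescribed data in integer coordinates\<close>

lemma mat_arr_marr: "mat_arr p es fs L = marr es fs L"
  by (simp add: mat_arr_def marr_def)

lemma fr_int_pt: "int_pt 1 0 = fr 1 0" "int_pt 2 0 = fr 2 0" "int_pt 3 0 = fr 3 0" "int_pt 2 1 = fr 2 1"
  "int_pt 3 1 = fr 3 1" "int_pt 3 2 = fr 3 2" "int_pt 4 0 = fr1 0" "int_pt 4 1 = fr1 1" "int_pt 4 2 = fr1 2" "int_pt 4 3 = fr1 3"
  by (simp_all add: int_pt_def int_sym_def)

lemma triangle_part_diag: "int_pt a a \<in> triangle_part 3 \<longleftrightarrow> 0 \<le> a \<and> a \<le> 4"
proof -
  have D: "(0, 0) \<in> Dbar 3" "(0, 1) \<in> Dbar 3" and s: "sym_int (0, 0) = 0" "sym_int (0, 1) = 4"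
    by (simp_all add: Dbar_def sym_int_def)
  show ?thesis
    using int_pt_strip[of a a] sym_le_iff[OF D(1) int_sym_Dbar[of a]] sym_le_iff[OF int_sym_Dbar[of a] D(2)]
    by (auto simp: triangle_part_def int_pt_def s sym_le_def)
qed

lemma R_values: "R 1 0 = marr [3] [3] [[q]]" "R 2 0 = marr [3] [3] [[q]]" "R 2 1 = marr [1, 5] [2, 4] P"
  "R 3 1 = marr [2, 4] [3] [[- q], [1]]" "R 3 2 = marr [1, 5] [3] [[- (q ^ 2)], [1]]"
  by (simp_all add: R_def exps_def Let_def)

lemma V_values: "V 2 0 = marr [3] [1, 5] [[1, q ^ 2]]" "V 3 0 = marr [3] [2, 4] [[1, q]]" "V 3 1 = marr [2, 4] [1, 5] Q"
  "V 4 1 = marr [3] [3] [[q]]" "V 4 2 = marr [3] [3] [[q]]"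
  by (simp_all add: V_def exps_def Let_def)

lemma Ob_values: "Ob 1 0 = dsum 6 [3]" "Ob 2 0 = dsum 6 [3]" "Ob 3 0 = dsum 6 [3]" "Ob 4 1 = dsum 6 [3]" "Ob 4 2 = dsum 6 [3]"
  "Ob 4 3 = dsum 6 [3]" "Ob 2 1 = dsum 6 [1, 5]" "Ob 3 2 = dsum 6 [1, 5]" "Ob 3 1 = dsum 6 [2, 4]" "Ob 4 0 = dsum 6 []"
  by (simp_all add: Ob_def exps_def)

text \<open>The prescribed arrows are precisely the unit steps between nonzero objects of the
  triangle part, so they can be collected as values of \<open>R\<close> and
  \<open>V\<close>.\<close>

lemma octahedron_data_int:
  "octahedron_data p P Q X \<longleftrightarrow>
     (\<forall>a b. 0 \<le> a \<and> a \<le> b \<and> b \<le> 4 \<longrightarrow> DO X (int_pt b a) = Ob b a) \<and>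
     (\<forall>(b, a)\<in>{(1, 0), (2, 0), (2, 1), (3, 1), (3, 2)}. DM X (int_pt b a) (int_pt (b + 1) a) = R b a) \<and>
     (\<forall>(b, a)\<in>{(2, 0), (3, 0), (3, 1), (4, 1), (4, 2)}. DM X (int_pt b a) (int_pt b (a + 1)) = V b a)"
proof -
  have 1: "(\<forall>\<alpha>. (\<alpha>, \<alpha>) \<in> triangle_part 3 \<longrightarrow> DO X (\<alpha>, \<alpha>) = dsum 6 []) \<longleftrightarrow> (\<forall>a. 0 \<le> a \<and> a \<le> 4 \<longrightarrow> DO X (int_pt a a) = Ob a a)"
  proof (intro iffI allI impI)
    fix a :: int assume "\<forall>\<alpha>. (\<alpha>, \<alpha>) \<in> triangle_part 3 \<longrightarrow> DO X (\<alpha>, \<alpha>) = dsum 6 []" "0 \<le> a \<and> a \<le> 4"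
    then show "DO X (int_pt a a) = Ob a a" using triangle_part_diag[of a] unfolding int_pt_def Ob_zero by blast
  next
    fix \<alpha> assume *: "\<forall>a. 0 \<le> a \<and> a \<le> 4 \<longrightarrow> DO X (int_pt a a) = Ob a a" and \<alpha>: "(\<alpha>, \<alpha>) \<in> triangle_part 3"
    then have "\<alpha> \<in> Dbar 3" by (simp add: triangle_part_def strip_def)
    then have "int_pt (sym_int \<alpha>) (sym_int \<alpha>) = (\<alpha>, \<alpha>)" by (simp add: int_pt_def)
    then show "DO X (\<alpha>, \<alpha>) = dsum 6 []"
      using * \<alpha> triangle_part_diag[of "sym_int \<alpha>"] by (metis Ob_zero(1))
  qed
  have 2: "(\<forall>a b. 0 \<le> a \<and> a \<le> b \<and> b \<le> 4 \<longrightarrow> A b a) \<longleftrightarrow>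
    (\<forall>a. 0 \<le> a \<and> a \<le> 4 \<longrightarrow> A a a) \<and> A 4 0 \<and> A 1 0 \<and> A 2 0 \<and> A 3 0 \<and> A 4 1 \<and> A 4 2 \<and> A 4 3 \<and> A 2 1 \<and> A 3 2 \<and> A 3 1"
    (is "?L \<longleftrightarrow> ?R") for A :: "int \<Rightarrow> int \<Rightarrow> bool"
  proof
    assume R: ?R
    show ?L
    proof (intro allI impI)
      fix a b :: int assume ab: "0 \<le> a \<and> a \<le> b \<and> b \<le> 4"
      then have "a = b \<or> (b, a) \<in> {(4, 0), (1, 0), (2, 0), (3, 0), (4, 1), (4, 2), (4, 3), (2, 1), (3, 2), (3, 1)}" by (simp; presburger)
      then show "A b a" using R ab by auto
    qed
  qed simp
  show ?thesis
    unfolding octahedron_data_def Let_def 1 2[of "\<lambda>b a. DO X (int_pt b a) = Ob b a"]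
    by (simp add: fr_int_pt R_values V_values Ob_values mat_arr_marr conj_ac)
qed


text \<open>A path leaves the strip only if \<open>b' > a + 4\<close>, and it then meets zero
  objects. This agrees with functoriality on the strip, where such a morphism factors through the
  zero object at \<open>(a + 4, a)\<close>.\<close>

definition octahedron_diagram :: "(obj, arr) diagram" where
  "octahedron_diagram = \<lparr>DO = (\<lambda>(\<beta>, \<alpha>). Ob (sym_int \<beta>) (sym_int \<alpha>)),
     DM = (\<lambda>(\<beta>, \<alpha>) (\<delta>, \<gamma>). path (sym_int \<beta>) (sym_int \<alpha>) (sym_int \<delta>) (sym_int \<gamma>))\<rparr>"

lemma octahedron_diagram_int: "DO octahedron_diagram (int_pt b a) = Ob b a"
  "DM octahedron_diagram (int_pt b a) (int_pt b' a') = path b a b' a'"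
  by (simp_all add: octahedron_diagram_def int_pt_def)

lemma octahedron_diagram_data:
  "is_functor C 3 octahedron_diagram" "periodic C 3 octahedron_diagram" "octahedron_data p P Q octahedron_diagram"
proof -
  show "is_functor C 3 octahedron_diagram"
    unfolding is_functor_int octahedron_diagram_int using path_Mor path_Idn path_Cmp by simp
  show "periodic C 3 octahedron_diagram"
    unfolding periodic_int octahedron_diagram_int ShM_eq ShO_eq using shift_path rev_Ob by simp
  have "path b a (b + 1) a = R b a" "path b a b (a + 1) = V b a" for b a
    using path_R[of b "b + 1" a] path_V[of a "a + 1" b] Rp_1[of b a] Vp_1[of b a] by (simp_all del: Rp.simps Vp.simps add: One_nat_def)
  then show "octahedron_data p P Q octahedron_diagram"
    unfolding octahedron_data_int octahedron_diagram_int by auto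
qed

section \<open>Every diagram with the prescribed data agrees with the model\<close>

context
  fixes X :: "(obj, arr) diagram"
  assumes X: "is_functor C 3 X" "periodic C 3 X" "octahedron_data p P Q X"
begin

lemma X_Mor:
  assumes "a \<le> b" "b \<le> a + 4" "a' \<le> b'" "b' \<le> a' + 4" "a \<le> a'" "b \<le> b'"
  shows "DM X (int_pt b a) (int_pt b' a') \<in> Mor C (DO X (int_pt b a)) (DO X (int_pt b' a'))"
  using X(1) assms unfolding is_functor_int by blast

lemma X_Cmp:
  assumes "a \<le> b" "b \<le> a + 4" "a' \<le> b'" "b' \<le> a' + 4" "a'' \<le> b''" "b'' \<le> a'' + 4" "a \<le> a'" "b \<le> b'" "a' \<le> a''" "b' \<le> b''"
  shows "Cmp C (DM X (int_pt b a) (int_pt b' a')) (DM X (int_pt b' a') (int_pt b'' a'')) = DM X (int_pt b a) (int_pt b'' a'')"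
  using X(1) assms unfolding is_functor_int by blast

lemma X_Idn: "a \<le> b \<Longrightarrow> b \<le> a + 4 \<Longrightarrow> DM X (int_pt b a) (int_pt b a) = Idn C (DO X (int_pt b a))"
  using X(1) unfolding is_functor_int by blast

lemma X_shift_DO: "a \<le> b \<Longrightarrow> b \<le> a + 4 \<Longrightarrow> DO X (int_pt (a + 4) b) = rev (DO X (int_pt b a))"
  using X(2) unfolding periodic_int ShO_eq by blast

lemma X_shift_DM:
  assumes "a \<le> b" "b \<le> a + 4" "a' \<le> b'" "b' \<le> a' + 4" "a \<le> a'" "b \<le> b'"
  shows "DM X (int_pt (a + 4) b) (int_pt (a' + 4) b') = stable_shift p 6 (DM X (int_pt b a) (int_pt b' a'))"
  using X(2) assms unfolding periodic_int ShM_eq by blast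

lemma X_DO:
  assumes "a \<le> b" "b \<le> a + 4"
  shows "DO X (int_pt b a) = Ob b a"
proof -
  have tri: "DO X (int_pt b a) = Ob b a" if "0 \<le> a" "a \<le> b" "b \<le> 4" for a b
    using X(3) that unfolding octahedron_data_int by blast
  have per: "DO X (int_pt (b + 4) (a + 4)) = DO X (int_pt b a)" if "a \<le> b" "b \<le> a + 4" for a b
    using X_shift_DO[of b "a + 4"] X_shift_DO[of a b] that by simp
  have perO: "Ob (b + 4) (a + 4) = Ob b a" for a b
    using rev_Ob[of "a + 4" b] rev_Ob[of b a] rev_rev_ident by metis
  have "\<forall>b. a \<le> b \<and> b \<le> a + 4 \<longrightarrow> DO X (int_pt b a) = Ob b a"
  proof (rule int_shift_induct[of _ a])
    fix a :: int assume a: "0 \<le> a" "a \<le> 3"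
    show "\<forall>b. a \<le> b \<and> b \<le> a + 4 \<longrightarrow> DO X (int_pt b a) = Ob b a"
    proof (intro allI impI)
      fix b assume b: "a \<le> b \<and> b \<le> a + 4"
      show "DO X (int_pt b a) = Ob b a"
      proof (cases "b \<le> 4")
        case True
        then show ?thesis using tri a b by blast
      next
        case False
        \<comment> \<open>For \<open>b > 4\<close> the point \<open>(b, a)\<close> is the shift of
          \<open>(a, b - 4)\<close>, which lies in the triangle part.\<close>
        then have "DO X (int_pt (b - 4 + 4) a) = rev (Ob a (b - 4))"
          using a b X_shift_DO[of "b - 4" a] tri[of "b - 4" a] by simp
        then show ?thesis using rev_Ob[of a "b - 4"] by simp
      qed
    qed
  next
    fix a assume *: "\<forall>b. a \<le> b \<and> b \<le> a + 4 \<longrightarrow> DO X (int_pt b a) = Ob b a"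
    show "\<forall>b. a + 4 \<le> b \<and> b \<le> a + 4 + 4 \<longrightarrow> DO X (int_pt b (a + 4)) = Ob b (a + 4)"
    proof (intro allI impI)
      fix b assume b: "a + 4 \<le> b \<and> b \<le> a + 4 + 4"
      define c where "c = b - 4"
      have "a \<le> c" "c \<le> a + 4" "b = c + 4" using b by (simp_all add: c_def)
      then show "DO X (int_pt b (a + 4)) = Ob b (a + 4)" using per[of a c] perO[of c a] * by metis
    qed
  next
    fix a assume *: "\<forall>b. a + 4 \<le> b \<and> b \<le> a + 4 + 4 \<longrightarrow> DO X (int_pt b (a + 4)) = Ob b (a + 4)"
    show "\<forall>b. a \<le> b \<and> b \<le> a + 4 \<longrightarrow> DO X (int_pt b a) = Ob b a"
    proof (intro allI impI)
      fix b assume b: "a \<le> b \<and> b \<le> a + 4"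
      then have "DO X (int_pt (b + 4) (a + 4)) = Ob (b + 4) (a + 4)" using * by simp
      then show "DO X (int_pt b a) = Ob b a" using per[of a b] perO[of b a] b by metis
    qed
  qed
  then show ?thesis using assms by blast
qed

definition elementary :: "int \<Rightarrow> bool" where
  "elementary a \<longleftrightarrow>
    (\<forall>b. a \<le> b \<and> b + 1 \<le> a + 4 \<longrightarrow> DM X (int_pt b a) (int_pt (b + 1) a) = R b a) \<and>
    (\<forall>b. a + 1 \<le> b \<and> b \<le> a + 4 \<longrightarrow> DM X (int_pt b a) (int_pt b (a + 1)) = V b a)"

text \<open>Apart from the prescribed steps, the source or the target is a zero object, and then
  both morphisms are the zero morphism.\<close>

lemma elementary_triangle:
  assumes "0 \<le> a"
  shows "a \<le> b \<Longrightarrow> b + 1 \<le> 4 \<Longrightarrow> DM X (int_pt b a) (int_pt (b + 1) a) = R b a"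
    and "a + 1 \<le> b \<Longrightarrow> b \<le> 4 \<Longrightarrow> DM X (int_pt b a) (int_pt b (a + 1)) = V b a"
proof -
  assume b: "a \<le> b" "b + 1 \<le> 4"
  have M: "DM X (int_pt b a) (int_pt (b + 1) a) \<in> Mor C (Ob b a) (Ob (b + 1) a)"
    using X_Mor[of a b a "b + 1"] X_DO[of a b] X_DO[of a "b + 1"] b assms by simp
  have "b = a \<or> (b = 3 \<and> a = 0) \<or> (b, a) \<in> {(1, 0), (2, 0), (2, 1), (3, 1), (3, 2)}"
    using b assms by (simp; presburger)
  then consider "b = a" | "b = 3" "a = 0" | "(b, a) \<in> {(1, 0), (2, 0), (2, 1), (3, 1), (3, 2)}" by blast
  then show "DM X (int_pt b a) (int_pt (b + 1) a) = R b a"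
  proof cases
    case 1
    then show ?thesis
      using zero_object_from[OF zero_object_nil _ M[unfolded 1 Ob_zero]] R_V_zero(1)[of b a] by (simp add: Ob_zero)
  next
    case 2
    have "zero_object C (Ob (b + 1) a)" using zero_object_nil by (simp add: 2 Ob_values)
    from zero_object_to[OF this _ M] show ?thesis using R_V_zero(1)[of b a] 2 by simp
  next
    case 3
    then show ?thesis using X(3) unfolding octahedron_data_int by blast
  qed
next
  assume b: "a + 1 \<le> b" "b \<le> 4"
  have M: "DM X (int_pt b a) (int_pt b (a + 1)) \<in> Mor C (Ob b a) (Ob b (a + 1))"
    using X_Mor[of a b "a + 1" b] X_DO[of a b] X_DO[of "a + 1" b] b assms by simp
  have "b = a + 1 \<or> (b = 4 \<and> a = 0) \<or> (b, a) \<in> {(2, 0), (3, 0), (3, 1), (4, 1), (4, 2)}"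
    using b assms by (simp; presburger)
  then consider "b = a + 1" | "b = 4" "a = 0" | "(b, a) \<in> {(2, 0), (3, 0), (3, 1), (4, 1), (4, 2)}" by blast
  then show "DM X (int_pt b a) (int_pt b (a + 1)) = V b a"
  proof cases
    case 1
    have "zero_object C (Ob b (a + 1))" using zero_object_nil by (simp add: 1 Ob_zero)
    from zero_object_to[OF this _ M] show ?thesis using R_V_zero(2)[of b a] 1 by simp
  next
    case 2
    have "zero_object C (Ob b a)" using zero_object_nil by (simp add: 2 Ob_values)
    from zero_object_from[OF this _ M] show ?thesis using R_V_zero(2)[of b a] 2 by simp
  next
    case 3
    then show ?thesis using X(3) unfolding octahedron_data_int by blast
  qed
qed

lemma shift_shift_R: "stable_shift p 6 (stable_shift p 6 (R b a)) = R (b + 4) (a + 4)"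
  and shift_shift_V: "stable_shift p 6 (stable_shift p 6 (V b a)) = V (b + 4) (a + 4)"
  by (simp_all add: shift_R shift_V)

lemma shift_shift_inj:
  assumes "F \<in> Mor C (Ob b a) (Ob b' a')" "G \<in> Mor C (Ob b a) (Ob b' a')"
    and "stable_shift p 6 (stable_shift p 6 F) = stable_shift p 6 (stable_shift p 6 G)"
  shows "F = G"
proof -
  note S = stable_shift_Mor[OF Ob_E_obj Ob_E_obj assms(1), unfolded rev_Ob] stable_shift_Mor[OF Ob_E_obj Ob_E_obj assms(2), unfolded rev_Ob]
  have "stable_shift p 6 F = stable_shift p 6 G" by (rule stable_shift_inj[OF Ob_E_obj Ob_E_obj S assms(3)])
  then show ?thesis by (rule stable_shift_inj[OF Ob_E_obj Ob_E_obj assms(1,2)])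
qed

lemma X_shift_shift_DM:
  assumes "a \<le> b" "b \<le> a + 4" "a' \<le> b'" "b' \<le> a' + 4" "a \<le> a'" "b \<le> b'"
  shows "DM X (int_pt (b + 4) (a + 4)) (int_pt (b' + 4) (a' + 4)) = stable_shift p 6 (stable_shift p 6 (DM X (int_pt b a) (int_pt b' a')))"
  using X_shift_DM[OF assms] X_shift_DM[of b "a + 4" b' "a' + 4"] assms by simp

text \<open>Positions from 0 to 3 reduce to the triangle part by at most one shift. The double shift
  then moves by a whole period, and its injectivity on morphisms permits the step to smaller
  positions.\<close>

lemma elementary_all: "elementary a"
proof (rule int_shift_induct[of elementary a])
  fix a :: int assume a: "0 \<le> a" "a \<le> 3"
  show "elementary a"
    unfolding elementary_def
  proof (intro conjI allI impI)
    fix b assume b: "a \<le> b \<and> b + 1 \<le> a + 4"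
    show "DM X (int_pt b a) (int_pt (b + 1) a) = R b a"
    proof (cases "b + 1 \<le> 4")
      case True
      then show ?thesis using elementary_triangle(1)[OF a(1)] b by blast
    next
      case False
      define c where "c = b - 4"
      have c: "0 \<le> c" "c + 1 \<le> a" "a \<le> 4" "b = c + 4" "b + 1 = c + 1 + 4" "a \<le> c + 4" using a b False by (simp_all add: c_def)
      have "DM X (int_pt (c + 4) a) (int_pt (c + 1 + 4) a) = stable_shift p 6 (DM X (int_pt a c) (int_pt a (c + 1)))"
        using c by (intro X_shift_DM) auto
      also have "\<dots> = R (c + 4) a" using elementary_triangle(2)[OF c(1,2,3)] by (simp add: shift_V)
      finally show ?thesis using c(4,5) by metis
    qed
  next
    fix b assume b: "a + 1 \<le> b \<and> b \<le> a + 4"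
    show "DM X (int_pt b a) (int_pt b (a + 1)) = V b a"
    proof (cases "b \<le> 4")
      case True
      then show ?thesis using elementary_triangle(2)[OF a(1)] b by blast
    next
      case False
      define c where "c = b - 4"
      have c: "0 \<le> c" "c \<le> a" "a + 1 \<le> 4" "b = c + 4" "a + 1 \<le> c + 4" using a b False by (simp_all add: c_def)
      have "DM X (int_pt (c + 4) a) (int_pt (c + 4) (a + 1)) = stable_shift p 6 (DM X (int_pt a c) (int_pt (a + 1) c))"
        using c by (intro X_shift_DM) auto
      also have "\<dots> = V (c + 4) a" using elementary_triangle(1)[OF c(1,2,3)] by (simp add: shift_R)
      finally show ?thesis by (simp only: c)
    qed
  qed
next
  fix a assume e: "elementary a"
  show "elementary (a + 4)"
    unfolding elementary_def
  proof (intro conjI allI impI)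
    fix b assume b: "a + 4 \<le> b \<and> b + 1 \<le> a + 4 + 4"
    define c where "c = b - 4"
    have c: "a \<le> c" "c + 1 \<le> a + 4" "b = c + 4" "b + 1 = c + 1 + 4" using b by (simp_all add: c_def)
    have "DM X (int_pt (c + 4) (a + 4)) (int_pt (c + 1 + 4) (a + 4)) = R (c + 4) (a + 4)"
      using X_shift_shift_DM[of a c a "c + 1"] e c(1,2) by (simp add: elementary_def shift_shift_R)
    then show "DM X (int_pt b (a + 4)) (int_pt (b + 1) (a + 4)) = R b (a + 4)" using c(3,4) by metis
  next
    fix b assume b: "a + 4 + 1 \<le> b \<and> b \<le> a + 4 + 4"
    define c where "c = b - 4"
    have c: "a + 1 \<le> c" "c \<le> a + 4" "b = c + 4" using b by (simp_all add: c_def)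
    have "DM X (int_pt (c + 4) (a + 4)) (int_pt (c + 4) (a + 1 + 4)) = V (c + 4) (a + 4)"
      using X_shift_shift_DM[of a c "a + 1" c] e c(1,2) by (simp add: elementary_def shift_shift_V)
    moreover have "a + 4 + 1 = a + 1 + 4" by simp
    ultimately show "DM X (int_pt b (a + 4)) (int_pt b (a + 4 + 1)) = V b (a + 4)" unfolding c by metis
  qed
next
  fix a assume e: "elementary (a + 4)"
  show "elementary a"
    unfolding elementary_def
  proof (intro conjI allI impI)
    fix b assume b: "a \<le> b \<and> b + 1 \<le> a + 4"
    show "DM X (int_pt b a) (int_pt (b + 1) a) = R b a"
    proof (rule shift_shift_inj[OF _ R_Mor])
      show "DM X (int_pt b a) (int_pt (b + 1) a) \<in> Mor C (Ob b a) (Ob (b + 1) a)"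
        using X_Mor[of a b a "b + 1"] X_DO[of a b] X_DO[of a "b + 1"] b by simp
      have "b + 4 + 1 = b + 1 + 4" by simp
      then have "DM X (int_pt (b + 4) (a + 4)) (int_pt (b + 1 + 4) (a + 4)) = R (b + 4) (a + 4)"
        using e[unfolded elementary_def, THEN conjunct1, rule_format, of "b + 4"] b by simp
      then show "stable_shift p 6 (stable_shift p 6 (DM X (int_pt b a) (int_pt (b + 1) a))) = stable_shift p 6 (stable_shift p 6 (R b a))"
        using X_shift_shift_DM[of a b a "b + 1"] b by (simp add: shift_shift_R)
    qed
  next
    fix b assume b: "a + 1 \<le> b \<and> b \<le> a + 4"
    show "DM X (int_pt b a) (int_pt b (a + 1)) = V b a"
    proof (rule shift_shift_inj[OF _ V_Mor])
      show "DM X (int_pt b a) (int_pt b (a + 1)) \<in> Mor C (Ob b a) (Ob b (a + 1))"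
        using X_Mor[of a b "a + 1" b] X_DO[of a b] X_DO[of "a + 1" b] b by simp
      have "a + 4 + 1 = a + 1 + 4" by simp
      then have "DM X (int_pt (b + 4) (a + 4)) (int_pt (b + 4) (a + 1 + 4)) = V (b + 4) (a + 4)"
        using e[unfolded elementary_def, THEN conjunct2, rule_format, of "b + 4"] b by simp
      then show "stable_shift p 6 (stable_shift p 6 (DM X (int_pt b a) (int_pt b (a + 1)))) = stable_shift p 6 (stable_shift p 6 (V b a))"
        using X_shift_shift_DM[of a b "a + 1" b] b by (simp add: shift_shift_V)
    qed
  qed
qed

text \<open>Functoriality of \<open>X\<close> is available only on the strip; the bound keeps all
  intermediate points there.\<close>

lemma X_Rp: "a \<le> b \<Longrightarrow> b + int n \<le> a + 4 \<Longrightarrow> DM X (int_pt b a) (int_pt (b + int n) a) = Rp n b a"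
proof (induction n)
  case 0
  then show ?case by (simp add: X_Idn X_DO)
next
  case (Suc n)
  have e: "b + int (Suc n) = b + int n + 1" by simp
  have "DM X (int_pt (b + int n) a) (int_pt (b + int n + 1) a) = R (b + int n) a"
    using elementary_all[of a] Suc.prems unfolding elementary_def by simp
  moreover have "Cmp C (DM X (int_pt b a) (int_pt (b + int n) a)) (DM X (int_pt (b + int n) a) (int_pt (b + int n + 1) a)) =
      DM X (int_pt b a) (int_pt (b + int n + 1) a)"
    using Suc.prems by (intro X_Cmp) auto
  ultimately show ?case using Suc unfolding e Rp.simps(2) by simp
qed

lemma X_Vp: "a + int n \<le> b \<Longrightarrow> b \<le> a + 4 \<Longrightarrow> DM X (int_pt b a) (int_pt b (a + int n)) = Vp n b a"
proof (induction n)
  case 0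
  then show ?case by (simp add: X_Idn X_DO)
next
  case (Suc n)
  have e: "a + int (Suc n) = a + int n + 1" by simp
  have "DM X (int_pt b (a + int n)) (int_pt b (a + int n + 1)) = V b (a + int n)"
    using elementary_all[of "a + int n"] Suc.prems unfolding elementary_def by simp
  moreover have "Cmp C (DM X (int_pt b a) (int_pt b (a + int n))) (DM X (int_pt b (a + int n)) (int_pt b (a + int n + 1))) =
      DM X (int_pt b a) (int_pt b (a + int n + 1))"
    using Suc.prems by (intro X_Cmp) auto
  ultimately show ?case using Suc unfolding e Vp.simps(2) by simp
qed

lemma X_DM_R: "a \<le> b \<Longrightarrow> b \<le> c \<Longrightarrow> c \<le> a + 4 \<Longrightarrow> DM X (int_pt b a) (int_pt c a) = Rp (nat (c - b)) b a"
  using X_Rp[of a b "nat (c - b)"] by simp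

lemma X_DM_V: "a \<le> b \<Longrightarrow> b \<le> c \<Longrightarrow> c \<le> a + 4 \<Longrightarrow> DM X (int_pt c a) (int_pt c b) = Vp (nat (b - a)) c a"
  using X_Vp[of a "nat (b - a)" c] by simp

lemma X_pretriangle: "pretriangle C 3 X"
proof (rule pretriangle_intI[OF X(1)])
  show "zero_object C (DO X (int_pt a a)) \<and> zero_object C (DO X (int_pt (a + 4) a))" for a
    using zero_object_nil by (simp_all add: X_DO Ob_zero)
  fix a b c d :: int assume "a \<le> b \<and> b \<le> c \<and> c \<le> d \<and> d \<le> a + 4"
  then show "weak_square C (DO X (int_pt c a)) (DO X (int_pt d a)) (DO X (int_pt c b)) (DO X (int_pt d b))
        (DM X (int_pt c a) (int_pt d a)) (DM X (int_pt c a) (int_pt c b))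
        (DM X (int_pt d a) (int_pt d b)) (DM X (int_pt c b) (int_pt d b))"
    using weak_square_Rp_Vp[of a b c d] by (simp add: X_DO X_DM_R X_DM_V)
qed

text \<open>By periodicity \<open>d\<close> is determined by the integers \<open>a\<close>,
  \<open>b\<close>, \<open>c\<close> belonging to the images of 0, 1, 2. Injectivity makes
  \<open>a < b < c < a + 4\<close> strict, as \<open>dist_Rp_Vp\<close> requires.\<close>

lemma X_distinguished:
  assumes d: "periodic_monotone 2 3 d" "inj_on d (Dbar 2)"
  shows "distinguished_triangle C (pullback_diagram X d)"
proof -
  have D2: "(0, 0) \<in> Dbar 2" "(1, 0) \<in> Dbar 2" "(2, 0) \<in> Dbar 2" "(0, 1) \<in> Dbar 2" by (simp_all add: Dbar_def)
  have le: "(0, 0) \<preceq> (1, 0)" "(1, 0) \<preceq> (2, 0)" "(2, 0) \<preceq> (0, 1)" by (simp_all add: sym_le_def)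
  define a b c where abc: "a = sym_int (d (0, 0))" "b = sym_int (d (1, 0))" "c = sym_int (d (2, 0))"
  have D3: "d (0, 0) \<in> Dbar 3" "d (1, 0) \<in> Dbar 3" "d (2, 0) \<in> Dbar 3" "d (0, 1) \<in> Dbar 3"
    using d D2 by (auto simp: periodic_monotone_def)
  have "d (sym_shift 1 (0, 0)) = sym_shift 1 (d (0, 0))" using d D2 by (auto simp: periodic_monotone_def)
  then have d01: "sym_int (d (0, 1)) = a + 4" by (simp add: abc sym_shift_def sym_int_def)
  have m: "d (0, 0) \<preceq> d (1, 0)" "d (1, 0) \<preceq> d (2, 0)" "d (2, 0) \<preceq> d (0, 1)"
    using d D2 le unfolding periodic_monotone_def by blast+
  have i: "d (0, 0) = int_sym a" "d (1, 0) = int_sym b" "d (2, 0) = int_sym c" "d (0, 1) = int_sym (a + 4)"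
    using int_sym_sym_int[OF D3(4)] D3 unfolding d01 by (simp_all add: abc)
  have "d (0, 0) \<noteq> d (1, 0)" "d (1, 0) \<noteq> d (2, 0)" "d (2, 0) \<noteq> d (0, 1)"
    using inj_onD[OF d(2)] D2 by (metis prod.inject zero_neq_one zero_neq_numeral one_eq_numeral_iff num.distinct(1))+
  then have "a \<noteq> b" "b \<noteq> c" "c \<noteq> a + 4" unfolding i by auto
  moreover have "a \<le> b" "b \<le> c" "c \<le> a + 4" using m D3 by (simp_all add: sym_le_iff abc d01)
  ultimately have lt: "a < b" "b < c" "c < a + 4" by simp_all
  have "stable_dist p 6 (DM X (int_pt b a) (int_pt c a)) (DM X (int_pt c a) (int_pt c b)) (DM X (int_pt c b) (int_pt (a + 4) b))"
    using dist_Rp_Vp[OF lt] lt by (simp add: X_DM_R X_DM_V)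
  then have "Dist C (DM (pullback_diagram X d) (fr 1 0) (fr 2 0)) (DM (pullback_diagram X d) (fr 2 0) (fr 2 1)) (DM (pullback_diagram X d) (fr 2 1) (fr1 1))"
    by (simp add: Dist_eq pullback_diagram_def i int_pt_def)
  then show ?thesis
    unfolding distinguished_triangle_def using pullback_pretriangle[OF d(1) X_pretriangle] pullback_periodic[OF d(1) X(2)] by blast
qed

lemma X_verdier_octahedron: "verdier_octahedron C X"
  unfolding verdier_octahedron_def using X_pretriangle X(2) X_distinguished by blast

end
end

theorem lemma3p1:
  fixes p :: nat
  assumes "prime p" and "p \<ge> 2"
  shows "(\<exists>X. is_X p X) \<and> (\<exists>X. is_Xtilde p X) \<and>
         (\<forall>X. is_X p X \<longrightarrow> verdier_octahedron (stable_cat p 6) X) \<and>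
         (\<forall>X. is_Xtilde p X \<longrightarrow> verdier_octahedron (stable_cat p 6) X)"
proof -
  have "0 < p" using assms(2) by simp
  then interpret O0: octahedron p 0 + O1: octahedron p 1 by unfold_locales
  \<comment> \<open>The family has the entry \<open>- t\<close>; writing \<open>- 0\<close> makes
    the data match the instance \<open>t = 0\<close> literally.\<close>
  have X: "is_X p X \<longleftrightarrow> is_functor (stable_cat p 6) 3 X \<and> periodic (stable_cat p 6) 3 X \<and>
      octahedron_data p [[int p, 0], [0, 1]] [[1, 0], [- 0, int p]] X" for X
    by (simp add: is_X_def)
  show ?thesis
    unfolding X is_Xtilde_def
    using O0.octahedron_diagram_data O1.octahedron_diagram_data O0.X_verdier_octahedron O1.X_verdier_octahedron by blast
qed

end
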